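(* Let $K$ be a field, let $a\ge1$, $n\ge1$, $b\ge 3$ be integers, and let $G_{a,b,n}=\overline{K}_a\nabla(nB_b)$. Then $$\mathrm{reg}(nB_b)=2n\qquad\text{and}\qquad \mathrm{reg}(G_{a,b,n})=2n.$$
   Context: All graphs are finite, simple and undirected. For $b\ge 2$, $B_b$ is the graph with vertices $x_1,\dots,x_b,y_1,\dots,y_b$ and edges $\{x_i,x_j\}$ and $\{y_i,y_j\}$ for $1\le i<j\le b$, and $\{x_i,y_i\}$ for $1\le i\le b$. $nB_b$ is the disjoint union of $n$ copies of $B_b$. The join $G\nabla H$ of graphs on disjoint vertex sets is obtained from the disjoint union by adding every edge between $V(G)$ and $V(H)$. $\overline{K}_a$ is the edgeless graph on $a$ vertices. For a graph $G$, $R_G$ is the standard graded polynomial ring over $K$ whose variables are the vertices of $G$, $I(G)=(xy:\{x,y\}\in E(G))\subseteq R_G$ is the edge ideal, and $\mathrm{reg}(G):=\mathrm{reg}(R_G/I(G))=\max\{d-i:\beta_{i,d}(R_G/I(G))\ne0\}$ is the Castelnuovo–Mumford regularity of the quotient ring. *)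

theory Defs
  imports "HOL-Library.Poly_Mapping" "Jordan_Normal_Form.Matrix"
begin

section \<open>Graphs\<close>

record 'v graph =
  verts :: "'v set"
  edges :: "'v set set"

text \<open>The vertices $x_i$ and $y_i$ of $B_b$ are \<open>Inl i\<close> and \<open>Inr i\<close>.\<close>

definition graph_B :: "nat \<Rightarrow> (nat + nat) graph" where
  "graph_B b =
    \<lparr> verts = Inl ` {1..b} \<union> Inr ` {1..b},
      edges = {{Inl i, Inl j} | i j. 1 \<le> i \<and> i < j \<and> j \<le> b}
            \<union> {{Inr i, Inr j} | i j. 1 \<le> i \<and> i < j \<and> j \<le> b}
            \<union> {{Inl i, Inr i} | i. 1 \<le> i \<and> i \<le> b} \<rparr>"

definition copies :: "nat \<Rightarrow> 'v graph \<Rightarrow> (nat \<times> 'v) graph" where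
  "copies n G =
    \<lparr> verts = {1..n} \<times> verts G,
      edges = {Pair k ` e | k e. k \<in> {1..n} \<and> e \<in> edges G} \<rparr>"

definition edgeless :: "nat \<Rightarrow> nat graph" where
  "edgeless a = \<lparr> verts = {1..a}, edges = {} \<rparr>"

text \<open>The sum type makes the two vertex sets disjoint.\<close>

definition graph_join :: "'u graph \<Rightarrow> 'v graph \<Rightarrow> ('u + 'v) graph" where
  "graph_join G H =
    \<lparr> verts = Inl ` verts G \<union> Inr ` verts H,
      edges = (\<lambda>e. Inl ` e) ` edges G \<union> (\<lambda>e. Inr ` e) ` edges H
            \<union> {{Inl u, Inr v} | u v. u \<in> verts G \<and> v \<in> verts H} \<rparr>"


section \<open>Polynomial rings and edge ideals\<close>

type_synonym ('v, 'k) mpoly = "('v \<Rightarrow>\<^sub>0 nat) \<Rightarrow>\<^sub>0 'k"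

text \<open>
  The polynomial ring $K[V]$ is a subring of the type, since the vertex sets depend on
  numerical parameters and are not types.
\<close>

definition poly_ring :: "'v set \<Rightarrow> ('v, 'k::zero) mpoly set" where
  "poly_ring V = {p. \<forall>m \<in> Poly_Mapping.keys p. Poly_Mapping.keys m \<subseteq> V}"

definition var :: "'v \<Rightarrow> ('v, 'k::zero_neq_one) mpoly" where
  "var v = Poly_Mapping.single (Poly_Mapping.single v 1) 1"

definition mon_deg :: "('v \<Rightarrow>\<^sub>0 nat) \<Rightarrow> nat" where
  "mon_deg m = (\<Sum>v \<in> Poly_Mapping.keys m. Poly_Mapping.lookup m v)"

definition ideal_generated :: "'v set \<Rightarrow> ('v, 'k::comm_ring_1) mpoly set \<Rightarrow> ('v, 'k) mpoly set" where
  "ideal_generated V S =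
    {(\<Sum>g\<in>T. c g * g) | T c. finite T \<and> T \<subseteq> S \<and> (\<forall>g\<in>T. c g \<in> poly_ring V)}"

definition edge_ideal :: "'v graph \<Rightarrow> ('v, 'k::field) mpoly set" where
  "edge_ideal G = ideal_generated (verts G) {var x * var y | x y. {x, y} \<in> edges G}"


section \<open>Graded Betti numbers and regularity of quotient rings\<close>

definition free_module :: "'v set \<Rightarrow> nat \<Rightarrow> ('v, 'k::zero) mpoly vec set" where
  "free_module V r = {f \<in> carrier_vec r. \<forall>j<r. f $ j \<in> poly_ring V}"

text \<open>
  Matrices (acting on column vectors) of homogeneous $R$-linear maps of degree $0$ from
  $\bigoplus_k R(-t_k)$ to $\bigoplus_j R(-s_j)$, where $R = K[V]$: the entry in row $j$ and
  column $k$ is zero or homogeneous of degree $t_k - s_j$.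
\<close>

definition graded_maps :: "'v set \<Rightarrow> nat list \<Rightarrow> nat list \<Rightarrow> ('v, 'k::zero) mpoly mat set" where
  "graded_maps V t s = {A \<in> carrier_mat (length s) (length t).
     \<forall>j < length s. \<forall>k < length t. A $$ (j, k) \<in> poly_ring V \<and>
       (\<forall>m \<in> Poly_Mapping.keys (A $$ (j, k)). mon_deg m + s ! j = t ! k)}"

text \<open>
  A minimal graded free resolution
  $\cdots \to F_2 \to F_1 \to F_0 \to R/I \to 0$ over $R = K[V]$, where $F_i$ is the direct sum
  of the modules $R(-d)$ for $d$ in the list \<open>s i\<close>. The matrix \<open>D (Suc i)\<close> is the differential
  $F_{i+1} \to F_i$, while \<open>D 0\<close> is a lift $F_0 \to R$ of the augmentation $F_0 \to R/I$.
  Minimality is $\partial F_{i+1} \subseteq \mathfrak{m} F_i$, that is, no entry of a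
  differential has a constant term. No shift below $0$ can occur, as $R/I$ lives in
  nonnegative degrees.
\<close>

definition minimal_graded_free_resolution ::
  "'v set \<Rightarrow> ('v, 'k::field) mpoly set \<Rightarrow> (nat \<Rightarrow> nat list) \<Rightarrow> (nat \<Rightarrow> ('v, 'k) mpoly mat) \<Rightarrow> bool"
where
  "minimal_graded_free_resolution V I s D \<longleftrightarrow>
    (let F = (\<lambda>i. free_module V (length (s i))) in
      D 0 \<in> graded_maps V (s 0) [0] \<and>
      (\<forall>i. D (Suc i) \<in> graded_maps V (s (Suc i)) (s i)) \<and>
      (\<forall>p \<in> poly_ring V. \<exists>f \<in> F 0. p - (D 0 *\<^sub>v f) $ 0 \<in> I) \<and>
      (\<lambda>f. D 1 *\<^sub>v f) ` F 1 = {f \<in> F 0. (D 0 *\<^sub>v f) $ 0 \<in> I} \<and>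
      (\<forall>i. (\<lambda>f. D (Suc (Suc i)) *\<^sub>v f) ` F (Suc (Suc i)) =
           {f \<in> F (Suc i). D (Suc i) *\<^sub>v f = 0\<^sub>v (length (s i))}) \<and>
      (\<forall>i. \<forall>j < length (s i). \<forall>k < length (s (Suc i)).
           Poly_Mapping.lookup (D (Suc i) $$ (j, k)) 0 = 0))"

text \<open>
  The graded Betti number $\beta_{i,d}(R/I)$ is the number of summands $R(-d)$ of $F_i$. For
  finite \<open>V\<close> and a homogeneous ideal \<open>I\<close>, a minimal graded free resolution exists and is
  unique up to isomorphism, so the choice does not matter.
\<close>

definition graded_betti :: "'v set \<Rightarrow> ('v, 'k::field) mpoly set \<Rightarrow> nat \<Rightarrow> nat \<Rightarrow> nat" where
  "graded_betti V I i d =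
    count_list ((SOME s. \<exists>D. minimal_graded_free_resolution V I s D) i) d"

definition quotient_reg :: "'v set \<Rightarrow> ('v, 'k::field) mpoly set \<Rightarrow> int" where
  "quotient_reg V I = Max {int d - int i | i d. graded_betti V I i d \<noteq> 0}"

definition graph_reg :: "'k::field itself \<Rightarrow> 'v graph \<Rightarrow> int" where
  "graph_reg K G = quotient_reg (verts G) (edge_ideal G :: ('v, 'k) mpoly set)"

end

theory Submission
  imports Defs "HOL-Library.Function_Algebras"
begin

text \<open>
  The shifts in a minimal graded free resolution of $R/I$ are detected by Koszul homology: as
  free modules are Koszul acyclic, dimension shifting along the syzygies identifies
  $H_i(x; R/I)_d$ with the degree $d$ minimal generators of the $i$-th syzygy module. A vanishing bound
  on Koszul homology also bounds the degrees of these generators, so that minimal resolutions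
  exist without appeal to the Hilbert basis theorem.

  For an edge ideal, $H_i(x; R/I)$ splits into multidegrees. If the exponent of a variable is at
  least $2$, multiplication by that variable can be contracted. In a squarefree multidegree one
  sees cochains of the independence complex, whose faces have at most $2n$ elements unless they
  lie in the simplex $\overline{K}_a$, where any vertex gives a contraction; hence the regularity
  is at most $2n$. Conversely, the independence complex of $nB_3$, an induced subgraph, is the
  join of $n$ hexagons, a sphere of dimension $2n-1$: pairing with its fundamental cycle shows
  that the cochain of a single facet is not a coboundary.
\<close>

section \<open>Koszul homology and dimension shifting\<close>

text \<open>Betti numbers are read off a resolution selected by \<open>SOME\<close>, so two facts
  are needed: a minimal resolution exists, and its shifts do not depend on the choice. Koszul
  homology serves both, since it does not mention a resolution and its degree 0 part is the module
  modulo the multiples of the variables, where Nakayama's lemma finds the minimal generators. The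
  regularity asks only whether a shift occurs, so a criterion for membership in \<open>s i\<close>
  suffices and no dimension is computed. The differences \<open>d - i\<close> lie in
  \<open>{0..B}\<close> for all \<open>i\<close> together, which makes the maximum one over a finite
  set.

  The hypothesis b \<ge> 3 enters through the lower bound. The independence complex of B_b is the
  complete bipartite graph on the x_i and the y_j without the perfect matching. For b = 3 this is a
  hexagon; for b = 2 it is two disjoint edges, without a cycle. The fundamental cycle of the join is
  given by explicit signs. Since characteristic 2 is allowed, where a sum equal to its own negative
  need not vanish, cancellation is always arranged pair by pair.\<close>

lemma sum_antisymmetric_zero:
  fixes g :: "'a \<Rightarrow> 'a \<Rightarrow> 'm::ab_group_add"
  assumes "finite A" and "\<And>v w. v \<in> A \<Longrightarrow> w \<in> A \<Longrightarrow> v \<noteq> w \<Longrightarrow> g v w = - g w v"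
  shows "(\<Sum>v\<in>A. \<Sum>w\<in>A - {v}. g v w) = 0"
  using assms
\<comment> \<open>Exchanging the two summations would only show that the sum is its own negative.
  Adding one index at a time cancels a row against the matching column.\<close>
proof (induction A rule: finite_induct)
  case (insert x A)
  have "(\<Sum>w\<in>insert x A - {v}. g v w) = g v x + (\<Sum>w\<in>A - {v}. g v w)" if "v \<in> A" for v
  proof -
    have "insert x A - {v} = insert x (A - {v})" using that insert.hyps by auto
    then show ?thesis using insert.hyps by simp
  qed
  moreover have "insert x A - {x} = A" using insert.hyps by auto
  moreover have "(\<Sum>w\<in>A. g x w) = - (\<Sum>v\<in>A. g v x)"
    unfolding sum_negf[symmetric] using insert.hyps by (intro sum.cong) (auto intro!: insert.prems)
  moreover have "(\<Sum>v\<in>A. \<Sum>w\<in>A - {v}. g v w) = 0"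
    by (intro insert.IH insert.prems) auto
  ultimately show ?case
    using insert.hyps by (simp add: sum.distrib)
qed simp

locale koszul =
  fixes V :: "'v set" and ord :: "'v \<Rightarrow> nat"
  assumes fin [simp]: "finite V" and inj_ord: "inj_on ord V"
begin

text \<open>The usual Koszul sign, applied as a choice between \<open>a\<close> and
  \<open>- a\<close> so that chains can take values in any abelian group. The order comes from a map
  into the naturals because vertex types carry no order of their own.\<close>

definition sgs :: "'v \<Rightarrow> 'v set \<Rightarrow> 'm::ab_group_add \<Rightarrow> 'm" where
  "sgs v S a = (if even (card {w \<in> S. ord w < ord v}) then a else - a)"

lemma sgs_0 [simp]: "sgs v S 0 = 0" by (simp add: sgs_def)
lemma sgs_sgs [simp]: "sgs v S (sgs v S a) = a" by (simp add: sgs_def)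
lemma sgs_diff: "sgs v S (a - b) = sgs v S a - sgs v S b" by (simp add: sgs_def)
lemma sgs_sum: "sgs v S (sum f A) = (\<Sum>x\<in>A. sgs v S (f x))"
  by (simp add: sgs_def sum_negf)
lemma sgs_apply: "sgs v S f x = sgs v S (f x)" by (simp add: sgs_def)

lemma sgs_insert:
  assumes "v \<notin> S" "finite S"
  shows "sgs w (insert v S) a = (if ord v < ord w then - sgs w S a else sgs w S a)"
proof -
  have "{u \<in> insert v S. ord u < ord w} =
      (if ord v < ord w then insert v {u \<in> S. ord u < ord w} else {u \<in> S. ord u < ord w})"
    by auto
  then show ?thesis
    unfolding sgs_def using assms by simp
qed

text \<open>Inserting the earlier of \<open>v\<close> and \<open>w\<close> changes the sign of the
  later one, but not the other way round, so exactly one of the two sides picks up an extra sign.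
  This is what makes \<open>bd\<close> square to 0.\<close>

lemma sgs_swap:
  assumes "v \<in> V" "w \<in> V" "v \<noteq> w" "v \<notin> S" "w \<notin> S" "finite S"
  shows "sgs v S (sgs w (insert v S) a) = - sgs w S (sgs v (insert w S) a)"
proof -
  have "ord v \<noteq> ord w" using assms inj_ord by (auto dest: inj_onD)
  then show ?thesis
    using assms by (auto simp: sgs_insert) (auto simp: sgs_def)
qed

text \<open>The Koszul differential written coefficientwise: a chain stores at \<open>T\<close> its
  coefficient of the exterior monomial of \<open>T\<close>, and the coefficient of the boundary at
  \<open>S\<close> collects what remains of each \<open>insert v S\<close> after contracting
  \<open>v\<close>.\<close>

definition bd :: "('v \<Rightarrow> 'm \<Rightarrow> 'm) \<Rightarrow> ('v set \<Rightarrow> 'm::ab_group_add) \<Rightarrow> 'v set \<Rightarrow> 'm" where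
  "bd X c S = (if S \<subseteq> V then \<Sum>v\<in>V - S. sgs v S (X v (c (insert v S))) else 0)"

text \<open>Values off the subsets of size \<open>j\<close> are fixed to 0, so that equality of
  chains is equality of functions.\<close>

definition chains :: "nat \<Rightarrow> 'm set \<Rightarrow> ('v set \<Rightarrow> 'm::ab_group_add) set" where
  "chains j N = {c. (\<forall>T. T \<subseteq> V \<and> card T = j \<longrightarrow> c T \<in> N) \<and>
     (\<forall>T. \<not> (T \<subseteq> V \<and> card T = j) \<longrightarrow> c T = 0)}"

text \<open>\<open>M e\<close> is the degree \<open>e\<close> part and \<open>X v\<close> the multiplication by the variable \<open>v\<close>, required to be additive and commuting on the whole type.\<close>

definition gmod :: "('v \<Rightarrow> 'm \<Rightarrow> 'm) \<Rightarrow> (int \<Rightarrow> 'm::ab_group_add set) \<Rightarrow> bool" where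
  "gmod X M \<longleftrightarrow> (\<forall>v a b. X v (a + b) = X v a + X v b) \<and> (\<forall>v w a. X v (X w a) = X w (X v a))
     \<and> (\<forall>e. 0 \<in> M e) \<and> (\<forall>e. \<forall>a\<in>M e. \<forall>b\<in>M e. a - b \<in> M e)
     \<and> (\<forall>e. \<forall>v\<in>V. \<forall>a\<in>M e. X v a \<in> M (e + 1))"

definition gmap :: "('v \<Rightarrow> 'm \<Rightarrow> 'm) \<Rightarrow> (int \<Rightarrow> 'm::ab_group_add set) \<Rightarrow>
    ('v \<Rightarrow> 'n \<Rightarrow> 'n) \<Rightarrow> (int \<Rightarrow> 'n::ab_group_add set) \<Rightarrow> ('m \<Rightarrow> 'n) \<Rightarrow> bool" where
  "gmap X M Y N \<phi> \<longleftrightarrow> (\<forall>a b. \<phi> (a + b) = \<phi> a + \<phi> b) \<and> (\<forall>v a. \<phi> (X v a) = Y v (\<phi> a))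
     \<and> (\<forall>e. \<forall>a\<in>M e. \<phi> a \<in> N e)"

text \<open>Vanishing of the $j$-th Koszul homology of \<open>M\<close> in total degree $j + e$.\<close>

definition van :: "('v \<Rightarrow> 'm \<Rightarrow> 'm) \<Rightarrow> nat \<Rightarrow> int \<Rightarrow> (int \<Rightarrow> 'm::ab_group_add set) \<Rightarrow> bool" where
  "van X j e M \<longleftrightarrow> (\<forall>c\<in>chains j (M e). bd X c = (\<lambda>_. 0) \<longrightarrow>
     (\<exists>b\<in>chains (Suc j) (M (e - 1)). bd X b = c))"

section \<open>Additive maps and graded modules\<close>

lemma additive_simps:
  assumes "\<And>a b. f (a + b) = f a + (f b :: 'm::ab_group_add)"
  shows additive_0: "f 0 = 0" and additive_uminus: "f (- a) = - f (a :: 'n::ab_group_add)"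
    and additive_diff: "f (a - b) = f a - f b"
    and additive_sum: "f (sum g A) = (\<Sum>x\<in>A. f (g x))"
proof -
  show 0: "f 0 = 0" using assms[of 0 0] by simp
  show u: "f (- a) = - f a" for a using assms[of a "- a"] 0 by (simp add: eq_neg_iff_add_eq_0 add.commute)
  show "f (a - b) = f a - f b" using assms[of a "- b"] u by simp
  show "f (sum g A) = (\<Sum>x\<in>A. f (g x))"
    by (induction A rule: infinite_finite_induct) (simp_all add: 0 assms)
qed

lemma additive_sgs:
  assumes "\<And>a b. f (a + b) = f a + (f b :: 'm::ab_group_add)"
  shows "f (sgs v S a) = sgs v S (f (a :: 'n::ab_group_add))"
  by (simp add: sgs_def additive_uminus[OF assms])

lemma gmod_add: "gmod X M \<Longrightarrow> X v (a + b) = X v a + X v b" by (simp add: gmod_def)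
lemma gmod_0: "gmod X M \<Longrightarrow> X v 0 = 0" using additive_0[of "X v"] by (simp add: gmod_def)
lemma gmod_diff: "gmod X M \<Longrightarrow> X v (a - b) = X v a - X v b"
  using additive_diff[of "X v"] by (simp add: gmod_def)

lemma gmod_sub:
  assumes "gmod X M"
  shows gmod_0_in: "0 \<in> M e" and gmod_diff_in: "a \<in> M e \<Longrightarrow> b \<in> M e \<Longrightarrow> a - b \<in> M e"
    and gmod_sgs_in: "a \<in> M e \<Longrightarrow> sgs v S a \<in> M e"
    and gmod_X_in: "v \<in> V \<Longrightarrow> a \<in> M e \<Longrightarrow> X v a \<in> M (e + 1)"
    and gmod_sum_in: "(\<And>x. x \<in> A \<Longrightarrow> g x \<in> M e) \<Longrightarrow> sum g A \<in> M e"
proof -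
  show 0: "0 \<in> M e" and d: "\<And>a b. a \<in> M e \<Longrightarrow> b \<in> M e \<Longrightarrow> a - b \<in> M e"
    and "v \<in> V \<Longrightarrow> a \<in> M e \<Longrightarrow> X v a \<in> M (e + 1)"
    using assms by (auto simp: gmod_def)
  have u: "\<And>a. a \<in> M e \<Longrightarrow> - a \<in> M e" using d[OF 0] by simp
  have s: "\<And>a b. a \<in> M e \<Longrightarrow> b \<in> M e \<Longrightarrow> a + b \<in> M e" using d u by fastforce
  show "a \<in> M e \<Longrightarrow> sgs v S a \<in> M e" using u by (simp add: sgs_def)
  show "(\<And>x. x \<in> A \<Longrightarrow> g x \<in> M e) \<Longrightarrow> sum g A \<in> M e"
    by (induction A rule: infinite_finite_induct) (auto simp: 0 intro: s)
qed

lemma bd_diff: "gmod X M \<Longrightarrow> bd X (\<lambda>S. b S - c S) = (\<lambda>S. bd X b S - bd X c S)"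
  by (auto simp: bd_def fun_eq_iff gmod_diff sgs_diff sum_subtractf)

lemma bd_bd:
  assumes "gmod X M"
  shows "bd X (bd X c) = (\<lambda>_. 0)"
proof
  fix S
  show "bd X (bd X c) S = 0"
  proof (cases "S \<subseteq> V")
    case True
    then have finS: "finite S" using fin finite_subset by blast
    define g where "g v w = sgs v S (sgs w (insert v S) (X v (X w (c (insert w (insert v S))))))" for v w
    have X: "X v (a + b) = X v a + X v b" for v a b using assms by (rule gmod_add)
    have "bd X (bd X c) S = (\<Sum>v\<in>V - S. \<Sum>w\<in>(V - S) - {v}. g v w)"
      unfolding bd_def g_def
      using True by (auto simp: sgs_sum additive_sum[where f = "X _", OF X] additive_sgs[where f = "X _", OF X]
          Diff_insert[symmetric] intro!: sum.cong)
    also have "\<dots> = 0"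
    proof (rule sum_antisymmetric_zero)
      fix v w assume "v \<in> V - S" "w \<in> V - S" "v \<noteq> w"
      moreover have "X v (X w a) = X w (X v a)" for a using assms by (auto simp: gmod_def)
      ultimately show "g v w = - g w v"
        unfolding g_def by (simp add: sgs_swap[OF _ _ _ _ _ finS, of v w] insert_commute)
    qed simp
    finally show ?thesis .
  qed (simp add: bd_def)
qed

section \<open>Chains and maps between them\<close>

lemma chainsD: "c \<in> chains j N \<Longrightarrow> T \<subseteq> V \<Longrightarrow> card T = j \<Longrightarrow> c T \<in> N"
  by (auto simp: chains_def split: if_splits)

lemma chains_eq_0: "c \<in> chains j N \<Longrightarrow> \<not> (T \<subseteq> V \<and> card T = j) \<Longrightarrow> c T = 0"
  by (auto simp: chains_def)

lemma chains_0: "0 \<in> N \<Longrightarrow> (\<lambda>_. 0) \<in> chains j N" by (auto simp: chains_def)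

lemma chains_diff:
  "gmod X M \<Longrightarrow> b \<in> chains j (M e) \<Longrightarrow> c \<in> chains j (M e) \<Longrightarrow> (\<lambda>S. b S - c S) \<in> chains j (M e)"
  by (auto simp: chains_def gmod_diff_in)

lemma bd_chains:
  assumes "gmod X M" "c \<in> chains (Suc j) (M e)"
  shows "bd X c \<in> chains j (M (e + 1))"
proof -
  have "bd X c T \<in> M (e + 1)" if "T \<subseteq> V" "card T = j" for T
  proof -
    have "finite T" using that fin finite_subset by blast
    then show ?thesis unfolding bd_def using that assms(2)
      by (auto intro!: gmod_sum_in[OF assms(1)] gmod_sgs_in[OF assms(1)] gmod_X_in[OF assms(1)]
          intro: chainsD)
  qed
  moreover have "bd X c T = 0" if T: "\<not> (T \<subseteq> V \<and> card T = j)" for T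
  proof (cases "T \<subseteq> V")
    case True
    then have "finite T" using fin finite_subset by blast
    then have "c (insert v T) = 0" if "v \<in> V - T" for v
      using that T True by (intro chains_eq_0[OF assms(2)]) auto
    then show ?thesis by (simp add: bd_def gmod_0[OF assms(1)])
  qed (simp add: bd_def)
  ultimately show ?thesis by (auto simp: chains_def)
qed

lemma bd_0_eq_0:
  assumes "gmod X M" "c \<in> chains 0 N"
  shows "bd X c = (\<lambda>_. 0)"
proof
  fix S
  have "c (insert v S) = 0" if "S \<subseteq> V" for v 
    using that finite_subset[OF that fin] by (intro chains_eq_0[OF assms(2)]) auto
  then show "bd X c S = 0" by (simp add: bd_def gmod_0[OF assms(1)])
qed

lemma bd_map:
  assumes "gmap X M Y N \<phi>"
  shows "bd Y (\<lambda>S. \<phi> (c S)) = (\<lambda>S. \<phi> (bd X c S))"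
proof -
  have a: "\<phi> (a + b) = \<phi> a + \<phi> b" for a b using assms by (auto simp: gmap_def)
  have "\<phi> (X v a) = Y v (\<phi> a)" for v a using assms by (auto simp: gmap_def)
  then show ?thesis
    by (auto simp: bd_def additive_sum[OF a] additive_sgs[OF a] additive_0[OF a])
qed

lemma map_chains:
  assumes "gmap X M Y N \<phi>" "c \<in> chains j (M e)"
  shows "(\<lambda>S. \<phi> (c S)) \<in> chains j (N e)"
proof -
  have a: "\<phi> (a + b) = \<phi> a + \<phi> b" for a b using assms by (auto simp: gmap_def)
  show ?thesis using assms by (auto simp: chains_def gmap_def additive_0[OF a])
qed

lemma lift_chain:
  assumes "gmap X F Y M \<phi>" "\<phi> ` F e = M e" "c \<in> chains j (M e)"
  obtains b where "b \<in> chains j (F e)" "(\<lambda>S. \<phi> (b S)) = c"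
proof -
  have a: "\<phi> (a + b) = \<phi> a + \<phi> b" for a b using assms by (auto simp: gmap_def)
  have "\<exists>x. (if T \<subseteq> V \<and> card T = j then x \<in> F e else x = 0) \<and> \<phi> x = c T" for T
  proof (cases "T \<subseteq> V \<and> card T = j")
    case True
    then have "c T \<in> \<phi> ` F e" using assms chainsD by metis
    then show ?thesis using True by auto
  next
    case False
    then show ?thesis using chains_eq_0[OF assms(3)] additive_0[OF a] by auto
  qed
  then obtain b where "\<forall>T. (if T \<subseteq> V \<and> card T = j then b T \<in> F e else b T = 0) \<and> \<phi> (b T) = c T"
    by metis
  then show thesis by (intro that[of b]) (auto simp: chains_def)
qed

lemma gmap_ker_gmod:
  assumes "gmod X F" "gmod Y M" "gmap X F Y M \<phi>"
  shows "gmod X (\<lambda>e. {z \<in> F e. \<phi> z = 0})"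
proof -
  have a: "\<phi> (a + b) = \<phi> a + \<phi> b" for a b using assms by (auto simp: gmap_def)
  have x: "\<phi> (X v a) = Y v (\<phi> a)" for v a using assms by (auto simp: gmap_def)
  show ?thesis using assms(1)
    by (auto simp: gmod_def additive_0[OF a] additive_diff[OF a] x gmod_0[OF assms(2)])
qed

text \<open>Dimension shifting along $0 \to Z \to F \to M \to 0$ with $F$ Koszul acyclic.\<close>

lemma van_shift:
  assumes F: "gmod X F" and M: "gmod Y M" and \<phi>: "gmap X F Y M \<phi>"
    and surj: "\<And>e. \<phi> ` F e = M e"
    and Z: "Z = (\<lambda>e. {z \<in> F e. \<phi> z = 0})"
    and ex: "\<And>j e. van X (Suc j) e F"
    and min: "\<And>e c. c \<in> chains 0 (Z e) \<Longrightarrow> \<exists>b\<in>chains (Suc 0) (F (e - 1)). bd X b = c"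
  shows "van Y (Suc j) e M \<longleftrightarrow> van X j (e + 1) Z"
proof
  have a: "\<phi> (a + b) = \<phi> a + \<phi> b" for a b using \<phi> by (auto simp: gmap_def)
  have ZF: "c \<in> chains j (F e)" and Z0: "\<phi> (c S) = 0" if "c \<in> chains j (Z e)" for c j e S
  proof -
    show "\<phi> (c S) = 0"
      using chainsD[OF that, of S] chains_eq_0[OF that, of S] additive_0[of \<phi>, OF a]
      by (cases "S \<subseteq> V \<and> card S = j") (auto simp: Z)
    show "c \<in> chains j (F e)" using that by (auto simp: chains_def Z)
  qed
  have ZI: "c \<in> chains j (Z e)" if "c \<in> chains j (F e)" "\<And>S. \<phi> (c S) = 0" for c j e
    using that by (auto simp: chains_def Z)
  {
    assume v: "van Y (Suc j) e M"
    show "van X j (e + 1) Z"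
      unfolding van_def
    proof safe
      fix c assume c: "c \<in> chains j (Z (e + 1))" "bd X c = (\<lambda>_. 0)"
      have "\<exists>b\<in>chains (Suc j) (F e). bd X b = c"
      \<comment> \<open>Acyclicity of \<open>F\<close> covers only positive homological degrees. In
        degree 0 the bounding chain comes from \<open>min\<close>, which says that \<open>Z\<close>
        lies in the span of the multiples of the variables.\<close>
      proof (cases j)
        case 0
        then show ?thesis using min[of c "e + 1"] c by simp
      next
        case (Suc i)
        then show ?thesis using ex[of i "e + 1"] c(2) ZF[OF c(1)] by (auto simp: van_def)
      qed
      then obtain b where b: "b \<in> chains (Suc j) (F e)" "bd X b = c" by auto
      have "bd Y (\<lambda>S. \<phi> (b S)) = (\<lambda>_. 0)"
        using b Z0[OF c(1)] by (simp add: bd_map[OF \<phi>])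
      then obtain g where g: "g \<in> chains (Suc (Suc j)) (M (e - 1))" "bd Y g = (\<lambda>S. \<phi> (b S))"
        using v map_chains[OF \<phi> b(1)] by (auto simp: van_def)
      obtain h where h: "h \<in> chains (Suc (Suc j)) (F (e - 1))" "(\<lambda>S. \<phi> (h S)) = g"
        using lift_chain[OF \<phi> surj g(1)] by blast
      \<comment> \<open>\<open>b\<close> bounds \<open>c\<close> but may leave the kernel. Its image
        under \<phi> is a cycle, hence a boundary by assumption; subtracting the boundary of a
        lifted bounding chain moves \<open>b\<close> into the kernel without changing its own
        boundary.\<close>
      let ?z = "\<lambda>S. b S - bd X h S"
      have "bd X h \<in> chains (Suc j) (F e)" using bd_chains[OF F h(1)] by simp
      then have "?z \<in> chains (Suc j) (F e)" using chains_diff[OF F b(1)] by simp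
      moreover have "\<phi> (?z S) = 0" for S
        using fun_cong[OF g(2), of S] h(2) bd_map[OF \<phi>, of h] by (simp add: additive_diff[OF a])
      moreover have "bd X ?z = c" using b(2) by (simp add: bd_diff[OF F] bd_bd[OF F])
      ultimately show "\<exists>b\<in>chains (Suc j) (Z (e + 1 - 1)). bd X b = c"
        using ZI[of ?z] by (intro bexI[of _ ?z]) auto
    qed
  next
    assume v: "van X j (e + 1) Z"
    show "van Y (Suc j) e M"
      unfolding van_def
    proof safe
      fix c assume c: "c \<in> chains (Suc j) (M e)" "bd Y c = (\<lambda>_. 0)"
      obtain b where b: "b \<in> chains (Suc j) (F e)" "(\<lambda>S. \<phi> (b S)) = c"
        using lift_chain[OF \<phi> surj c(1)] by blast
      \<comment> \<open>The connecting homomorphism: the boundary of a lift of a cycle lies in the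
        kernel. If some \<open>z\<close> there has the same boundary, then \<open>b - z\<close> is a
        cycle in the acyclic module, and the image of a bounding chain bounds
        \<open>c\<close>.\<close>
      have "bd X b \<in> chains j (F (e + 1))" using bd_chains[OF F b(1)] by simp
      moreover have "\<phi> (bd X b S) = 0" for S
        using b(2) c(2) fun_cong[OF bd_map[OF \<phi>, of b], of S] by simp
      ultimately have "bd X b \<in> chains j (Z (e + 1))" using ZI by blast
      then obtain z where z: "z \<in> chains (Suc j) (Z e)" "bd X z = bd X b"
        using v bd_bd[OF F, of b] by (auto simp: van_def)
      have "(\<lambda>S. b S - z S) \<in> chains (Suc j) (F e)"
        using chains_diff[OF F b(1) ZF[OF z(1)]] .
      moreover have "bd X (\<lambda>S. b S - z S) = (\<lambda>_. 0)" by (simp add: bd_diff[OF F] z(2))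
      ultimately obtain h where h: "h \<in> chains (Suc (Suc j)) (F (e - 1))" "bd X h = (\<lambda>S. b S - z S)"
        using ex[of j e] by (auto simp: van_def)
      have "bd Y (\<lambda>S. \<phi> (h S)) = (\<lambda>S. \<phi> (b S) - \<phi> (z S))"
        using bd_map[OF \<phi>, of h] h(2) by (simp add: additive_diff[OF a])
      moreover have "\<phi> (z S) = 0" for S using Z0[OF z(1)] .
      ultimately have "bd Y (\<lambda>S. \<phi> (h S)) = c" using b(2) by simp
      then show "\<exists>b\<in>chains (Suc (Suc j)) (M (e - 1)). bd Y b = c"
        using map_chains[OF \<phi> h(1)] by blast
    qed
  }
qed

end


section \<open>Quotients by monomial ideals\<close>

definition xvar :: "'v \<Rightarrow> 'v \<Rightarrow>\<^sub>0 nat" where "xvar v = Poly_Mapping.single v 1"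

lemma lookup_xvar: "Poly_Mapping.lookup (xvar v) w = (if w = v then 1 else 0)"
  by (simp add: xvar_def lookup_single when_def)

lemma minus_xvar_add: "Poly_Mapping.lookup m v \<noteq> 0 \<Longrightarrow> m - xvar v + xvar v = m"
  by (rule poly_mapping_eqI) (auto simp: lookup_add lookup_minus lookup_xvar)

lemma add_minus_xvar: "m + xvar v - xvar v = m"
  by (rule poly_mapping_eqI) (auto simp: lookup_add lookup_minus lookup_xvar)

lemma keys_nat_add: "Poly_Mapping.keys (m + m' :: 'v \<Rightarrow>\<^sub>0 nat) = Poly_Mapping.keys m \<union> Poly_Mapping.keys m'"
  by (auto simp: in_keys_iff lookup_add)

lemma keys_xvar [simp]: "Poly_Mapping.keys (xvar v) = {v}" by (simp add: xvar_def)

lemma mon_deg_sum: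
  assumes "finite A" "Poly_Mapping.keys m \<subseteq> A"
  shows "mon_deg m = (\<Sum>v\<in>A. Poly_Mapping.lookup m v)"
  unfolding mon_deg_def using assms
  by (intro sum.mono_neutral_left) (auto simp: in_keys_iff)

lemma mon_deg_add: "mon_deg (m + m') = mon_deg m + mon_deg m'"
proof -
  let ?A = "Poly_Mapping.keys m \<union> Poly_Mapping.keys m'"
  have "mon_deg (m + m') = (\<Sum>v\<in>?A. Poly_Mapping.lookup (m + m') v)"
    by (rule mon_deg_sum) (auto simp: keys_nat_add)
  also have "\<dots> = mon_deg m + mon_deg m'"
    by (simp add: lookup_add sum.distrib mon_deg_sum[of ?A m] mon_deg_sum[of ?A m'])
  finally show ?thesis .
qed

lemma mon_deg_xvar [simp]: "mon_deg (xvar v) = 1" by (simp add: xvar_def mon_deg_def)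

lemma mon_deg_0 [simp]: "mon_deg 0 = 0" by (simp add: mon_deg_def)

lemma mon_deg_eq_0_iff [simp]: "mon_deg m = 0 \<longleftrightarrow> m = 0"
  by (auto simp: mon_deg_def in_keys_iff) (metis lookup_zero poly_mapping_eqI)

lemma finite_monomials:
  assumes "finite A"
  shows "finite {m :: 'v \<Rightarrow>\<^sub>0 nat. Poly_Mapping.keys m \<subseteq> A \<and> mon_deg m \<le> d}"
proof -
  let ?M = "{m :: 'v \<Rightarrow>\<^sub>0 nat. Poly_Mapping.keys m \<subseteq> A \<and> mon_deg m \<le> d}"
  have "Poly_Mapping.lookup ` ?M \<subseteq> {f. \<forall>v. (v \<in> A \<longrightarrow> f v \<in> {..d}) \<and> (v \<notin> A \<longrightarrow> f v = 0)}"
  proof -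
    have *: "(v \<in> A \<longrightarrow> Poly_Mapping.lookup m v \<in> {..d}) \<and> (v \<notin> A \<longrightarrow> Poly_Mapping.lookup m v = 0)"
      if m: "Poly_Mapping.keys m \<subseteq> A" "mon_deg m \<le> d" for m :: "'v \<Rightarrow>\<^sub>0 nat" and v
    proof (intro conjI impI)
      show "Poly_Mapping.lookup m v \<in> {..d}" if "v \<in> A"
        using m that member_le_sum[of v A "Poly_Mapping.lookup m"] by (simp add: mon_deg_sum[OF assms] assms)
      show "Poly_Mapping.lookup m v = 0" if "v \<notin> A" using that m by (auto simp: in_keys_iff)
    qed
    show ?thesis
      by (rule image_subsetI) (use * in simp)
  qed
  moreover have "finite {f. \<forall>v. (v \<in> A \<longrightarrow> f v \<in> {..d}) \<and> (v \<notin> A \<longrightarrow> f v = (0::nat))}"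
    using assms by (intro finite_set_of_finite_funs) auto
  ultimately have "finite (Poly_Mapping.lookup ` ?M)" by (rule finite_subset)
  moreover have "inj_on Poly_Mapping.lookup ?M" by (auto intro!: inj_onI poly_mapping_eqI)
  ultimately show ?thesis by (rule finite_imageD)
qed

text \<open>Monomials are exponent vectors, so \<open>m + m'\<close> is a product: the complement of
  such a set is the set of monomials of a monomial ideal.\<close>

definition down_closed :: "('v \<Rightarrow>\<^sub>0 nat) set \<Rightarrow> bool" where
  "down_closed Std \<longleftrightarrow> (\<forall>m m'. m + m' \<in> Std \<longrightarrow> m \<in> Std)"

lemma down_closed_minus: "down_closed Std \<Longrightarrow> m \<in> Std \<Longrightarrow> m - xvar v \<in> Std"
  unfolding down_closed_def
proof -
  assume D: "\<forall>m m'. m + m' \<in> Std \<longrightarrow> m \<in> Std" and m: "m \<in> Std"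
  show "m - xvar v \<in> Std"
  proof (cases "Poly_Mapping.lookup m v = 0")
    case True
    then have "m - xvar v = m" by (intro poly_mapping_eqI) (auto simp: lookup_minus lookup_xvar)
    then show ?thesis using m by simp
  next
    case False
    then show ?thesis using D m minus_xvar_add[OF False] by metis
  qed
qed

text \<open>
  The quotient of the polynomial ring by a monomial ideal, with basis the monomials in \<open>Std\<close>;
  an element is the function of its coefficients.
\<close>

definition smul :: "('v \<Rightarrow>\<^sub>0 nat) set \<Rightarrow> 'v \<Rightarrow> (('v \<Rightarrow>\<^sub>0 nat) \<Rightarrow> 'k::field) \<Rightarrow> ('v \<Rightarrow>\<^sub>0 nat) \<Rightarrow> 'k" where
  "smul Std v f = (\<lambda>m. if m \<in> Std \<and> Poly_Mapping.lookup m v \<noteq> 0 then f (m - xvar v) else 0)"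

lemma sum_fun_apply: "(sum f A) x = (\<Sum>i\<in>A. f i x)"
  by (induction A rule: infinite_finite_induct) auto

context koszul
begin

definition stdmod :: "('v \<Rightarrow>\<^sub>0 nat) set \<Rightarrow> int \<Rightarrow> (('v \<Rightarrow>\<^sub>0 nat) \<Rightarrow> 'k::field) set" where
  "stdmod Std e = {f. \<forall>m. f m \<noteq> 0 \<longrightarrow> m \<in> Std \<and> Poly_Mapping.keys m \<subseteq> V \<and> int (mon_deg m) = e}"

lemma smul_commute:
  assumes "down_closed Std"
  shows "smul Std v (smul Std w f) = smul Std w (smul Std v f)"
proof
  fix m
  have "m - xvar v - xvar w = m - xvar w - xvar v"
    by (intro poly_mapping_eqI) (simp add: lookup_minus)
  then show "smul Std v (smul Std w f) m = smul Std w (smul Std v f) m"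
    by (auto simp: smul_def down_closed_minus[OF assms] lookup_minus lookup_xvar split: if_splits)
qed

lemma stdmod_gmod:
  assumes "down_closed Std"
  shows "gmod (smul Std) (stdmod Std)"
proof -
  have "smul Std v (a + b) = smul Std v a + smul Std v b" for v and a b :: "('v \<Rightarrow>\<^sub>0 nat) \<Rightarrow> 'k::field"
    by (auto simp: smul_def fun_eq_iff)
  moreover have "smul Std v a \<in> stdmod Std (e + 1)" if a: "a \<in> stdmod Std e" and v: "v \<in> V"
    for v e and a :: "('v \<Rightarrow>\<^sub>0 nat) \<Rightarrow> 'k::field"
    unfolding stdmod_def
  proof safe
    fix m assume "smul Std v a m \<noteq> 0"
    then have m: "m \<in> Std" "Poly_Mapping.lookup m v \<noteq> 0" "a (m - xvar v) \<noteq> 0"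
      by (auto simp: smul_def split: if_splits)
    then have *: "Poly_Mapping.keys (m - xvar v) \<subseteq> V" "int (mon_deg (m - xvar v)) = e"
      using a by (auto simp: stdmod_def)
    show "m \<in> Std" by fact
    show "x \<in> V" if "x \<in> Poly_Mapping.keys m" for x
      using that *(1) v keys_nat_add[of "m - xvar v" "xvar v"] minus_xvar_add[OF m(2)] by auto
    show "int (mon_deg m) = e + 1"
      using *(2) mon_deg_add[of "m - xvar v" "xvar v"] minus_xvar_add[OF m(2)] by simp
  qed
  moreover have "a - b \<in> stdmod Std e" if "a \<in> stdmod Std e" "b \<in> stdmod Std e"
    for e and a b :: "('v \<Rightarrow>\<^sub>0 nat) \<Rightarrow> 'k::field"
  proof -
    have "(a - b) m \<noteq> 0 \<Longrightarrow> a m \<noteq> 0 \<or> b m \<noteq> 0" for m by auto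
    then show ?thesis using that unfolding stdmod_def by blast
  qed
  moreover have "0 \<in> stdmod Std e" for e by (simp add: stdmod_def)
  ultimately show ?thesis
    unfolding gmod_def using smul_commute[OF assms] by blast
qed

text \<open>The multidegree of the monomial \<open>m\<close> times the exterior monomial of
  \<open>S\<close>. It is preserved by \<open>bd\<close>, which moves one variable from the exterior
  part into the monomial.\<close>

definition mdeg :: "'v set \<Rightarrow> ('v \<Rightarrow>\<^sub>0 nat) \<Rightarrow> 'v \<Rightarrow> nat" where
  "mdeg S m = (\<lambda>w. Poly_Mapping.lookup m w + (if w \<in> S then 1 else 0))"

lemma bd_smul_apply:
  "bd (smul Std) c S m = (if S \<subseteq> V \<and> m \<in> Std
     then \<Sum>w\<in>{w \<in> V - S. Poly_Mapping.lookup m w \<noteq> 0}. sgs w S (c (insert w S) (m - xvar w)) else 0)"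
proof (cases "S \<subseteq> V \<and> m \<in> Std")
  case True
  then have "bd (smul Std) c S m =
      (\<Sum>w\<in>V - S. sgs w S (if Poly_Mapping.lookup m w \<noteq> 0 then c (insert w S) (m - xvar w) else 0))"
    by (simp add: bd_def sum_fun_apply sgs_apply smul_def)
  also have "\<dots> = (\<Sum>w\<in>V - S. if Poly_Mapping.lookup m w \<noteq> 0 then sgs w S (c (insert w S) (m - xvar w)) else 0)"
    by (intro sum.cong) auto
  also have "\<dots> = (\<Sum>w\<in>{w \<in> V - S. Poly_Mapping.lookup m w \<noteq> 0}. sgs w S (c (insert w S) (m - xvar w)))"
    by (subst sum.inter_filter) auto
  finally show ?thesis using True by simp
next
  case False
  then show ?thesis by (auto simp: bd_def sum_fun_apply sgs_apply smul_def)
qed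

text \<open>
  In each multidegree \<open>u\<close> separately, dividing the monomial by a variable \<open>v\<close> and moving \<open>v\<close>
  into the exterior part is a contracting homotopy, provided that multiplication by \<open>v\<close> does
  not leave \<open>Std\<close> in this multidegree.
\<close>

lemma van_contract:
  assumes D: "down_closed Std"
    and ch: "\<And>u. \<exists>v. \<forall>S m. S \<subseteq> V \<and> card S = j \<and> m \<in> Std \<and> Poly_Mapping.keys m \<subseteq> V \<and>
       int (mon_deg m) = e \<and> mdeg S m = u \<longrightarrow>
         (v \<in> S \<or> Poly_Mapping.lookup m v \<noteq> 0) \<and> (v \<in> S \<longrightarrow> m + xvar v \<in> Std)"
  shows "van (smul Std) j e (stdmod Std :: int \<Rightarrow> (('v \<Rightarrow>\<^sub>0 nat) \<Rightarrow> 'k::field) set)"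
proof -
  obtain ch where ch: "\<And>S m. S \<subseteq> V \<Longrightarrow> card S = j \<Longrightarrow> m \<in> Std \<Longrightarrow> Poly_Mapping.keys m \<subseteq> V \<Longrightarrow>
      int (mon_deg m) = e \<Longrightarrow>
      (ch (mdeg S m) \<in> S \<or> Poly_Mapping.lookup m (ch (mdeg S m)) \<noteq> 0) \<and>
      (ch (mdeg S m) \<in> S \<longrightarrow> m + xvar (ch (mdeg S m)) \<in> Std)"
    using ch by metis
  note G = stdmod_gmod[OF D]
  show ?thesis
    unfolding van_def
  proof safe
    fix c :: "'v set \<Rightarrow> ('v \<Rightarrow>\<^sub>0 nat) \<Rightarrow> 'k"
    assume c: "c \<in> chains j (stdmod Std e)" and cyc: "bd (smul Std) c = (\<lambda>_. 0)"
    \<comment> \<open>The variable depends only on \<open>mdeg T m\<close>, which \<open>bd\<close>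
      preserves, so the same \<open>v\<close> is used by all terms of the identity to be
      checked.\<close>
    define h where "h T m = (let v = ch (mdeg T m) in
        if v \<in> T \<and> T \<subseteq> V then sgs v (T - {v}) (c (T - {v}) (m + xvar v)) else 0)" for T m
    have c0: "c T m = 0" if "\<not> (T \<subseteq> V \<and> card T = j)" for T m
      using chains_eq_0[OF c that] by simp
    have cs: "m \<in> Std" "Poly_Mapping.keys m \<subseteq> V" "int (mon_deg m) = e" if "c T m \<noteq> 0" for T m
    proof -
      have "T \<subseteq> V" "card T = j" using c0 that by blast+
      then have "c T \<in> stdmod Std e" using c by (simp add: chainsD)
      then show "m \<in> Std" "Poly_Mapping.keys m \<subseteq> V" "int (mon_deg m) = e"
        using that by (auto simp: stdmod_def)
    qed
    have h: "h \<in> chains (Suc j) (stdmod Std (e - 1))"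
    proof -
      have "h T m \<noteq> 0 \<Longrightarrow> T \<subseteq> V \<and> card T = Suc j \<and> m \<in> Std \<and> Poly_Mapping.keys m \<subseteq> V \<and> int (mon_deg m) = e - 1"
        for T m
      proof -
        assume nz: "h T m \<noteq> 0"
        define v where "v = ch (mdeg T m)"
        have v: "v \<in> T" "T \<subseteq> V" "c (T - {v}) (m + xvar v) \<noteq> 0"
          using nz unfolding h_def Let_def v_def[symmetric] by (auto simp: sgs_def split: if_splits)
        note * = cs[OF v(3)]
        have "card (T - {v}) = j" using c0 v(3) by blast
        moreover have "finite T" using v(2) fin finite_subset by blast
        ultimately have "card T = Suc j" using v(1) card_Suc_Diff1 by metis
        moreover have "m \<in> Std" using *(1) D by (auto simp: down_closed_def)
        ultimately show ?thesis using * v by (auto simp: keys_nat_add mon_deg_add)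
      qed
      then show ?thesis by (fastforce simp: chains_def stdmod_def)
    qed
    have "bd (smul Std) h S m = c S m" for S m
    proof (cases "S \<subseteq> V \<and> card S = j \<and> m \<in> Std \<and> Poly_Mapping.keys m \<subseteq> V \<and> int (mon_deg m) = e")
      case False
      have bh: "bd (smul Std) h \<in> chains j (stdmod Std e)" using bd_chains[OF G h] by simp
      have "bd (smul Std) h S m = 0"
      proof (cases "S \<subseteq> V \<and> card S = j")
        case True
        then show ?thesis using False chainsD[OF bh, of S] unfolding stdmod_def by blast
      next
        case False
        then show ?thesis using chains_eq_0[OF bh False] by simp
      qed
      moreover have "c S m = 0" using False c0[of S m] cs[of S m] by argo
      ultimately show ?thesis by simp
    next
      case True
      then have S: "S \<subseteq> V" "card S = j" "m \<in> Std" "Poly_Mapping.keys m \<subseteq> V" "int (mon_deg m) = e" by auto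
      have finS: "finite S" using S fin finite_subset by blast
      define v where "v = ch (mdeg S m)"
      define W where "W = {w \<in> V - S. Poly_Mapping.lookup m w \<noteq> 0}"
      have finW: "finite W" by (simp add: W_def)
      have md: "mdeg (insert w S) (m - xvar w) = mdeg S m" if "w \<in> W" for w
        using that by (auto simp: mdeg_def W_def lookup_minus lookup_xvar fun_eq_iff)
      have hw: "h (insert w S) (m - xvar w) = (if v \<in> insert w S
          then sgs v (insert w S - {v}) (c (insert w S - {v}) (m - xvar w + xvar v)) else 0)" if "w \<in> W" for w
        using that S(1) unfolding h_def Let_def md[OF that] v_def[symmetric] by (auto simp: W_def)
      have bh: "bd (smul Std) h S m = (\<Sum>w\<in>W. sgs w S (h (insert w S) (m - xvar w)))"
        using S by (simp add: bd_smul_apply W_def)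
      note chv = ch[OF S, folded v_def]
      show ?thesis
      proof (cases "v \<in> S")
        \<comment> \<open>If \<open>v\<close> is not in \<open>S\<close>, then
          \<open>h (insert w S)\<close> contributes nothing for \<open>w\<close> other than
          \<open>v\<close>, and the term \<open>w = v\<close> gives back
          \<open>c S m\<close>.\<close>
        case False
        then have "Poly_Mapping.lookup m v \<noteq> 0" using chv by blast
        then have vW: "v \<in> W" using False S(4) by (auto simp: W_def in_keys_iff)
        have "(\<Sum>w\<in>W. sgs w S (h (insert w S) (m - xvar w))) = (\<Sum>w\<in>W. if w = v then c S m else 0)"
        proof (rule sum.cong)
          fix w assume w: "w \<in> W"
          have "insert v S - {v} = S" using False by auto
          then show "sgs w S (h (insert w S) (m - xvar w)) = (if w = v then c S m else 0)"
            using False minus_xvar_add[OF \<open>Poly_Mapping.lookup m v \<noteq> 0\<close>] by (auto simp: hw[OF w])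
        qed simp
        then show ?thesis using bh vW finW by simp
      next
        case True
        then have mv: "m + xvar v \<in> Std" using chv by blast
        define S' where "S' = S - {v}"
        have S': "S = insert v S'" "v \<notin> S'" "finite S'" "S' \<subseteq> V" "v \<in> V" using True S(1) finS by (auto simp: S'_def)
        let ?W' = "{w \<in> V - S'. Poly_Mapping.lookup (m + xvar v) w \<noteq> 0}"
        have W': "?W' = insert v W" "v \<notin> W"
          using S' by (auto simp: W_def lookup_add lookup_xvar)
        \<comment> \<open>The cycle condition at \<open>S'\<close> and \<open>m + xvar v\<close>
          expresses \<open>c S m\<close> through the remaining terms. It carries information only
          because \<open>m + xvar v\<close> is standard; elsewhere \<open>bd\<close> is 0 for every
          chain.\<close>
        have "0 = bd (smul Std) c S' (m + xvar v)" using cyc by simp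
        also have "\<dots> = (\<Sum>w\<in>insert v W. sgs w S' (c (insert w S') (m + xvar v - xvar w)))"
          using mv S'(4) by (simp only: bd_smul_apply W'(1)) simp
        also have "\<dots> = sgs v S' (c S m) + (\<Sum>w\<in>W. sgs w S' (c (insert w S') (m + xvar v - xvar w)))"
          using W'(2) finW by (simp add: add_minus_xvar S'(1))
        finally have "c S m = - sgs v S' (\<Sum>w\<in>W. sgs w S' (c (insert w S') (m + xvar v - xvar w)))"
          by (auto simp: sgs_def eq_neg_iff_add_eq_0 split: if_splits)
        also have "\<dots> = (\<Sum>w\<in>W. sgs w S (h (insert w S) (m - xvar w)))"
          unfolding sgs_sum sum_negf[symmetric]
        proof (rule sum.cong)
          fix w assume w: "w \<in> W"
          then have wv: "w \<in> V" "w \<noteq> v" "w \<notin> S'" "Poly_Mapping.lookup m w \<noteq> 0" using W'(2) S' by (auto simp: W_def)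
          have eq: "insert w S - {v} = insert w S'" using wv S' by auto
          have eq2: "m - xvar w + xvar v = m + xvar v - xvar w"
            using wv by (intro poly_mapping_eqI) (auto simp: lookup_add lookup_minus lookup_xvar)
          show "- sgs v S' (sgs w S' (c (insert w S') (m + xvar v - xvar w))) = sgs w S (h (insert w S) (m - xvar w))"
            using True sgs_swap[of v w S' "sgs v (insert w S') (c (insert w S') (m + xvar v - xvar w))"]
              sgs_swap[of w v S' "c (insert w S') (m + xvar v - xvar w)"] S' wv
            unfolding hw[OF w] eq eq2 by (simp add: sgs_insert) (auto simp: sgs_def)
        qed simp
        finally show ?thesis using bh by simp
      qed
    qed
    then have "bd (smul Std) h = c" by (auto simp: fun_eq_iff)
    then show "\<exists>b\<in>chains (Suc j) (stdmod Std (e - 1)). bd (smul Std) b = c" using h by blast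
  qed
qed

end


section \<open>Koszul homology and shifts of minimal resolutions\<close>

lemma poly_mapping_sum_single: "p = (\<Sum>m\<in>Poly_Mapping.keys p. Poly_Mapping.single m (Poly_Mapping.lookup p m))"
proof (rule poly_mapping_eqI)
  fix m
  show "Poly_Mapping.lookup p m =
      Poly_Mapping.lookup (\<Sum>m\<in>Poly_Mapping.keys p. Poly_Mapping.single m (Poly_Mapping.lookup p m)) m"
    by (simp add: lookup_sum lookup_single when_def in_keys_iff sum.delta)
qed

lemma lookup_single_mult:
  fixes p :: "('v, 'k::comm_ring_1) mpoly"
  shows "Poly_Mapping.lookup (Poly_Mapping.single a c * p) (a + m) = c * Poly_Mapping.lookup p m"
    and "(\<And>m'. m \<noteq> a + m') \<Longrightarrow> Poly_Mapping.lookup (Poly_Mapping.single a c * p) m = 0"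
proof -
  have *: "Poly_Mapping.lookup (Poly_Mapping.single a c * p) n =
      (\<Sum>m'\<in>Poly_Mapping.keys p. c * Poly_Mapping.lookup p m' when n = a + m')" for n
    by (subst poly_mapping_sum_single[of p])
      (simp only: sum_distrib_left mult_single lookup_sum lookup_single eq_commute)
  show "Poly_Mapping.lookup (Poly_Mapping.single a c * p) (a + m) = c * Poly_Mapping.lookup p m"
    by (simp add: * when_def in_keys_iff sum.delta)
  show "(\<And>m'. m \<noteq> a + m') \<Longrightarrow> Poly_Mapping.lookup (Poly_Mapping.single a c * p) m = 0"
    by (simp add: *)
qed

lemma lookup_const_mult:
  "Poly_Mapping.lookup (Poly_Mapping.single 0 c * p :: ('v, 'k::comm_ring_1) mpoly) m = c * Poly_Mapping.lookup p m"
  using lookup_single_mult(1)[of 0 c p m] by simp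

lemma lookup_mult_0:
  fixes p q :: "('v, 'k::comm_ring_1) mpoly"
  shows "Poly_Mapping.lookup (p * q) 0 = Poly_Mapping.lookup p 0 * Poly_Mapping.lookup q 0"
proof -
  have *: "Poly_Mapping.lookup (Poly_Mapping.single m c * q) 0 = (if m = 0 then c * Poly_Mapping.lookup q 0 else 0)"
    for m :: "'v \<Rightarrow>\<^sub>0 nat" and c
  proof (cases "m = 0")
    case False
    have "mon_deg (m + m') \<noteq> 0" for m' using False by (simp add: mon_deg_add)
    then have "0 \<noteq> m + m'" for m' by (metis mon_deg_0)
    then show ?thesis using False lookup_single_mult(2)[of 0 m] by simp
  qed (use lookup_const_mult[of c q 0] in simp)
  have "Poly_Mapping.lookup (p * q) 0 =
      (\<Sum>m\<in>Poly_Mapping.keys p. Poly_Mapping.lookup (Poly_Mapping.single m (Poly_Mapping.lookup p m) * q) 0)"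
    by (subst poly_mapping_sum_single[of p]) (simp only: sum_distrib_right lookup_sum)
  also have "\<dots> = Poly_Mapping.lookup p 0 * Poly_Mapping.lookup q 0"
    by (simp add: * in_keys_iff sum.delta)
  finally show ?thesis .
qed

lemma var_eq: "var v = Poly_Mapping.single (xvar v) 1"
  by (simp add: var_def xvar_def)

lemma lookup_var_mult:
  "Poly_Mapping.lookup (var v * p :: ('v, 'k::comm_ring_1) mpoly) m =
     (if Poly_Mapping.lookup m v \<noteq> 0 then Poly_Mapping.lookup p (m - xvar v) else 0)"
proof (cases "Poly_Mapping.lookup m v \<noteq> 0")
  case True
  then show ?thesis
    using lookup_single_mult(1)[of "xvar v" 1 p "m - xvar v"] minus_xvar_add[OF True]
    by (simp add: var_eq add.commute)
next
  case False
  then have "m \<noteq> xvar v + m'" for m' by (auto simp: lookup_add lookup_xvar)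
  then show ?thesis
    using lookup_single_mult(2)[of m "xvar v" 1 p] False by (simp add: var_eq)
qed

text \<open>Degrees are integers because the entries of a vector of degree \<open>d\<close> have
  degree \<open>d - s ! k\<close>, which may be negative; only 0 is homogeneous of negative
  degree.\<close>

definition hom_poly :: "'v set \<Rightarrow> int \<Rightarrow> ('v, 'k::zero) mpoly set" where
  "hom_poly V e = {p \<in> poly_ring V. \<forall>m\<in>Poly_Mapping.keys p. int (mon_deg m) = e}"

lemma hom_poly_iff:
  "p \<in> hom_poly V e \<longleftrightarrow>
    (\<forall>m. Poly_Mapping.lookup p m \<noteq> 0 \<longrightarrow> Poly_Mapping.keys m \<subseteq> V \<and> int (mon_deg m) = e)"
  by (auto simp: hom_poly_def poly_ring_def in_keys_iff)

lemma hom_poly_0 [simp]: "0 \<in> hom_poly V e" by (simp add: hom_poly_iff)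

lemma hom_poly_add: "p \<in> hom_poly V e \<Longrightarrow> q \<in> hom_poly V e \<Longrightarrow> p + q \<in> hom_poly V e"
  for p q :: "('v, 'k::ab_group_add) mpoly"
  unfolding hom_poly_iff lookup_add by (metis add.left_neutral)

lemma hom_poly_uminus: "p \<in> hom_poly V e \<Longrightarrow> - p \<in> hom_poly V e"
  for p :: "('v, 'k::ab_group_add) mpoly"
  by (simp add: hom_poly_iff)

lemma hom_poly_diff: "p \<in> hom_poly V e \<Longrightarrow> q \<in> hom_poly V e \<Longrightarrow> p - q \<in> hom_poly V e"
  for p q :: "('v, 'k::ab_group_add) mpoly"
  using hom_poly_add[of p V e "- q"] hom_poly_uminus[of q V e] by simp

lemma hom_poly_sum: "(\<And>x. x \<in> A \<Longrightarrow> f x \<in> hom_poly V e) \<Longrightarrow> sum f A \<in> hom_poly V e"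
  for f :: "'a \<Rightarrow> ('v, 'k::ab_group_add) mpoly"
  by (induction A rule: infinite_finite_induct) (auto intro: hom_poly_add)

lemma poly_ring_mult: "p \<in> poly_ring V \<Longrightarrow> q \<in> poly_ring V \<Longrightarrow> p * q \<in> poly_ring V"
  for p q :: "('v, 'k::comm_ring_1) mpoly"
  using keys_mult[of p q] unfolding poly_ring_def by (fastforce simp: keys_nat_add)

lemma poly_ring_add: "p \<in> poly_ring V \<Longrightarrow> q \<in> poly_ring V \<Longrightarrow> p + q \<in> poly_ring V"
  for p q :: "('v, 'k::comm_ring_1) mpoly"
  using keys_add[of p q] unfolding poly_ring_def by blast

lemma poly_ring_sum: "(\<And>x. x \<in> A \<Longrightarrow> f x \<in> poly_ring V) \<Longrightarrow> sum f A \<in> poly_ring V"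
  for f :: "'a \<Rightarrow> ('v, 'k::comm_ring_1) mpoly"
proof (induction A rule: infinite_finite_induct)
  case (insert x A)
  then show ?case by (simp add: poly_ring_add)
qed (auto simp: poly_ring_def)

lemma hom_poly_mult: "p \<in> hom_poly V e \<Longrightarrow> q \<in> hom_poly V e' \<Longrightarrow> p * q \<in> hom_poly V (e + e')"
  for p q :: "('v, 'k::comm_ring_1) mpoly"
proof -
  assume p: "p \<in> hom_poly V e" and q: "q \<in> hom_poly V e'"
  then have "p * q \<in> poly_ring V" by (auto simp: hom_poly_def intro: poly_ring_mult)
  moreover have "int (mon_deg m) = e + e'" if m: "m \<in> Poly_Mapping.keys (p * q)" for m
  proof -
    obtain a b where "m = a + b" "a \<in> Poly_Mapping.keys p" "b \<in> Poly_Mapping.keys q"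
      using m keys_mult[of p q] by blast
    then show ?thesis using p q by (auto simp: hom_poly_def mon_deg_add)
  qed
  ultimately show ?thesis by (auto simp: hom_poly_def)
qed

lemma hom_poly_var: "v \<in> V \<Longrightarrow> (var v :: ('v, 'k::comm_ring_1) mpoly) \<in> hom_poly V 1"
  by (simp add: hom_poly_def poly_ring_def var_eq)

lemma hom_poly_single:
  "Poly_Mapping.keys m \<subseteq> V \<Longrightarrow> int (mon_deg m) = e \<Longrightarrow> Poly_Mapping.single m c \<in> hom_poly V e"
  by (auto simp: hom_poly_iff lookup_single when_def)

lemma hom_poly_neg: "p \<in> hom_poly V e \<Longrightarrow> e < 0 \<Longrightarrow> p = 0"
  by (intro poly_mapping_eqI) (auto simp: hom_poly_iff)

lemma hom_poly_const:
  assumes "p \<in> hom_poly V 0"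
  shows "p = Poly_Mapping.single 0 (Poly_Mapping.lookup p 0)"
proof (rule poly_mapping_eqI)
  fix m
  have "m = 0" if "Poly_Mapping.lookup p m \<noteq> 0"
    using that assms mon_deg_eq_0_iff[of m] by (fastforce simp: hom_poly_iff)
  then show "Poly_Mapping.lookup p m = Poly_Mapping.lookup (Poly_Mapping.single 0 (Poly_Mapping.lookup p 0)) m"
    by (cases "m = 0") (auto simp: lookup_single)
qed

lemma hom_poly_lookup_0: "p \<in> hom_poly V e \<Longrightarrow> e \<noteq> 0 \<Longrightarrow> Poly_Mapping.lookup p 0 = 0"
  by (fastforce simp: hom_poly_iff)

text \<open>Degree \<open>d\<close> part of the free module with shifts \<open>s\<close>; vectors are functions with support below \<open>length s\<close>.\<close>

definition free_deg :: "'v set \<Rightarrow> nat list \<Rightarrow> int \<Rightarrow> (nat \<Rightarrow> ('v, 'k::zero) mpoly) set" where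
  "free_deg V s d = {f. \<forall>k. if k < length s then f k \<in> hom_poly V (d - int (s ! k)) else f k = 0}"

lemma free_deg_iff: "f \<in> free_deg V s d \<longleftrightarrow>
    (\<forall>k<length s. f k \<in> hom_poly V (d - int (s ! k))) \<and> (\<forall>k\<ge>length s. f k = 0)"
  by (auto simp: free_deg_def not_less)

definition pmul :: "('v, 'k::comm_ring_1) mpoly \<Rightarrow> (nat \<Rightarrow> ('v, 'k) mpoly) \<Rightarrow> nat \<Rightarrow> ('v, 'k) mpoly" where
  "pmul p f = (\<lambda>k. p * f k)"

lemma pmul_add: "pmul p (f + g) = pmul p f + pmul p g"
  by (auto simp: pmul_def algebra_simps)

lemma pmul_in: "p \<in> hom_poly V e \<Longrightarrow> f \<in> free_deg V s d \<Longrightarrow> pmul p f \<in> free_deg V s (e + d)"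
  using hom_poly_mult[of p V e] by (fastforce simp: free_deg_iff pmul_def algebra_simps)

text \<open>The action of a matrix on vectors encoded as functions on all naturals. Such functions
  form an abelian group, as the values of Koszul chains must, whereas vectors of varying length do
  not.\<close>

definition act :: "('v, 'k::comm_ring_1) mpoly mat \<Rightarrow> (nat \<Rightarrow> ('v, 'k) mpoly) \<Rightarrow> nat \<Rightarrow> ('v, 'k) mpoly" where
  "act A f = (\<lambda>j. if j < dim_row A then \<Sum>k<dim_col A. A $$ (j, k) * f k else 0)"

lemma act_add: "act A (f + g) = act A f + act A g"
  by (auto simp: act_def algebra_simps sum.distrib fun_eq_iff)

lemma act_pmul: "act A (pmul p f) = pmul p (act A f)"
  by (auto simp: act_def pmul_def sum_distrib_left algebra_simps fun_eq_iff intro!: sum.cong)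

lemma graded_maps_iff:
  fixes V :: "'v set"
  shows "A \<in> graded_maps V t s \<longleftrightarrow> dim_row A = length s \<and> dim_col A = length t \<and>
    (\<forall>j<length s. \<forall>k<length t. A $$ (j, k) \<in> hom_poly V (int (t ! k) - int (s ! j)))"
proof -
  have "mon_deg m + s ! j = t ! k \<longleftrightarrow> int (mon_deg m) = int (t ! k) - int (s ! j)" for m :: "'v \<Rightarrow>\<^sub>0 nat" and j k
    by linarith
  then show ?thesis by (auto simp: graded_maps_def hom_poly_def)
qed

lemma act_in: "A \<in> graded_maps V t s \<Longrightarrow> f \<in> free_deg V t d \<Longrightarrow> act A f \<in> free_deg V s d"
proof -
  assume A: "A \<in> graded_maps V t s" and f: "f \<in> free_deg V t d"
  have "A $$ (j, k) * f k \<in> hom_poly V (d - int (s ! j))" if "j < length s" "k < length t" for j k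
    using hom_poly_mult[of "A $$ (j, k)" V "int (t ! k) - int (s ! j)" "f k" "d - int (t ! k)"] A f that
    by (simp add: graded_maps_iff free_deg_iff)
  then show ?thesis using A by (auto simp: free_deg_iff act_def graded_maps_iff intro!: hom_poly_sum)
qed

lemma finite_stdmod_support:
  assumes "finite V" "\<And>m. f m \<noteq> 0 \<Longrightarrow> Poly_Mapping.keys m \<subseteq> V \<and> int (mon_deg m) = e"
  shows "finite {m. f m \<noteq> 0}"
  using assms(2) by (intro finite_subset[OF _ finite_monomials[OF assms(1), of "nat e"]]) force

context koszul
begin

abbreviation X :: "'v \<Rightarrow> (nat \<Rightarrow> ('v, 'k::field) mpoly) \<Rightarrow> nat \<Rightarrow> ('v, 'k) mpoly" where
  "X v \<equiv> pmul (var v)"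

lemma free_deg_gmod: "gmod X (free_deg V s :: int \<Rightarrow> (nat \<Rightarrow> ('v, 'k::field) mpoly) set)"
proof -
  have "X v f \<in> free_deg V s (e + 1)" if "v \<in> V" "f \<in> free_deg V s e" for v e and f :: "nat \<Rightarrow> ('v, 'k) mpoly"
    using pmul_in[OF hom_poly_var[OF that(1)] that(2)] by (simp add: add.commute)
  moreover have "X v (X w f) = X w (X v f)" for v w and f :: "nat \<Rightarrow> ('v, 'k) mpoly"
    by (auto simp: pmul_def algebra_simps)
  moreover have "a - b \<in> free_deg V s e" if "a \<in> free_deg V s e" "b \<in> free_deg V s e"
    for e and a b :: "nat \<Rightarrow> ('v, 'k) mpoly"
    using that by (auto simp: free_deg_iff hom_poly_diff)
  moreover have "0 \<in> free_deg V s e" for e by (simp add: free_deg_iff)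
  ultimately show ?thesis unfolding gmod_def by (simp only: pmul_add) blast
qed

lemma act_gmap:
  "A \<in> graded_maps V t s \<Longrightarrow> gmap X (free_deg V t) X (free_deg V s) (act A :: _ \<Rightarrow> nat \<Rightarrow> ('v, 'k::field) mpoly)"
  unfolding gmap_def by (auto simp: act_add act_pmul act_in)

text \<open>For the polynomial ring itself multiplication never leaves the basis, so any variable
  occurring in the multidegree gives a contraction. Only multidegree 0 offers none, and it forces
  \<open>j = 0\<close> and \<open>e = 0\<close>.\<close>

lemma van_UNIV: 
  assumes "j \<noteq> 0 \<or> e \<noteq> 0"
  shows "van (smul UNIV) j e (stdmod UNIV :: int \<Rightarrow> (('v \<Rightarrow>\<^sub>0 nat) \<Rightarrow> 'k::field) set)"
proof (rule van_contract)
  fix u :: "'v \<Rightarrow> nat"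
  show "\<exists>v. \<forall>S m. S \<subseteq> V \<and> card S = j \<and> m \<in> UNIV \<and> Poly_Mapping.keys m \<subseteq> V \<and>
       int (mon_deg m) = e \<and> mdeg S m = u \<longrightarrow>
         (v \<in> S \<or> Poly_Mapping.lookup m v \<noteq> 0) \<and> (v \<in> S \<longrightarrow> m + xvar v \<in> UNIV)"
  proof (cases "\<exists>v. u v \<noteq> 0")
    case True
    then obtain v where "u v \<noteq> 0" by blast
    then show ?thesis by (intro exI[of _ v]) (auto simp: mdeg_def split: if_splits)
  next
    case False
    have "\<not> (card S = j \<and> int (mon_deg m) = e \<and> mdeg S m = u)" for S m
    proof
      assume *: "card S = j \<and> int (mon_deg m) = e \<and> mdeg S m = u"
      then have "Poly_Mapping.lookup m v = 0 \<and> v \<notin> S" for v 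
        using False by (auto simp: mdeg_def split: if_splits)
      then have "m = 0" "S = {}" by (auto intro: poly_mapping_eqI)
      then show False using * assms by auto
    qed
    then show ?thesis by blast
  qed
qed (auto simp: down_closed_def)

lemma lookup_gmap:
  assumes "k < length s"
  shows "gmap X (free_deg V s) (smul UNIV) (\<lambda>e. stdmod UNIV (e - int (s ! k)))
    (\<lambda>f. Poly_Mapping.lookup (f k :: ('v, 'k::field) mpoly))"
  using assms unfolding gmap_def
  by (auto simp: fun_eq_iff lookup_add pmul_def lookup_var_mult smul_def stdmod_def free_deg_iff hom_poly_iff)

lemma bd_zero: "gmod Y M \<Longrightarrow> bd Y (\<lambda>_. 0) = (\<lambda>_. 0)"
  by (rule ext) (simp add: bd_def gmod_0)

text \<open>A free module is a sum of shifted polynomial rings, so \<open>van_UNIV\<close> applies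
  in each coordinate. The only homology left is that of the constants in homological degree 0, which
  \<open>nc\<close> excludes.\<close>

lemma free_exact:
  fixes c :: "'v set \<Rightarrow> nat \<Rightarrow> ('v, 'k::field) mpoly"
  assumes c: "c \<in> chains j (free_deg V s d)" and cyc: "bd X c = (\<lambda>_. 0)"
    and nc: "j = 0 \<Longrightarrow> (\<And>k. Poly_Mapping.lookup (c {} k) 0 = 0)"
  shows "\<exists>b\<in>chains (Suc j) (free_deg V s (d - 1)). bd X b = c"
proof -
  let ?L = "\<lambda>k (f :: nat \<Rightarrow> ('v, 'k) mpoly). Poly_Mapping.lookup (f k)"
  have "\<exists>b\<in>chains (Suc j) (stdmod UNIV (d - int (s ! k) - 1)). bd (smul UNIV) b = (\<lambda>S. ?L k (c S))"
    if k: "k < length s" for k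
  proof (cases "j \<noteq> 0 \<or> d - int (s ! k) \<noteq> 0")
    case True
    have "bd (smul UNIV) (\<lambda>S. ?L k (c S)) = (\<lambda>_. 0)"
      using bd_map[OF lookup_gmap[OF k], of c] cyc by (auto simp: fun_eq_iff)
    moreover have "(\<lambda>S. ?L k (c S)) \<in> chains j (stdmod UNIV (d - int (s ! k)))"
      using map_chains[OF lookup_gmap[OF k] c] .
    ultimately show ?thesis
      using van_UNIV[OF True] by (auto simp: van_def)
  next
    case False
    have "c S k = 0" for S
    proof (cases "S \<subseteq> V \<and> card S = j")
      case True
      then have "S = {}" using False finite_subset[OF _ fin] by auto
      moreover have "c S k \<in> hom_poly V 0"
        using chainsD[OF c, of S] True k False by (auto simp: free_deg_iff)
      ultimately show ?thesis using hom_poly_const nc[of k] False by fastforce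
    qed (use chains_eq_0[OF c] in simp)
    then have "(\<lambda>S. ?L k (c S)) = (\<lambda>_. 0)" by (auto simp: fun_eq_iff)
    moreover have "bd (smul UNIV) (\<lambda>_. 0) = (\<lambda>_. 0 :: ('v \<Rightarrow>\<^sub>0 nat) \<Rightarrow> 'k)"
      by (rule bd_zero[OF stdmod_gmod]) (simp add: down_closed_def)
    ultimately show ?thesis
      by (intro bexI[of _ "\<lambda>_. 0"] chains_0) (auto simp: stdmod_def)
  qed
  then obtain B where B: "\<And>k. k < length s \<Longrightarrow> B k \<in> chains (Suc j) (stdmod UNIV (d - int (s ! k) - 1))"
    "\<And>k. k < length s \<Longrightarrow> bd (smul UNIV) (B k) = (\<lambda>S. ?L k (c S))"
    by metis
  define b where "b T k = (if k < length s then Abs_poly_mapping (B k T) else 0)" for T k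
  have L: "?L k (b T) = B k T" if k: "k < length s" for k T
  proof -
    \<comment> \<open>The bounding chains of \<open>van_UNIV\<close> are mere coefficient functions.
      Being homogeneous over finitely many variables they have finite support, hence come from
      polynomials.\<close>
    have "finite {m. B k T m \<noteq> 0}"
    proof (cases "T \<subseteq> V \<and> card T = Suc j")
      case True
      then have "B k T \<in> stdmod UNIV (d - int (s ! k) - 1)" using chainsD[OF B(1)[OF k]] by blast
      then show ?thesis by (intro finite_stdmod_support[OF fin]) (auto simp: stdmod_def)
    next
      case False
      then show ?thesis using chains_eq_0[OF B(1)[OF k] False] by simp
    qed
    then show ?thesis using k by (simp add: b_def)
  qed
  have b: "b \<in> chains (Suc j) (free_deg V s (d - 1))"
  proof -
    have "b T \<in> free_deg V s (d - 1)" if "T \<subseteq> V" "card T = Suc j" for T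
      using chainsD[OF B(1) that] L
      by (auto simp: free_deg_iff hom_poly_iff stdmod_def algebra_simps) (simp add: b_def)
    moreover have "b T k = 0" if T: "\<not> (T \<subseteq> V \<and> card T = Suc j)" for T k
      using chains_eq_0[OF B(1) T] by (auto simp: b_def zero_fun_def)
    ultimately show ?thesis by (auto simp: chains_def fun_eq_iff)
  qed
  have bdb: "bd X b \<in> chains j (free_deg V s d)" using bd_chains[OF free_deg_gmod b] by simp
  have "bd X b S k = c S k" for S k
  proof (cases "k < length s")
    case True
    have "?L k (bd X b S) = bd (smul UNIV) (B k) S"
      using bd_map[OF lookup_gmap[OF True], of b] by (auto simp: L[OF True] fun_eq_iff)
    then show ?thesis by (auto simp: B(2)[OF True] intro!: poly_mapping_eqI)
  next
    case False
    then show ?thesis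
      using chainsD[OF c, of S] chains_eq_0[OF c, of S] chainsD[OF bdb, of S] chains_eq_0[OF bdb, of S]
      by (cases "S \<subseteq> V \<and> card S = j") (auto simp: free_deg_iff)
  qed
  then have "bd X b = c" by (auto simp: fun_eq_iff)
  then show ?thesis using b by blast
qed

lemma free_van: "van X (Suc j) e (free_deg V s :: int \<Rightarrow> (nat \<Rightarrow> ('v, 'k::field) mpoly) set)"
  unfolding van_def using free_exact by blast

lemma card_subset_0: "T \<subseteq> V \<and> card T = 0 \<longleftrightarrow> T = {}"
  by (metis card_0_eq card.empty empty_subsetI fin finite_subset)

lemma chain0: "z \<in> N \<Longrightarrow> (\<lambda>T. if T = {} then z else 0) \<in> chains 0 N"
  by (simp add: chains_def card_subset_0)

lemma chains_0_eq: "c \<in> chains 0 N \<Longrightarrow> c = (\<lambda>T. if T = {} then c {} else 0)"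
  by (rule ext) (simp add: chains_def card_subset_0)

text \<open>Every 0-chain is a cycle, so the homology in question is \<open>N\<close> modulo the
  multiples of the variables, the space of minimal generators of degree \<open>d\<close>.\<close>

lemma van_0_iff:
  assumes "gmod Y N"
  shows "van Y 0 d N \<longleftrightarrow> (\<forall>z\<in>N d. \<exists>b\<in>chains (Suc 0) (N (d - 1)). bd Y b {} = z)"
proof
  assume v: "van Y 0 d N"
  show "\<forall>z\<in>N d. \<exists>b\<in>chains (Suc 0) (N (d - 1)). bd Y b {} = z"
  proof
    fix z assume "z \<in> N d"
    note z = chain0[OF this]
    obtain b where b: "b \<in> chains (Suc 0) (N (d - 1))" "bd Y b = (\<lambda>T. if T = {} then z else 0)"
      using v bspec[OF v[unfolded van_def] z] bd_0_eq_0[OF assms z] by blast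
    then show "\<exists>b\<in>chains (Suc 0) (N (d - 1)). bd Y b {} = z"
      by (intro bexI[OF _ b(1)]) simp
  qed
next
  assume R: "\<forall>z\<in>N d. \<exists>b\<in>chains (Suc 0) (N (d - 1)). bd Y b {} = z"
  show "van Y 0 d N"
    unfolding van_def
  proof safe
    fix c assume c: "c \<in> chains 0 (N d)"
    then have "c {} \<in> N d" by (auto dest: chainsD)
    then obtain b where b: "b \<in> chains (Suc 0) (N (d - 1))" "bd Y b {} = c {}" using R by blast
    have "bd Y b \<in> chains 0 (N d)" using bd_chains[OF assms b(1)] by simp
    then have "bd Y b = (\<lambda>T. if T = {} then c {} else 0)" by (rule chains_0_eq[of "bd Y b" "N d", unfolded b(2)])
    also have "\<dots> = c" by (rule chains_0_eq[OF c, symmetric])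
    finally have "bd Y b = c" .
    then show "\<exists>b\<in>chains (Suc 0) (N (d - 1)). bd Y b = c" using b by blast
  qed
qed

lemma free_min_bd:
  fixes f :: "nat \<Rightarrow> ('v, 'k::field) mpoly"
  assumes "f \<in> free_deg V s d" "\<And>k. Poly_Mapping.lookup (f k) 0 = 0"
  shows "\<exists>b\<in>chains (Suc 0) (free_deg V s (d - 1)). bd X b {} = f"
proof -
  obtain b where "b \<in> chains (Suc 0) (free_deg V s (d - 1))" "bd X b = (\<lambda>T. if T = {} then f else 0)"
    using free_exact[OF chain0[OF assms(1)] bd_0_eq_0[OF free_deg_gmod chain0[OF assms(1)]]] assms(2) by auto
  then show ?thesis by (intro bexI[of _ b]) auto
qed

text \<open>Nakayama's lemma. If the image of a basis vector of degree \<open>d\<close> were a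
  combination of multiples of variables, lifting this combination would give a kernel element with
  constant term 1, against \<open>ker\<close>. If no basis vector has degree \<open>d\<close>, then
  elements of that degree in the free module have no constant terms and are themselves such
  combinations.\<close>

lemma generators_iff_not_van:
  fixes \<phi> :: "(nat \<Rightarrow> ('v, 'k::field) mpoly) \<Rightarrow> 'n::ab_group_add"
  assumes N: "gmod Y N" and \<phi>: "gmap X (free_deg V s) Y N \<phi>" and surj: "\<And>e. \<phi> ` free_deg V s e = N e"
    and ker: "\<And>e f k. f \<in> free_deg V s e \<Longrightarrow> \<phi> f = 0 \<Longrightarrow> Poly_Mapping.lookup (f k) 0 = 0"
  shows "d \<in> set s \<longleftrightarrow> \<not> van Y 0 (int d) N"
proof -
  have a: "\<phi> (a + b) = \<phi> a + \<phi> b" for a b using \<phi> by (auto simp: gmap_def)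
  show ?thesis
  proof
    assume "d \<in> set s"
    then obtain k where k: "k < length s" "s ! k = d" by (auto simp: in_set_conv_nth)
    show "\<not> van Y 0 (int d) N"
    proof
      assume v: "van Y 0 (int d) N"
      define u :: "nat \<Rightarrow> ('v, 'k) mpoly" where "u = (\<lambda>i. if i = k then 1 else 0)"
      have u: "u \<in> free_deg V s (int d)"
        using k hom_poly_single[of 0 V 0 "1::'k"] by (auto simp: u_def free_deg_iff)
      then have "\<phi> u \<in> N (int d)" using surj by blast
      then obtain b where b: "b \<in> chains (Suc 0) (N (int d - 1))" "bd Y b {} = \<phi> u"
        using v van_0_iff[OF N] by blast
      obtain b' where b': "b' \<in> chains (Suc 0) (free_deg V s (int d - 1))" "(\<lambda>S. \<phi> (b' S)) = b"
        using lift_chain[OF \<phi> surj b(1)] by blast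
      let ?w = "bd X b' {}"
      have w: "?w \<in> free_deg V s (int d)"
        using bd_chains[OF free_deg_gmod b'(1)] by (auto dest: chainsD)
      have "u - ?w \<in> free_deg V s (int d)" using gmod_diff_in[OF free_deg_gmod u w] .
      moreover have "\<phi> (u - ?w) = 0"
        using b(2) b'(2) fun_cong[OF bd_map[OF \<phi>, of b'], of "{}"] by (simp add: additive_diff[of \<phi>, OF a])
      ultimately have "Poly_Mapping.lookup ((u - ?w) k) 0 = 0" by (rule ker)
      moreover have "Poly_Mapping.lookup (?w k) 0 = 0"
        by (auto simp: bd_def sum_fun_apply sgs_apply lookup_sum pmul_def sgs_def lookup_var_mult intro!: sum.neutral)
      ultimately show False by (simp add: u_def lookup_minus lookup_one)
    qed
  next
    assume nv: "\<not> van Y 0 (int d) N"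
    show "d \<in> set s"
    proof (rule ccontr)
      assume d: "d \<notin> set s"
      have "\<exists>b\<in>chains (Suc 0) (N (int d - 1)). bd Y b {} = z" if z: "z \<in> N (int d)" for z
      proof -
        obtain f where f: "f \<in> free_deg V s (int d)" "\<phi> f = z" using z unfolding surj[symmetric] by blast
        have "Poly_Mapping.lookup (f k) 0 = 0" for k
        proof (cases "k < length s")
          case True
          then have "int d - int (s ! k) \<noteq> 0" using d by auto
          then show ?thesis using f(1) True by (auto simp: free_deg_iff intro: hom_poly_lookup_0)
        qed (use f in \<open>auto simp: free_deg_iff\<close>)
        then obtain b where b: "b \<in> chains (Suc 0) (free_deg V s (int d - 1))" "bd X b {} = f"
          using free_min_bd[OF f(1)] by blast
        then show ?thesis
          using map_chains[OF \<phi> b(1)] fun_cong[OF bd_map[OF \<phi>, of b], of "{}"] f(2) by auto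
      qed
      then show False using nv van_0_iff[OF N] by blast
    qed
  qed
qed

lemma act_min:
  assumes "\<And>j k. j < dim_row A \<Longrightarrow> k < dim_col A \<Longrightarrow> Poly_Mapping.lookup (A $$ (j, k)) 0 = 0"
  shows "Poly_Mapping.lookup (act A f j :: ('v, 'k::field) mpoly) 0 = 0"
  using assms by (auto simp: act_def lookup_sum lookup_mult_0)

text \<open>By \<open>ker\<close> the elements of the kernel have no constant terms, and
  \<open>free_exact\<close> turns this into the condition \<open>min\<close> of
  \<open>van_shift\<close>.\<close>

lemma van_shift_free:
  fixes \<phi> :: "(nat \<Rightarrow> ('v, 'k::field) mpoly) \<Rightarrow> 'n::ab_group_add"
  assumes N: "gmod Y N" and \<phi>: "gmap X (free_deg V s) Y N \<phi>" and surj: "\<And>e. \<phi> ` free_deg V s e = N e"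
    and ker: "\<And>e f k. f \<in> free_deg V s e \<Longrightarrow> \<phi> f = 0 \<Longrightarrow> Poly_Mapping.lookup (f k) 0 = 0"
    and Z: "Z = (\<lambda>e. {z \<in> free_deg V s e. \<phi> z = 0})"
  shows "van Y (Suc j) e N \<longleftrightarrow> van X j (e + 1) Z"
proof (rule van_shift[OF free_deg_gmod N \<phi> surj Z free_van])
  fix e c assume c: "c \<in> chains 0 (Z e)"
  then have "c {} \<in> Z e" by (auto dest: chainsD)
  moreover have "c \<in> chains 0 (free_deg V s e)" using c by (auto simp: chains_def Z)
  ultimately show "\<exists>b\<in>chains (Suc 0) (free_deg V s (e - 1)). bd X b = c"
    using bd_0_eq_0[OF free_deg_gmod] by (intro free_exact) (auto simp: Z ker)
qed

lemma resolution_shifts_iff: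
  fixes \<phi> :: "(nat \<Rightarrow> ('v, 'k::field) mpoly) \<Rightarrow> 'n::ab_group_add"
  assumes N: "gmod Y N" and \<phi>: "gmap X (free_deg V (s 0)) Y N \<phi>"
    and surj: "\<And>e. \<phi> ` free_deg V (s 0) e = N e"
    and D: "\<And>i. D (Suc i) \<in> graded_maps V (s (Suc i)) (s i)"
    and ex0: "\<And>e. act (D 1) ` free_deg V (s 1) e = {f \<in> free_deg V (s 0) e. \<phi> f = 0}"
    and ex: "\<And>i e. act (D (Suc (Suc i))) ` free_deg V (s (Suc (Suc i))) e =
        {f \<in> free_deg V (s (Suc i)) e. act (D (Suc i)) f = 0}"
    and min: "\<And>i j k. j < length (s i) \<Longrightarrow> k < length (s (Suc i)) \<Longrightarrow>
        Poly_Mapping.lookup (D (Suc i) $$ (j, k)) 0 = 0"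
  shows "d \<in> set (s i) \<longleftrightarrow> \<not> van Y i (int d - int i) N"
proof -
  \<comment> \<open>The syzygy module inside the \<open>i\<close>-th free module, covered by the
    next one. The summands with shifts \<open>s (Suc i)\<close> are therefore tested on
    \<open>Z i\<close>, and only \<open>s 0\<close> is tested on \<open>N\<close> itself.\<close>
  define Z where "Z i e = act (D (Suc i)) ` free_deg V (s (Suc i)) e" for i e
  have Z0: "Z 0 = (\<lambda>e. {f \<in> free_deg V (s 0) e. \<phi> f = 0})" using ex0 by (auto simp: Z_def)
  have ZS: "Z (Suc i) = (\<lambda>e. {f \<in> free_deg V (s (Suc i)) e. act (D (Suc i)) f = 0})" for i
    using ex by (auto simp: Z_def)
  have dims: "dim_row (D (Suc i)) = length (s i)" "dim_col (D (Suc i)) = length (s (Suc i))" for i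
    using D[of i] by (auto simp: graded_maps_iff)
  have Zmin: "Poly_Mapping.lookup (f k) 0 = 0" if "f \<in> Z i e" for i e f k
    using that act_min[of "D (Suc i)"] min dims by (auto simp: Z_def)
  have ker0: "Poly_Mapping.lookup (f k) 0 = 0" if "f \<in> free_deg V (s 0) e" "\<phi> f = 0" for e f k
    using Zmin[of f 0 e k] that by (simp add: Z0)
  have kerS: "Poly_Mapping.lookup (f k) 0 = 0"
    if "f \<in> free_deg V (s (Suc i)) e" "act (D (Suc i)) f = 0" for i e f k
    using Zmin[of f "Suc i" e k] that by (simp add: ZS)
  have G: "gmod X (Z i)" for i
  proof (cases i)
    case 0
    then show ?thesis using gmap_ker_gmod[OF free_deg_gmod N \<phi>] by (simp add: Z0)
  next
    case (Suc i')
    then show ?thesis using gmap_ker_gmod[OF free_deg_gmod free_deg_gmod act_gmap[OF D[of i']]] by (simp add: ZS)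
  qed
  have \<phi>': "gmap X (free_deg V (s (Suc i))) X (Z i) (act (D (Suc i)))" for i
    using act_gmap[OF D[of i]] by (auto simp: gmap_def Z_def)
  \<comment> \<open>The total degree stays constant: each shift lowers the homological degree by one
    and raises the internal degree by one.\<close>
  have shift: "van Y (Suc (i + j)) e N \<longleftrightarrow> van X j (e + int i + 1) (Z i)" for i j e
  proof (induction i arbitrary: j)
    case 0
    have "van Y (Suc j) e N \<longleftrightarrow> van X j (e + 1) (Z 0)"
      by (rule van_shift_free[where \<phi> = \<phi> and s = "s 0"]) (rule N \<phi> surj ker0 Z0 | assumption)+
    then show ?case by simp
  next
    case (Suc i)
    have "van Y (Suc (Suc i + j)) e N \<longleftrightarrow> van X (Suc j) (e + int i + 1) (Z i)"
      using Suc.IH[of "Suc j"] by simp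
    also have "\<dots> \<longleftrightarrow> van X j (e + int i + 1 + 1) (Z (Suc i))"
      by (rule van_shift_free[where \<phi> = "act (D (Suc i))" and s = "s (Suc i)"])
        (rule G \<phi>' Z_def[symmetric] kerS ZS | assumption)+
    finally show ?case by (simp add: algebra_simps)
  qed
  show ?thesis
  proof (cases i)
    case 0
    have "d \<in> set (s 0) \<longleftrightarrow> \<not> van Y 0 (int d) N"
      by (rule generators_iff_not_van[where \<phi> = \<phi>]) (rule N \<phi> surj ker0 | assumption)+
    then show ?thesis using 0 by simp
  next
    case (Suc i')
    have "d \<in> set (s (Suc i')) \<longleftrightarrow> \<not> van X 0 (int d) (Z i')"
      by (rule generators_iff_not_van[where \<phi> = "act (D (Suc i'))"])
        (rule G \<phi>' Z_def[symmetric] kerS | assumption)+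
    then show ?thesis using shift[of i' 0 "int d - int i"] Suc by simp
  qed
qed

end


section \<open>Degreewise exactness\<close>

definition free_fun :: "'v set \<Rightarrow> nat \<Rightarrow> (nat \<Rightarrow> ('v, 'k::zero) mpoly) set" where
  "free_fun V r = {f. (\<forall>k<r. f k \<in> poly_ring V) \<and> (\<forall>k\<ge>r. f k = 0)}"

definition fun_of_vec :: "nat \<Rightarrow> 'a::zero vec \<Rightarrow> nat \<Rightarrow> 'a" where
  "fun_of_vec r v = (\<lambda>k. if k < r then v $ k else 0)"

lemma fun_of_vec_vec [simp]: "f \<in> free_fun V r \<Longrightarrow> fun_of_vec r (vec r f) = f"
  by (auto simp: fun_of_vec_def free_fun_def)

lemma vec_fun_of_vec [simp]: "v \<in> carrier_vec r \<Longrightarrow> vec r (fun_of_vec r v) = v"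
  by (auto simp: fun_of_vec_def)

lemma fun_of_vec_in: "v \<in> free_module V r \<Longrightarrow> fun_of_vec r v \<in> free_fun V r"
  by (auto simp: fun_of_vec_def free_fun_def free_module_def)

lemma vec_in: "f \<in> free_fun V r \<Longrightarrow> vec r f \<in> free_module V r"
  by (auto simp: free_fun_def free_module_def)

lemma fun_of_vec_image: "fun_of_vec r ` free_module V r = free_fun V r"
proof
  show "free_fun V r \<subseteq> fun_of_vec r ` free_module V r"
    using vec_in fun_of_vec_vec by (metis image_eqI subsetI)
qed (auto intro: fun_of_vec_in)

lemma fun_of_vec_mult:
  assumes "A \<in> carrier_mat r c" "v \<in> carrier_vec c"
  shows "fun_of_vec r (A *\<^sub>v v) = act A (fun_of_vec c v)"
  using assms
  by (auto simp: fun_of_vec_def act_def scalar_prod_def fun_eq_iff lessThan_atLeast0 intro!: sum.cong)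

text \<open>Carries exactness statements between the vectors of the definition of a resolution and
  their encoding as functions.\<close>

lemma mult_vec_image_iff:
  fixes A :: "('v, 'k::comm_ring_1) mpoly mat"
  assumes A: "A \<in> carrier_mat r c"
  shows "(\<lambda>f. A *\<^sub>v f) ` free_module V c = {f \<in> free_module V r. Q (fun_of_vec r f)} \<longleftrightarrow>
    act A ` free_fun V c = {f \<in> free_fun V r. Q f}" (is "?L = ?R \<longleftrightarrow> ?L' = ?R'")
proof -
  have sub: "?L \<subseteq> carrier_vec r" "?R \<subseteq> carrier_vec r" using A by (auto simp: free_module_def)
  have "inj_on (fun_of_vec r) (carrier_vec r)" by (metis inj_on_inverseI vec_fun_of_vec)
  then have "?L = ?R \<longleftrightarrow> fun_of_vec r ` ?L = fun_of_vec r ` ?R"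
    by (rule inj_on_image_eq_iff[OF _ sub, symmetric])
  moreover have "fun_of_vec r ` ?L = ?L'"
    unfolding image_image fun_of_vec_image[of c V, symmetric]
    by (intro image_cong refl fun_of_vec_mult[OF A]) (auto simp: free_module_def)
  moreover have "fun_of_vec r ` ?R = ?R'"
  proof
    show "?R' \<subseteq> fun_of_vec r ` ?R"
    proof
      fix f assume f: "f \<in> ?R'"
      then have "vec r f \<in> ?R" using vec_in by fastforce
      then show "f \<in> fun_of_vec r ` ?R" using f by (intro image_eqI[of _ _ "vec r f"]) auto
    qed
  qed (auto intro: fun_of_vec_in)
  ultimately show ?thesis by simp
qed

section \<open>Homogeneous components\<close>

definition hcomp :: "int \<Rightarrow> ('v, 'k::comm_ring_1) mpoly \<Rightarrow> ('v, 'k) mpoly" where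
  "hcomp e p = (\<Sum>m\<in>{m \<in> Poly_Mapping.keys p. int (mon_deg m) = e}. Poly_Mapping.single m (Poly_Mapping.lookup p m))"

lemma lookup_hcomp: "Poly_Mapping.lookup (hcomp e p) m = (if int (mon_deg m) = e then Poly_Mapping.lookup p m else 0)"
  by (auto simp: hcomp_def lookup_sum lookup_single when_def in_keys_iff sum.delta')

lemma hcomp_add: "hcomp e (p + q) = hcomp e p + hcomp e q"
  by (intro poly_mapping_eqI) (simp add: lookup_hcomp lookup_add)

lemma hcomp_0 [simp]: "hcomp e 0 = 0"
  by (intro poly_mapping_eqI) (simp add: lookup_hcomp)

lemma hcomp_sum: "hcomp e (sum f A) = (\<Sum>x\<in>A. hcomp e (f x))"
  by (induction A rule: infinite_finite_induct) (simp_all add: hcomp_add)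

lemma hcomp_in: "p \<in> poly_ring V \<Longrightarrow> hcomp e p \<in> hom_poly V e"
  by (auto simp: hom_poly_iff lookup_hcomp poly_ring_def in_keys_iff)

lemma hcomp_hom: "p \<in> hom_poly V e' \<Longrightarrow> hcomp e p = (if e = e' then p else 0)"
  by (intro poly_mapping_eqI) (auto simp: lookup_hcomp hom_poly_iff)

lemma hcomp_self: "p \<in> hom_poly V e \<Longrightarrow> hcomp e p = p"
  by (simp add: hcomp_hom)

definition degs :: "('v, 'k::zero) mpoly \<Rightarrow> int set" where
  "degs p = (\<lambda>m. int (mon_deg m)) ` Poly_Mapping.keys p"

lemma sum_hcomp:
  assumes "finite E" "degs p \<subseteq> E"
  shows "(\<Sum>e\<in>E. hcomp e p) = p"
proof (rule poly_mapping_eqI)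
  fix m
  have "Poly_Mapping.lookup (\<Sum>e\<in>E. hcomp e p) m = (if int (mon_deg m) \<in> E then Poly_Mapping.lookup p m else 0)"
    using assms(1) by (simp add: lookup_sum lookup_hcomp sum.delta')
  moreover have "int (mon_deg m) \<in> E" if "Poly_Mapping.lookup p m \<noteq> 0"
    using that assms(2) by (auto simp: degs_def in_keys_iff)
  ultimately show "Poly_Mapping.lookup (\<Sum>e\<in>E. hcomp e p) m = Poly_Mapping.lookup p m" by auto
qed

lemma hcomp_mult:
  assumes "a \<in> hom_poly V d"
  shows "hcomp e (a * p) = a * hcomp (e - d) p"
proof -
  have a: "a \<in> hom_poly UNIV d" using assms by (auto simp: hom_poly_iff)
  have p: "p \<in> poly_ring UNIV" by (simp add: poly_ring_def)
  have fin: "finite (insert (e - d) (degs p))" by (simp add: degs_def)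
  have "hcomp e (a * p) = (\<Sum>e'\<in>insert (e - d) (degs p). hcomp e (a * hcomp e' p))"
    by (subst sum_hcomp[OF fin, of p, symmetric]) (auto simp only: sum_distrib_left hcomp_sum)
  also have "\<dots> = (\<Sum>e'\<in>insert (e - d) (degs p). if e' = e - d then a * hcomp e' p else 0)"
  proof (rule sum.cong)
    fix e'
    show "hcomp e (a * hcomp e' p) = (if e' = e - d then a * hcomp e' p else 0)"
      using hcomp_hom[OF hom_poly_mult[OF a hcomp_in[OF p]], of e e'] by auto
  qed simp
  also have "\<dots> = a * hcomp (e - d) p" using fin by (simp only: sum.delta) simp
  finally show ?thesis .
qed

definition vcomp :: "nat list \<Rightarrow> int \<Rightarrow> (nat \<Rightarrow> ('v, 'k::comm_ring_1) mpoly) \<Rightarrow> nat \<Rightarrow> ('v, 'k) mpoly" where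
  "vcomp s d f = (\<lambda>k. if k < length s then hcomp (d - int (s ! k)) (f k) else 0)"

lemma vcomp_in: "f \<in> free_fun V (length s) \<Longrightarrow> vcomp s d f \<in> free_deg V s d"
  by (auto simp: vcomp_def free_deg_iff free_fun_def intro: hcomp_in)

lemma vcomp_eq: "f \<in> free_deg V s d \<Longrightarrow> vcomp s d f = f"
  by (auto simp: vcomp_def free_deg_iff fun_eq_iff intro: hcomp_self)

lemma free_deg_fun: "f \<in> free_deg V s d \<Longrightarrow> f \<in> free_fun V (length s)"
  by (auto simp: free_deg_iff free_fun_def hom_poly_def)

lemma act_vcomp:
  assumes "A \<in> graded_maps V t s"
  shows "act A (vcomp t d f) = vcomp s d (act A f)"
proof
  fix j
  show "act A (vcomp t d f) j = vcomp s d (act A f) j"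
    using assms
    by (auto simp: act_def vcomp_def graded_maps_iff hcomp_sum intro!: sum.cong)
      (subst hcomp_mult, auto)
qed

lemma sum_vcomp:
  assumes "f \<in> free_fun V (length s)"
  obtains E where "finite E" "(\<Sum>d\<in>E. vcomp s d f) = f"
proof -
  \<comment> \<open>Entry \<open>k\<close> of the component of degree \<open>d\<close> has degree
    \<open>d - s ! k\<close>, so the degrees occurring in \<open>f k\<close> are shifted back by
    \<open>s ! k\<close>.\<close>
  define E where "E = (\<Union>k<length s. (\<lambda>e. e + int (s ! k)) ` degs (f k))"
  have fin: "finite E" by (simp add: E_def degs_def)
  have "(\<Sum>d\<in>E. vcomp s d f) k = f k" for k
  proof (cases "k < length s")
    case True
    have "(\<Sum>d\<in>E. vcomp s d f) k = (\<Sum>d\<in>E. hcomp (d - int (s ! k)) (f k))"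
      using True by (simp add: sum_fun_apply vcomp_def)
    also have "\<dots> = (\<Sum>e\<in>(\<lambda>d. d - int (s ! k)) ` E. hcomp e (f k))"
      by (subst sum.reindex) (auto simp: inj_on_def)
    also have "\<dots> = f k" using fin True by (intro sum_hcomp) (force simp: E_def)+
    finally show ?thesis .
  next
    case False
    then show ?thesis using assms by (simp add: sum_fun_apply vcomp_def free_fun_def)
  qed
  then show thesis using fin that by blast
qed

lemma free_fun_sum: "(\<And>x. x \<in> A \<Longrightarrow> f x \<in> free_fun V r) \<Longrightarrow> sum f A \<in> free_fun V r"
  for f :: "'a \<Rightarrow> nat \<Rightarrow> ('v, 'k::comm_ring_1) mpoly"
  by (auto simp: free_fun_def sum_fun_apply intro: poly_ring_sum)

lemma act_free_fun:
  assumes "A \<in> graded_maps V t s" "f \<in> free_fun V (length t)"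
  shows "act A f \<in> free_fun V (length s)"
  using assms
  by (auto simp: act_def free_fun_def graded_maps_iff hom_poly_def intro!: poly_ring_sum poly_ring_mult)

lemma act_0 [simp]: "act A 0 = 0" by (auto simp: act_def)

lemma act_sum: "act A (sum f B) = (\<Sum>x\<in>B. act A (f x))"
  by (induction B rule: infinite_finite_induct) (simp_all only: sum.infinite sum.empty sum.insert act_0 act_add not_False_eq_True)

text \<open>A preimage of a homogeneous vector may be inhomogeneous, but graded maps commute with
  taking components, so its component of degree \<open>d\<close> is a preimage as well.\<close>

lemma exact_degreewise:
  assumes A: "A \<in> graded_maps V t s"
    and ex: "act A ` free_fun V (length t) = {f \<in> free_fun V (length s). Q f}"
  shows "act A ` free_deg V t d = {f \<in> free_deg V s d. Q f}"
proof
  show "act A ` free_deg V t d \<subseteq> {f \<in> free_deg V s d. Q f}"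
    using act_in[OF A] free_deg_fun ex by blast
  show "{f \<in> free_deg V s d. Q f} \<subseteq> act A ` free_deg V t d"
  proof
    fix f assume f: "f \<in> {f \<in> free_deg V s d. Q f}"
    then have "f \<in> act A ` free_fun V (length t)" using ex free_deg_fun by blast
    then obtain g where g: "g \<in> free_fun V (length t)" "f = act A g" by blast
    then have "f = act A (vcomp t d g)" using f act_vcomp[OF A] vcomp_eq by fastforce
    then show "f \<in> act A ` free_deg V t d" using vcomp_in[OF g(1)] by blast
  qed
qed

text \<open>The way back: a vector is the finite sum of its components, so preimages of the
  components add up. This is why \<open>Q\<close> must be stable under sums and under taking
  components.\<close>

lemma exact_from_degreewise:
  fixes A :: "('v, 'k::comm_ring_1) mpoly mat"
  assumes A: "A \<in> graded_maps V t s"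
    and ex: "\<And>d. act A ` free_deg V t d = {f \<in> free_deg V s d. Q f}"
    and Q0: "Q 0" and Qadd: "\<And>f g. Q f \<Longrightarrow> Q g \<Longrightarrow> Q (f + g)" and Qc: "\<And>f d. f \<in> free_fun V (length s) \<Longrightarrow> Q f \<Longrightarrow> Q (vcomp s d f)"
  shows "act A ` free_fun V (length t) = {f \<in> free_fun V (length s). Q f}"
proof -
  have Qsum: "(\<And>x. x \<in> E \<Longrightarrow> Q (h x)) \<Longrightarrow> Q (sum h E)" for E :: "int set" and h
    by (induction E rule: infinite_finite_induct) (auto simp: Q0 intro: Qadd)
  show ?thesis
  proof safe
    fix g :: "nat \<Rightarrow> ('v, 'k) mpoly" assume g: "g \<in> free_fun V (length t)"
    then show "act A g \<in> free_fun V (length s)" by (rule act_free_fun[OF A])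
    obtain E where E: "finite E" "(\<Sum>d\<in>E. vcomp t d g) = g" using sum_vcomp[OF g] .
    have "Q (\<Sum>d\<in>E. act A (vcomp t d g))"
      using ex vcomp_in[OF g] by (intro Qsum) blast
    then show "Q (act A g)" using E(2) act_sum[of A "\<lambda>d. vcomp t d g" E] by simp
  next
    fix f :: "nat \<Rightarrow> ('v, 'k) mpoly" assume f: "f \<in> free_fun V (length s)" "Q f"
    obtain E where E: "finite E" "(\<Sum>d\<in>E. vcomp s d f) = f" using sum_vcomp[OF f(1)] .
    have "\<exists>g\<in>free_deg V t d. act A g = vcomp s d f" for d
    proof -
      have "vcomp s d f \<in> act A ` free_deg V t d"
        unfolding ex using vcomp_in[OF f(1), of d] Qc[OF f, of d] by simp
      then show ?thesis by force
    qed
    then obtain g where g: "\<And>d. g d \<in> free_deg V t d" "\<And>d. act A (g d) = vcomp s d f" by metis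
    have "f = act A (\<Sum>d\<in>E. g d)" using E(2) g(2) by (simp add: act_sum)
    moreover have "(\<Sum>d\<in>E. g d) \<in> free_fun V (length t)" using g(1) free_deg_fun by (intro free_fun_sum) blast
    ultimately show "f \<in> act A ` free_fun V (length t)" by blast
  qed
qed

definition monomial_ideal :: "'v set \<Rightarrow> ('v \<Rightarrow>\<^sub>0 nat) set \<Rightarrow> ('v, 'k::zero) mpoly set" where
  "monomial_ideal V Std = {p \<in> poly_ring V. \<forall>m\<in>Poly_Mapping.keys p. m \<notin> Std}"

text \<open>The map onto the quotient ring: reducing modulo a monomial ideal means keeping the
  coefficients at the standard monomials.\<close>

definition aug :: "('v \<Rightarrow>\<^sub>0 nat) set \<Rightarrow> ('v, 'k::comm_ring_1) mpoly mat \<Rightarrow> (nat \<Rightarrow> ('v, 'k) mpoly) \<Rightarrow> ('v \<Rightarrow>\<^sub>0 nat) \<Rightarrow> 'k"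
  where "aug Std A f = (\<lambda>m. if m \<in> Std then Poly_Mapping.lookup (act A f 0) m else 0)"

lemma aug_eq_0_iff:
  assumes "A \<in> graded_maps V s [0]" "f \<in> free_fun V (length s)"
  shows "aug Std A f = 0 \<longleftrightarrow> act A f 0 \<in> monomial_ideal V Std"
  using act_free_fun[OF assms] by (auto simp: aug_def monomial_ideal_def free_fun_def fun_eq_iff in_keys_iff)

context koszul
begin

lemma aug_gmap:
  fixes A :: "('v, 'k::field) mpoly mat"
  assumes D: "down_closed Std" and A: "A \<in> graded_maps V s [0]"
  shows "gmap X (free_deg V s) (smul Std) (stdmod Std) (aug Std A)"
proof -
  have "aug Std A (X v f) = smul Std v (aug Std A f)" for v f
  proof -
    have "act A (X v f) 0 = var v * act A f 0" by (simp only: act_pmul) (simp add: pmul_def)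
    then show ?thesis
      by (auto simp: aug_def lookup_var_mult smul_def fun_eq_iff down_closed_minus[OF D])
  qed
  moreover have "aug Std A (f + g) = aug Std A f + aug Std A g" for f g
    by (auto simp: aug_def act_add lookup_add)
  moreover have "aug Std A f \<in> stdmod Std e" if "f \<in> free_deg V s e" for f e
    using act_in[OF A that] by (auto simp: aug_def stdmod_def free_deg_iff hom_poly_iff split: if_splits)
  ultimately show ?thesis by (auto simp: gmap_def)
qed

text \<open>The right-hand side involves neither \<open>s\<close> nor \<open>D\<close> beyond the
  indices, so all minimal resolutions have the same sets of shifts. The work is translation: from
  vectors to functions, from all vectors to single degrees, and from membership in the ideal to the
  kernel of \<open>aug\<close>.\<close>

lemma mgfr_shifts_iff:
  fixes D :: "nat \<Rightarrow> ('v, 'k::field) mpoly mat"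
  assumes Std: "down_closed Std"
    and res: "minimal_graded_free_resolution V (monomial_ideal V Std) s D"
  shows "d \<in> set (s i) \<longleftrightarrow> \<not> van (smul Std) i (int d - int i) (stdmod Std :: int \<Rightarrow> (('v \<Rightarrow>\<^sub>0 nat) \<Rightarrow> 'k) set)"
proof -
  let ?I = "monomial_ideal V Std :: ('v, 'k) mpoly set"
  have D0: "D 0 \<in> graded_maps V (s 0) [0]"
    and DS: "\<And>i. D (Suc i) \<in> graded_maps V (s (Suc i)) (s i)"
    and surj: "\<And>p. p \<in> poly_ring V \<Longrightarrow> \<exists>f\<in>free_module V (length (s 0)). p - (D 0 *\<^sub>v f) $ 0 \<in> ?I"
    and ex0: "(\<lambda>f. D 1 *\<^sub>v f) ` free_module V (length (s 1)) = {f \<in> free_module V (length (s 0)). (D 0 *\<^sub>v f) $ 0 \<in> ?I}"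
    and exS: "\<And>i. (\<lambda>f. D (Suc (Suc i)) *\<^sub>v f) ` free_module V (length (s (Suc (Suc i)))) =
           {f \<in> free_module V (length (s (Suc i))). D (Suc i) *\<^sub>v f = 0\<^sub>v (length (s i))}"
    and min: "\<And>i j k. j < length (s i) \<Longrightarrow> k < length (s (Suc i)) \<Longrightarrow>
           Poly_Mapping.lookup (D (Suc i) $$ (j, k)) 0 = 0"
    using res unfolding minimal_graded_free_resolution_def Let_def by blast+
  have dim0: "D 0 \<in> carrier_mat 1 (length (s 0))" using D0 by (auto simp: graded_maps_def)
  have dimS: "D (Suc i) \<in> carrier_mat (length (s i)) (length (s (Suc i)))" for i using DS[of i] by (auto simp: graded_maps_def)
  have D0f: "(D 0 *\<^sub>v f) $ 0 = act (D 0) (fun_of_vec (length (s 0)) f) 0" if "f \<in> free_module V (length (s 0))" for f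
    using fun_cong[OF fun_of_vec_mult[OF dim0, of f], of 0] that by (auto simp: free_module_def fun_of_vec_def)
  have DSf: "D (Suc i) *\<^sub>v f = 0\<^sub>v (length (s i)) \<longleftrightarrow> act (D (Suc i)) (fun_of_vec (length (s (Suc i))) f) = 0"
    if f: "f \<in> free_module V (length (s (Suc i)))" for f i
  proof -
    have "fun_of_vec (length (s i)) (D (Suc i) *\<^sub>v f) = 0 \<longleftrightarrow> D (Suc i) *\<^sub>v f = 0\<^sub>v (length (s i))"
      using dimS[of i] by (auto simp: fun_of_vec_def fun_eq_iff vec_eq_iff)
    then show ?thesis using fun_of_vec_mult[OF dimS, of f i] f by (auto simp: free_module_def)
  qed
  have uex0: "act (D 1) ` free_fun V (length (s 1)) = {f \<in> free_fun V (length (s 0)). act (D 0) f 0 \<in> ?I}"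
    using ex0 D0f mult_vec_image_iff[OF dimS[of 0], of V "\<lambda>f. act (D 0) f 0 \<in> ?I"]
    by (simp cong: conj_cong)
  have uexS: "act (D (Suc (Suc i))) ` free_fun V (length (s (Suc (Suc i)))) = {f \<in> free_fun V (length (s (Suc i))). act (D (Suc i)) f = 0}" for i
    using exS[of i] DSf[of _ i] mult_vec_image_iff[OF dimS[of "Suc i"], of V "\<lambda>f. act (D (Suc i)) f = 0"]
    by (simp cong: conj_cong)
  note D0map = aug_gmap[OF Std D0]
  show ?thesis
  proof (rule resolution_shifts_iff[where \<phi> = "aug Std (D 0)" and s = s and D = D])
    show "gmod (smul Std) (stdmod Std :: int \<Rightarrow> (('v \<Rightarrow>\<^sub>0 nat) \<Rightarrow> 'k) set)" by (rule stdmod_gmod[OF Std])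
    show "gmap X (free_deg V (s 0)) (smul Std) (stdmod Std) (aug Std (D 0))" by (rule D0map)
    show "aug Std (D 0) ` free_deg V (s 0) e = stdmod Std e" for e
    proof
      show "aug Std (D 0) ` free_deg V (s 0) e \<subseteq> stdmod Std e" using D0map by (auto simp: gmap_def)
      show "stdmod Std e \<subseteq> aug Std (D 0) ` free_deg V (s 0) e"
      proof
        fix z :: "('v \<Rightarrow>\<^sub>0 nat) \<Rightarrow> 'k" assume z: "z \<in> stdmod Std e"
        define p where "p = Abs_poly_mapping z"
        have p: "Poly_Mapping.lookup p = z"
          using z finite_stdmod_support[OF fin, of z e] by (simp add: p_def stdmod_def)
        then have "p \<in> poly_ring V" using z by (auto simp: poly_ring_def in_keys_iff stdmod_def)
        then obtain f where f: "f \<in> free_module V (length (s 0))" "p - (D 0 *\<^sub>v f) $ 0 \<in> ?I"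
          using surj by blast
        define g where "g = fun_of_vec (length (s 0)) f"
        have g: "g \<in> free_fun V (length (s 0))" "p - act (D 0) g 0 \<in> ?I"
          using f D0f fun_of_vec_in by (auto simp: g_def)
        \<comment> \<open>The preimage \<open>g\<close> may be inhomogeneous. Its component of
          degree \<open>e\<close> still maps to \<open>z\<close>, because \<open>z\<close> lives in
          degree \<open>e\<close>.\<close>
        have av: "act (D 0) (vcomp (s 0) e g) 0 = hcomp e (act (D 0) g 0)"
          by (simp only: act_vcomp[OF D0]) (simp add: vcomp_def)
        have "aug Std (D 0) (vcomp (s 0) e g) m = z m" for m
        proof (cases "m \<in> Std \<and> int (mon_deg m) = e")
          case True
          then have "Poly_Mapping.lookup (p - act (D 0) g 0) m = 0"
            using g(2) by (auto simp: monomial_ideal_def in_keys_iff)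
          then show ?thesis using True p
            by (auto simp: aug_def av lookup_hcomp lookup_minus)
        next
          case False
          then have "z m = 0" using z by (auto simp: stdmod_def)
          then show ?thesis using False
            by (auto simp: aug_def av lookup_hcomp)
        qed
        then show "z \<in> aug Std (D 0) ` free_deg V (s 0) e"
          using vcomp_in[OF g(1)] by (metis ext image_eqI)
      qed
    qed
    show "D (Suc i) \<in> graded_maps V (s (Suc i)) (s i)" for i by (rule DS)
    show "act (D 1) ` free_deg V (s 1) e = {f \<in> free_deg V (s 0) e. aug Std (D 0) f = 0}" for e
      using exact_degreewise[OF DS[of 0], of "\<lambda>f. act (D 0) f 0 \<in> ?I" e] uex0 aug_eq_0_iff[OF D0 free_deg_fun]
      by auto
    show "act (D (Suc (Suc i))) ` free_deg V (s (Suc (Suc i))) e = {f \<in> free_deg V (s (Suc i)) e. act (D (Suc i)) f = 0}" for i e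
      by (rule exact_degreewise[OF DS uexS])
    show "Poly_Mapping.lookup (D (Suc i) $$ (j, k)) 0 = 0"
      if "j < length (s i)" "k < length (s (Suc i))" for i j k using min that .
  qed
qed

end


section \<open>Existence of minimal resolutions\<close>

definition unit_fun :: "nat \<Rightarrow> ('v \<Rightarrow>\<^sub>0 nat) \<Rightarrow> nat \<Rightarrow> ('v, 'k::zero_neq_one) mpoly" where
  "unit_fun k m = (\<lambda>i. if i = k then Poly_Mapping.single m 1 else 0)"

abbreviation const_mul :: "'k \<Rightarrow> (nat \<Rightarrow> ('v, 'k::comm_ring_1) mpoly) \<Rightarrow> nat \<Rightarrow> ('v, 'k) mpoly" where
  "const_mul c \<equiv> pmul (Poly_Mapping.single 0 c)"

lemma pmul_0 [simp]: "pmul 0 f = 0" "pmul p 0 = 0" by (auto simp: pmul_def)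
lemma pmul_1 [simp]: "pmul 1 f = f" by (auto simp: pmul_def)
lemma pmul_pmul: "pmul p (pmul q f) = pmul (p * q) f" by (auto simp: pmul_def mult.assoc)
lemma pmul_add_left: "pmul (p + q) f = pmul p f + pmul q f"
  by (auto simp: pmul_def algebra_simps)
lemma pmul_diff_left: "pmul (p - q) f = pmul p f - pmul q f"
  by (auto simp: pmul_def algebra_simps)
lemma pmul_sum: "pmul p (sum f A) = (\<Sum>x\<in>A. pmul p (f x))"
  by (auto simp: pmul_def sum_fun_apply sum_distrib_left)

lemma vector_space_const_mul:
  "vector_space (const_mul :: 'k \<Rightarrow> (nat \<Rightarrow> ('v, 'k::field) mpoly) \<Rightarrow> nat \<Rightarrow> ('v, 'k) mpoly)"
  by standard (simp_all add: pmul_add single_add pmul_add_left pmul_pmul mult_single)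

text \<open>Each degree of a free module over finitely many variables has a finite monomial basis,
  so a maximal independent subset of \<open>W\<close> is finite.\<close>

lemma finite_dim:
  fixes W :: "(nat \<Rightarrow> ('v, 'k::field) mpoly) set"
  assumes "finite V" and W: "W \<subseteq> free_deg V s d"
  obtains S where "finite S" "S \<subseteq> W" "\<And>z. z \<in> W \<Longrightarrow> \<exists>c. z = (\<Sum>x\<in>S. const_mul (c x) x)"
proof -
  interpret vs: vector_space "const_mul :: 'k \<Rightarrow> (nat \<Rightarrow> ('v, 'k) mpoly) \<Rightarrow> nat \<Rightarrow> ('v, 'k) mpoly"
    by (rule vector_space_const_mul)
  define M where "M = {m :: 'v \<Rightarrow>\<^sub>0 nat. Poly_Mapping.keys m \<subseteq> V \<and> mon_deg m \<le> nat d}"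
  have finM: "finite M" unfolding M_def using assms(1) by (rule finite_monomials)
  define E :: "(nat \<Rightarrow> ('v, 'k) mpoly) set" where "E = (\<lambda>(k, m). unit_fun k m) ` ({..<length s} \<times> M)"
  have finE: "finite E" using finM by (simp add: E_def)
  have "f \<in> vs.span E" if f: "f \<in> W" for f
  proof -
    have fk: "f k \<in> hom_poly V (d - int (s ! k))" if "k < length s" for k
      using f W that by (auto simp: free_deg_iff)
    have "f i = (\<Sum>k<length s. \<Sum>m\<in>Poly_Mapping.keys (f k). const_mul (Poly_Mapping.lookup (f k) m) (unit_fun k m)) i" for i
    proof -
      have "(\<Sum>m\<in>Poly_Mapping.keys (f k). const_mul (Poly_Mapping.lookup (f k) m) (unit_fun k m)) i
        = (if k = i then (\<Sum>m\<in>Poly_Mapping.keys (f k). Poly_Mapping.single m (Poly_Mapping.lookup (f k) m)) else 0)" for k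
        by (cases "k = i") (simp_all add: sum_fun_apply pmul_def unit_fun_def mult_single)
      then have "(\<Sum>k<length s. \<Sum>m\<in>Poly_Mapping.keys (f k). const_mul (Poly_Mapping.lookup (f k) m) (unit_fun k m)) i
        = (\<Sum>k<length s. if k = i then (\<Sum>m\<in>Poly_Mapping.keys (f k). Poly_Mapping.single m (Poly_Mapping.lookup (f k) m)) else 0)"
        by (simp only: sum_fun_apply[of _ "{..<length s}"])
      also have "\<dots> = (if i < length s then f i else 0)"
        by (simp add: sum.delta' poly_mapping_sum_single[symmetric])
      also have "\<dots> = f i" using f W by (auto simp: free_deg_iff)
      finally show ?thesis by simp
    qed
    then have eq: "f = (\<Sum>k<length s. \<Sum>m\<in>Poly_Mapping.keys (f k). const_mul (Poly_Mapping.lookup (f k) m) (unit_fun k m))"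
      by (rule ext)
    have "unit_fun k m \<in> E" if "k < length s" "m \<in> Poly_Mapping.keys (f k)" for k m
    proof -
      have "m \<in> M" using fk[OF that(1)] that(2) by (force simp: M_def hom_poly_def poly_ring_def)
      then show ?thesis using that(1) by (auto simp: E_def)
    qed
    then have "(\<Sum>k<length s. \<Sum>m\<in>Poly_Mapping.keys (f k). const_mul (Poly_Mapping.lookup (f k) m) (unit_fun k m)) \<in> vs.span E"
      by (intro vs.span_sum vs.span_scale) (simp add: vs.span_base)
    then show ?thesis using eq by simp
  qed
  then have WE: "W \<subseteq> vs.span E" by blast
  obtain S where S: "S \<subseteq> W" "vs.independent S" "W \<subseteq> vs.span S"
    using vs.maximal_independent_subset[of W] by blast
  have "finite S" using vs.independent_span_bound[OF finE S(2)] S(1) WE by blast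
  moreover have "\<exists>c. z = (\<Sum>x\<in>S. const_mul (c x) x)" if "z \<in> W" for z
    using S(3) that vs.span_finite[OF \<open>finite S\<close>] by blast
  ultimately show thesis using S(1) that by blast
qed

text \<open>The degree \<open>d\<close> part of the submodule generated by \<open>G\<close>.
  Generators carry their degree because a vector need not determine it: 0 is homogeneous of every
  degree.\<close>

definition gen :: "'v set \<Rightarrow> ((nat \<Rightarrow> ('v, 'k::comm_ring_1) mpoly) \<times> nat) set \<Rightarrow> int \<Rightarrow> (nat \<Rightarrow> ('v, 'k) mpoly) set" where
  "gen V G d = {\<Sum>x\<in>G. pmul (p x) (fst x) | p. \<forall>x\<in>G. p x \<in> hom_poly V (d - int (snd x))}"

lemma gen_0: "0 \<in> gen V G d"
  unfolding gen_def by (intro CollectI exI[of _ "\<lambda>_. 0"]) simp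

lemma gen_add: "f \<in> gen V G d \<Longrightarrow> g \<in> gen V G d \<Longrightarrow> f + g \<in> gen V G d"
proof -
  assume "f \<in> gen V G d" "g \<in> gen V G d"
  then obtain p q where "f = (\<Sum>x\<in>G. pmul (p x) (fst x))" "\<forall>x\<in>G. p x \<in> hom_poly V (d - int (snd x))"
    "g = (\<Sum>x\<in>G. pmul (q x) (fst x))" "\<forall>x\<in>G. q x \<in> hom_poly V (d - int (snd x))"
    unfolding gen_def by blast
  then show ?thesis
    unfolding gen_def by (intro CollectI exI[of _ "\<lambda>x. p x + q x"])
      (auto simp: pmul_add_left sum.distrib intro: hom_poly_add)
qed

lemma gen_pmul: "a \<in> hom_poly V e \<Longrightarrow> f \<in> gen V G d \<Longrightarrow> pmul a f \<in> gen V G (e + d)"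
proof -
  assume a: "a \<in> hom_poly V e" and "f \<in> gen V G d"
  then obtain p where p: "f = (\<Sum>x\<in>G. pmul (p x) (fst x))" "\<forall>x\<in>G. p x \<in> hom_poly V (d - int (snd x))"
    unfolding gen_def by blast
  have "a * p x \<in> hom_poly V (e + d - int (snd x))" if "x \<in> G" for x
    using hom_poly_mult[OF a, of "p x"] p(2) that by (fastforce simp: algebra_simps)
  then show ?thesis
    unfolding gen_def by (intro CollectI exI[of _ "\<lambda>x. a * p x"]) (auto simp: p(1) pmul_sum pmul_pmul)
qed

lemma gen_sum: "(\<And>x. x \<in> A \<Longrightarrow> f x \<in> gen V G d) \<Longrightarrow> sum f A \<in> gen V G d"
  by (induction A rule: infinite_finite_induct) (auto simp: gen_0 intro: gen_add)

lemma gen_base: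
  assumes "finite G" "(x, d) \<in> G"
  shows "const_mul c x \<in> gen V G (int d)"
proof -
  have "(\<Sum>y\<in>G. pmul (if y = (x, d) then Poly_Mapping.single 0 c else 0) (fst y)) = 
      (\<Sum>y\<in>G. if y = (x, d) then const_mul c x else 0)"
    by (intro sum.cong) auto
  also have "\<dots> = const_mul c x" using assms by simp
  finally show ?thesis
    unfolding gen_def
    by (intro CollectI exI[of _ "\<lambda>y. if y = (x, d) then Poly_Mapping.single 0 c else 0"])
      (auto intro: hom_poly_single)
qed

context koszul
begin

definition generates :: "(int \<Rightarrow> (nat \<Rightarrow> ('v, 'k::field) mpoly) set) \<Rightarrow> ((nat \<Rightarrow> ('v, 'k) mpoly) \<times> nat) set \<Rightarrow> bool" where
  "generates Z G \<longleftrightarrow> finite G \<and> (\<forall>x\<in>G. fst x \<in> Z (int (snd x))) \<and> (\<forall>d. Z d \<subseteq> gen V G d)"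

text \<open>There is nothing in negative degrees, and up to degree \<open>B\<close> spanning sets of
  the graded pieces serve as generators. Beyond \<open>B\<close> vanishing writes every element
  through variables times elements of the previous degree, so induction on the degree
  finishes.\<close>

lemma ex_generates:
  fixes Z :: "int \<Rightarrow> (nat \<Rightarrow> ('v, 'k::field) mpoly) set"
  assumes Z: "gmod X Z" and sub: "\<And>d. Z d \<subseteq> free_deg V s d"
    and van: "\<And>d. d > B \<Longrightarrow> van X 0 d Z"
  shows "\<exists>G. generates Z G"
proof -
  have "\<exists>S. finite S \<and> S \<subseteq> Z d \<and> (\<forall>z\<in>Z d. \<exists>c. z = (\<Sum>x\<in>S. const_mul (c x) x))" for d
    by (rule finite_dim[OF fin sub[of d]]) blast
  then have "\<exists>S. \<forall>d. finite (S d) \<and> S d \<subseteq> Z d \<and> (\<forall>z\<in>Z d. \<exists>c. z = (\<Sum>x\<in>S d. const_mul (c x) x))"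
    by (intro choice allI)
  then obtain S where "\<forall>d. finite (S d) \<and> S d \<subseteq> Z d \<and> (\<forall>z\<in>Z d. \<exists>c. z = (\<Sum>x\<in>S d. const_mul (c x) x))" ..
  then have S: "\<And>d. finite (S d)" "\<And>d. S d \<subseteq> Z d"
    "\<And>d z. z \<in> Z d \<Longrightarrow> \<exists>c. z = (\<Sum>x\<in>S d. const_mul (c x) x)" by simp_all
  define G where "G = (\<Union>d\<le>nat B. (\<lambda>x. (x, d)) ` S (int d))"
  have finG: "finite G" using S(1) by (simp add: G_def)
  have neg: "Z d \<subseteq> gen V G d" if "d < 0" for d
  proof
    fix z assume "z \<in> Z d"
    then have z: "z \<in> free_deg V s d" using sub by blast
    have "z k = 0" for k
      using z that hom_poly_neg[of "z k" V "d - int (s ! k)"] by (cases "k < length s") (auto simp: free_deg_iff)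
    then have "z = 0" by auto
    then show "z \<in> gen V G d" by (simp add: gen_0)
  qed
  have nonneg: "Z (int d) \<subseteq> gen V G (int d)" for d
  proof (induction d rule: less_induct)
    case (less d)
    show ?case
    proof
      fix z assume z: "z \<in> Z (int d)"
      show "z \<in> gen V G (int d)"
      proof (cases "int d > B")
        case True
        obtain b where b: "b \<in> chains (Suc 0) (Z (int d - 1))" "bd X b {} = z"
          using van[OF True] z van_0_iff[OF Z] by blast
        have "Z (int d - 1) \<subseteq> gen V G (int d - 1)"
          using less.IH[of "d - 1"] neg[of "int d - 1"] by (cases d) auto
        moreover have "b {v} \<in> Z (int d - 1)" if "v \<in> V" for v using chainsD[OF b(1), of "{v}"] that by simp
        ultimately have "X v (b {v}) \<in> gen V G (int d)" if "v \<in> V" for v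
          using gen_pmul[OF hom_poly_var[OF that], of "b {v}" G "int d - 1"] that by (auto simp: subset_iff)
        then have "(\<Sum>v\<in>V. sgs v {} (X v (b {v}))) \<in> gen V G (int d)"
          by (intro gen_sum) (auto simp: sgs_def)
        then show ?thesis using b(2) by (simp add: bd_def)
      next
        case False
        obtain c where c: "z = (\<Sum>x\<in>S (int d). const_mul (c x) x)" using S(3)[OF z] by blast
        have "(x, d) \<in> G" if "x \<in> S (int d)" for x using that False by (auto simp: G_def)
        then show ?thesis unfolding c by (intro gen_sum gen_base finG)
      qed
    qed
  qed
  have "Z d \<subseteq> gen V G d" for d
    using neg[of d] nonneg[of "nat d"] by (cases "d < 0") auto
  moreover have "\<forall>x\<in>G. fst x \<in> Z (int (snd x))" unfolding G_def using S(2) by fastforce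
  ultimately show ?thesis using finG by (auto simp: generates_def)
qed

text \<open>Take a homogeneous generating set of least cardinality. A relation with a nonzero
  constant term at one generator would make that generator redundant.\<close>

lemma minimal_cover:
  fixes Z :: "int \<Rightarrow> (nat \<Rightarrow> ('v, 'k::field) mpoly) set"
  assumes Z: "gmod X Z" and sub: "\<And>d. Z d \<subseteq> free_deg V s d"
    and mul: "\<And>p e z d. p \<in> hom_poly V e \<Longrightarrow> z \<in> Z d \<Longrightarrow> pmul p z \<in> Z (e + d)"
    and van: "\<And>d. d > B \<Longrightarrow> van X 0 d Z"
  shows "\<exists>t A. A \<in> graded_maps V t s \<and> (\<forall>d. act A ` free_deg V t d = Z d) \<and>
    (\<forall>d f k. f \<in> free_deg V t d \<longrightarrow> act A f = 0 \<longrightarrow> Poly_Mapping.lookup (f k) 0 = 0)"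
proof -
  obtain G where G: "generates Z G" and Gmin: "\<And>G'. generates Z G' \<Longrightarrow> card G \<le> card G'"
    using ex_generates[OF Z sub van] ex_has_least_nat[of "generates Z" _ card] by metis
  have finG: "finite G" and GZ: "\<And>x. x \<in> G \<Longrightarrow> fst x \<in> Z (int (snd x))" and ZG: "\<And>d. Z d \<subseteq> gen V G d"
    using G by (auto simp: generates_def)
  obtain xs where xs: "set xs = G" "distinct xs" using finite_distinct_list[OF finG] by blast
  define n where "n = length xs"
  define t where "t = map snd xs"
  define A where "A = mat (length s) n (\<lambda>(j, k). fst (xs ! k) j)"
  have bij: "bij_betw ((!) xs) {..<n} G"
    using bij_betw_nth[OF xs(2), of "{..<n}" G] xs(1) by (simp add: n_def)
  have xsG: "xs ! k \<in> G" if "k < n" for k using that xs(1) by (auto simp: n_def)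
  have xsZ: "fst (xs ! k) \<in> free_deg V s (int (snd (xs ! k)))" if "k < n" for k using GZ[OF xsG[OF that]] sub by blast
  have lt: "length t = n" "\<And>k. k < n \<Longrightarrow> t ! k = snd (xs ! k)" by (auto simp: t_def n_def)
  have A: "A \<in> graded_maps V t s"
    using xsZ by (auto simp: graded_maps_iff A_def lt free_deg_iff)
  have actA: "act A f = (\<Sum>k<n. pmul (f k) (fst (xs ! k)))" for f
  proof
    fix j
    show "act A f j = (\<Sum>k<n. pmul (f k) (fst (xs ! k))) j"
    proof (cases "j < length s")
      case True
      then show ?thesis by (simp add: act_def A_def sum_fun_apply pmul_def mult.commute)
    next
      case False
      then show ?thesis using xsZ by (simp add: act_def A_def sum_fun_apply pmul_def free_deg_iff)
    qed
  qed
  have sumG: "(\<Sum>k<n. pmul (q (xs ! k)) (fst (xs ! k))) = (\<Sum>x\<in>G. pmul (q x) (fst x))" for q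
    by (rule sum.reindex_bij_betw[OF bij])
  have im: "act A ` free_deg V t d = Z d" for d
  proof
    show "act A ` free_deg V t d \<subseteq> Z d"
    proof clarify
      fix f :: "nat \<Rightarrow> ('v, 'k) mpoly" assume f: "f \<in> free_deg V t d"
      have "pmul (f k) (fst (xs ! k)) \<in> Z d" if "k < n" for k
        using mul[OF _ GZ[OF xsG[OF that]], of "f k" "d - int (snd (xs ! k))"] f that by (simp add: free_deg_iff lt)
      then show "act A f \<in> Z d" unfolding actA by (intro gmod_sum_in[OF Z]) simp
    qed
    show "Z d \<subseteq> act A ` free_deg V t d"
    proof
      fix z assume "z \<in> Z d"
      then obtain p where p: "z = (\<Sum>x\<in>G. pmul (p x) (fst x))" "\<forall>x\<in>G. p x \<in> hom_poly V (d - int (snd x))"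
        using ZG unfolding gen_def by blast
      define f where "f k = (if k < n then p (xs ! k) else 0)" for k
      have "f \<in> free_deg V t d" using p(2) xsG by (simp add: free_deg_iff lt f_def)
      moreover have "act A f = z" unfolding actA p(1) sumG[symmetric] by (simp add: f_def)
      ultimately show "z \<in> act A ` free_deg V t d" by blast
    qed
  qed
  have "Poly_Mapping.lookup (f k0) 0 = 0" if f: "f \<in> free_deg V t d" "act A f = 0" for d f k0
  proof (rule ccontr)
    assume nz: "Poly_Mapping.lookup (f k0) 0 \<noteq> 0"
    define c where "c = Poly_Mapping.lookup (f k0) 0"
    have k0: "k0 < n" using nz f(1) by (auto simp: free_deg_iff lt not_less[symmetric])
    define x0 where "x0 = xs ! k0"
    have x0: "x0 \<in> G" using xsG[OF k0] by (simp add: x0_def)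
    define p where "p x = f (the_inv_into {..<n} ((!) xs) x)" for x
    have pk: "p (xs ! k) = f k" if "k < n" for k
      using that bij the_inv_into_f_f[of "(!) xs" "{..<n}" k] by (simp add: p_def bij_betw_def)
    have ph: "p x \<in> hom_poly V (d - int (snd x))" if xG: "x \<in> G" for x
    proof -
      obtain k where "k < n" "x = xs ! k" using xG xs(1) by (auto simp: in_set_conv_nth n_def)
      then show ?thesis using pk f(1) by (simp add: free_deg_iff lt)
    qed
    have psum: "(\<Sum>x\<in>G. pmul (p x) (fst x)) = 0"
      using f(2) unfolding actA sumG[of p, symmetric] by (simp add: pk)
    have f0: "f k0 \<in> hom_poly V (d - int (snd x0))" using ph[OF x0] pk[OF k0] by (simp add: x0_def)
    \<comment> \<open>A homogeneous coefficient with a nonzero constant term has degree 0, so the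
      coefficient of \<open>x0\<close> is an invertible scalar.\<close>
    then have d: "d = int (snd x0)" using nz hom_poly_lookup_0 by fastforce
    then have p0: "p x0 = Poly_Mapping.single 0 c"
      using f0 hom_poly_const[of "f k0" V] pk[OF k0] by (simp add: c_def x0_def)
    have "generates Z (G - {x0})"
      unfolding generates_def
    proof (intro conjI allI subsetI ballI)
      fix d' z assume "z \<in> Z d'"
      then obtain q where q: "z = (\<Sum>x\<in>G. pmul (q x) (fst x))" "\<forall>x\<in>G. q x \<in> hom_poly V (d' - int (snd x))"
        using ZG unfolding gen_def by blast
      \<comment> \<open>Subtracting \<open>a\<close> times the relation cancels the coefficient of
        \<open>x0\<close> in an arbitrary combination.\<close>
      define a where "a = q x0 * Poly_Mapping.single 0 (inverse c)"
      define r where "r x = q x - a * p x" for x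
      have "a \<in> hom_poly V (d' - d)"
        using hom_poly_mult[of "q x0" V "d' - int (snd x0)" "Poly_Mapping.single 0 (inverse c)" 0] q(2) x0
        by (simp add: a_def d hom_poly_single)
      then have r: "r x \<in> hom_poly V (d' - int (snd x))" if "x \<in> G" for x
        using hom_poly_diff[of "q x" V "d' - int (snd x)" "a * p x"] q(2) that hom_poly_mult[of a V "d' - d" "p x", OF _ ph[OF that]]
        by (simp add: r_def)
      have r0: "r x0 = 0"
        using nz by (simp add: r_def a_def p0 mult.assoc mult_single c_def)
      have "(\<Sum>x\<in>G. pmul (r x) (fst x)) = z - pmul a (\<Sum>x\<in>G. pmul (p x) (fst x))"
        by (simp only: r_def pmul_diff_left sum_subtractf q(1) pmul_sum pmul_pmul)
      then have "z = (\<Sum>x\<in>G. pmul (r x) (fst x))" by (simp add: psum)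
      also have "\<dots> = (\<Sum>x\<in>G - {x0}. pmul (r x) (fst x))"
        using finG r0 by (intro sum.mono_neutral_right) auto
      finally show "z \<in> gen V (G - {x0}) d'"
        unfolding gen_def using r by blast
    qed (use finG GZ in auto)
    then have "card G \<le> card (G - {x0})" by (rule Gmin)
    then show False using x0 finG by (metis card_Diff1_less leD)
  qed
  then show ?thesis using A im by blast
qed

text \<open>The vanishing hypothesis is imposed in all homological degrees at once, so dimension
  shifting passes it on to the syzygies. Each syzygy module thus again has generators of bounded
  degree, and the construction can be continued.\<close>

lemma ex_minimal_resolution:
  assumes Std: "down_closed Std" "0 \<in> Std"
    and van: "\<And>j e. e > B \<Longrightarrow> van (smul Std) j e (stdmod Std :: int \<Rightarrow> (('v \<Rightarrow>\<^sub>0 nat) \<Rightarrow> 'k::field) set)"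
  shows "\<exists>s (D :: nat \<Rightarrow> ('v, 'k) mpoly mat). minimal_graded_free_resolution V (monomial_ideal V Std) s D"
proof -
  let ?I = "monomial_ideal V Std :: ('v, 'k) mpoly set"
  define D0 :: "('v, 'k) mpoly mat" where "D0 = mat 1 1 (\<lambda>_. 1)"
  have D0: "D0 \<in> graded_maps V [0] [0]"
    using hom_poly_single[of 0 V 0 "1::'k"] by (simp add: graded_maps_iff D0_def)
  have act0: "act D0 f 0 = f 0" for f by (simp add: act_def D0_def)
  define Z0 where "Z0 = (\<lambda>d. {f \<in> free_deg V [0] d. aug Std D0 f = 0})"
  \<comment> \<open>The bound grows by one per stage because each shift raises the internal degree
    by one; it starts at \<open>B + 1\<close> since \<open>Z0\<close> is the ideal, one step beyond
    the quotient. Absence of constant terms belongs to the invariant because it becomes the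
    minimality of the next differential.\<close>
  define good where "good i sZ \<longleftrightarrow> (case sZ of (s, Z) \<Rightarrow> gmod X Z \<and> (\<forall>d. Z d \<subseteq> free_deg V s d) \<and>
      (\<forall>p e z d. p \<in> hom_poly V e \<longrightarrow> z \<in> Z d \<longrightarrow> pmul p z \<in> Z (e + d)) \<and>
      (\<forall>d. \<forall>z\<in>Z d. \<forall>k. Poly_Mapping.lookup (z k) 0 = 0) \<and>
      (\<forall>j e. e > B + int i + 1 \<longrightarrow> van X j e Z))"
    for i :: nat and sZ :: "nat list \<times> (int \<Rightarrow> (nat \<Rightarrow> ('v, 'k) mpoly) set)"
  define nxt where "nxt sZ tY \<longleftrightarrow> (\<exists>A. A \<in> graded_maps V (fst tY) (fst sZ) \<and>
      (\<forall>d. act A ` free_deg V (fst tY) d = snd sZ d) \<and>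
      snd tY = (\<lambda>d. {f \<in> free_deg V (fst tY) d. act A f = 0}))"
    for sZ tY :: "nat list \<times> (int \<Rightarrow> (nat \<Rightarrow> ('v, 'k) mpoly) set)"
  have G: "gmod (smul Std) (stdmod Std :: int \<Rightarrow> (('v \<Rightarrow>\<^sub>0 nat) \<Rightarrow> 'k) set)" by (rule stdmod_gmod[OF Std(1)])
  have augmap: "gmap X (free_deg V [0]) (smul Std) (stdmod Std) (aug Std D0)" by (rule aug_gmap[OF Std(1) D0])
  have aug0: "aug Std D0 f = (\<lambda>m. if m \<in> Std then Poly_Mapping.lookup (f 0) m else 0)" for f
    by (auto simp: aug_def act0)
  have surj: "aug Std D0 ` free_deg V [0] e = stdmod Std e" for e
  proof
    show "aug Std D0 ` free_deg V [0] e \<subseteq> stdmod Std e" using augmap by (auto simp: gmap_def)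
    show "stdmod Std e \<subseteq> aug Std D0 ` free_deg V [0] e"
    proof
      fix z :: "('v \<Rightarrow>\<^sub>0 nat) \<Rightarrow> 'k" assume z: "z \<in> stdmod Std e"
      define f :: "nat \<Rightarrow> ('v, 'k) mpoly" where "f k = (if k = 0 then Abs_poly_mapping z else 0)" for k
      have p: "Poly_Mapping.lookup (f 0) = z"
        using z finite_stdmod_support[OF fin, of z e] by (simp add: f_def stdmod_def)
      have "f 0 \<in> hom_poly V e" using z unfolding hom_poly_iff p stdmod_def by blast
      moreover have "f k = 0" if "k \<ge> 1" for k using that by (simp add: f_def)
      ultimately have "f \<in> free_deg V [0] e" by (simp add: free_deg_iff)
      moreover have "aug Std D0 f = z"
      proof
        fix m
        have "z m = 0" if "m \<notin> Std" using z that unfolding stdmod_def by blast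
        then show "aug Std D0 f m = z m" by (simp add: aug0 p)
      qed
      ultimately show "z \<in> aug Std D0 ` free_deg V [0] e" by blast
    qed
  qed
  \<comment> \<open>The monomial 1 is standard, so the ideal is proper and its elements have no
    constant term.\<close>
  have min0: "Poly_Mapping.lookup (f k) 0 = 0" if "f \<in> free_deg V [0] e" "aug Std D0 f = 0" for e f k
  proof -
    have "Poly_Mapping.lookup (f 0) 0 = 0" using fun_cong[OF that(2), of 0] Std(2) by (simp add: aug0)
    then show ?thesis using that(1) by (cases k) (auto simp: free_deg_iff)
  qed
  have start: "good 0 ([0], Z0)"
  proof -
    have "gmod X Z0" using gmap_ker_gmod[OF free_deg_gmod G augmap] by (simp add: Z0_def)
    moreover have "pmul p z \<in> Z0 (e + d)" if p: "p \<in> hom_poly V e" and z: "z \<in> Z0 d" for p e z d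
    proof -
      have zf: "z \<in> free_deg V [0] d" "aug Std D0 z = 0" using z by (auto simp: Z0_def)
      have "z 0 \<in> ?I" using aug_eq_0_iff[OF D0, of z Std] zf free_deg_fun[OF zf(1)] act0[of z] by simp
      then have "p * z 0 \<in> ?I"
        using p Std(1) poly_ring_mult[of p V "z 0"] keys_mult[of p "z 0"]
        by (fastforce simp: monomial_ideal_def hom_poly_def down_closed_def add.commute)
      moreover have pz: "pmul p z \<in> free_deg V [0] (e + d)" using pmul_in[OF p zf(1)] .
      ultimately show ?thesis
        using aug_eq_0_iff[OF D0, of "pmul p z" Std] free_deg_fun[OF pz] act0[of "pmul p z"]
        by (simp add: Z0_def pmul_def)
    qed
    moreover have "van X j e Z0" if "e > B + 1" for j e
    proof -
      have "van (smul Std) (Suc j) (e - 1) (stdmod Std :: int \<Rightarrow> (('v \<Rightarrow>\<^sub>0 nat) \<Rightarrow> 'k) set)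
          \<longleftrightarrow> van X j (e - 1 + 1) Z0"
        by (rule van_shift_free[where \<phi> = "aug Std D0" and s = "[0]"])
          (rule G augmap surj min0 Z0_def | assumption)+
      then show ?thesis using van[of "e - 1" "Suc j"] that by simp
    qed
    ultimately show ?thesis using min0 by (auto simp: good_def Z0_def)
  qed
  have step: "\<exists>tY. good (Suc i) tY \<and> nxt sZ tY" if g: "good i sZ" for i sZ
  proof -
    obtain s Z where sZ: "sZ = (s, Z)" by fastforce
    have Z: "gmod X Z" "\<And>d. Z d \<subseteq> free_deg V s d"
      "\<And>p e z d. p \<in> hom_poly V e \<Longrightarrow> z \<in> Z d \<Longrightarrow> pmul p z \<in> Z (e + d)"
      "\<And>j e. e > B + int i + 1 \<Longrightarrow> van X j e Z"
      using g by (auto simp: good_def sZ)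
    obtain t A where A: "A \<in> graded_maps V t s" "\<And>d. act A ` free_deg V t d = Z d"
      "\<And>d f k. f \<in> free_deg V t d \<Longrightarrow> act A f = 0 \<Longrightarrow> Poly_Mapping.lookup (f k) 0 = 0"
      using minimal_cover[OF Z(1-3), of "B + int i + 1"] Z(4) by blast
    define Y where "Y = (\<lambda>d. {f \<in> free_deg V t d. act A f = 0})"
    have "gmod X Y"
      using gmap_ker_gmod[OF free_deg_gmod free_deg_gmod act_gmap[OF A(1)]] by (simp add: Y_def)
    moreover have "pmul p z \<in> Y (e + d)" if "p \<in> hom_poly V e" "z \<in> Y d" for p e z d
      using that pmul_in[of p V e z t d] by (auto simp: Y_def act_pmul)
    moreover have "van X j e Y" if "e > B + int i + 2" for j e
    proof -
      have m: "gmap X (free_deg V t) X Z (act A)" using act_gmap[OF A(1)] A(2) by (auto simp: gmap_def)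
      have "van X (Suc j) (e - 1) Z \<longleftrightarrow> van X j (e - 1 + 1) Y"
        by (rule van_shift_free[where \<phi> = "act A" and s = t]) (rule Z(1) m A(2) A(3) Y_def | assumption)+
      then show ?thesis using Z(4)[of "e - 1" "Suc j"] that by simp
    qed
    ultimately have "good (Suc i) (t, Y)" using A(3) by (auto simp: good_def Y_def algebra_simps)
    moreover have "nxt sZ (t, Y)" using A by (auto simp: nxt_def sZ Y_def)
    ultimately show ?thesis by blast
  qed
  obtain F where F: "\<And>i. good i (F i)" "\<And>i. nxt (F i) (F (Suc i))" "F 0 = ([0], Z0)"
  proof -
    have "\<exists>f. \<forall>i. (good i (f i) \<and> (i = 0 \<longrightarrow> f i = ([0], Z0))) \<and> nxt (f i) (f (Suc i))"
      by (rule dependent_nat_choice) (use start step in blast)+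
    then show thesis using that by blast
  qed
  define s where "s i = fst (F i)" for i
  define Z where "Z i = snd (F i)" for i
  have s0: "s 0 = [0]" and Z0: "Z 0 = Z0" using F(3) by (auto simp: s_def Z_def)
  have "\<forall>i. \<exists>A. A \<in> graded_maps V (s (Suc i)) (s i) \<and> (\<forall>d. act A ` free_deg V (s (Suc i)) d = Z i d) \<and>
      Z (Suc i) = (\<lambda>d. {f \<in> free_deg V (s (Suc i)) d. act A f = 0})"
    using F(2) by (simp add: nxt_def s_def Z_def)
  from choice[OF this] obtain A where A': "\<forall>i. A i \<in> graded_maps V (s (Suc i)) (s i) \<and>
      (\<forall>d. act (A i) ` free_deg V (s (Suc i)) d = Z i d) \<and>
      Z (Suc i) = (\<lambda>d. {f \<in> free_deg V (s (Suc i)) d. act (A i) f = 0})" ..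
  have A: "\<And>i. A i \<in> graded_maps V (s (Suc i)) (s i)"
    "\<And>i d. act (A i) ` free_deg V (s (Suc i)) d = Z i d"
    "\<And>i. Z (Suc i) = (\<lambda>d. {f \<in> free_deg V (s (Suc i)) d. act (A i) f = 0})"
    using A' by simp_all
  have Zmin: "Poly_Mapping.lookup (z k) 0 = 0" if "z \<in> Z i d" for i d z k
    using F(1)[of i] that by (auto simp: good_def Z_def split: prod.splits)
  define D where "D i = (case i of 0 \<Rightarrow> D0 | Suc i' \<Rightarrow> A i')" for i
  have DS: "D (Suc i) = A i" "D 0 = D0" for i by (simp_all add: D_def)
  have dim0: "D0 \<in> carrier_mat 1 1" by (simp add: D0_def)
  have dimS: "A i \<in> carrier_mat (length (s i)) (length (s (Suc i)))" for i using A(1)[of i] by (auto simp: graded_maps_def)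
  have D0f: "(D0 *\<^sub>v f) $ 0 = fun_of_vec 1 f 0" if "f \<in> free_module V 1" for f
    using fun_cong[OF fun_of_vec_mult[OF dim0, of f], of 0] that by (auto simp: free_module_def fun_of_vec_def act0)
  have Af: "A i *\<^sub>v f = 0\<^sub>v (length (s i)) \<longleftrightarrow> act (A i) (fun_of_vec (length (s (Suc i))) f) = 0"
    if f: "f \<in> free_module V (length (s (Suc i)))" for f i
  proof -
    have "fun_of_vec (length (s i)) (A i *\<^sub>v f) = 0 \<longleftrightarrow> A i *\<^sub>v f = 0\<^sub>v (length (s i))"
      using dimS[of i] by (auto simp: fun_of_vec_def fun_eq_iff vec_eq_iff)
    then show ?thesis using fun_of_vec_mult[OF dimS, of f i] f by (auto simp: free_module_def)
  qed
  have ex0: "act (A 0) ` free_fun V (length (s 1)) = {f \<in> free_fun V (length (s 0)). f 0 \<in> ?I}"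
  proof (rule exact_from_degreewise[of _ _ "s 1" "s 0" "\<lambda>f. f 0 \<in> ?I"])
    show "A 0 \<in> graded_maps V (s 1) (s 0)" using A(1)[of 0] by simp
    show "act (A 0) ` free_deg V (s 1) d = {f \<in> free_deg V (s 0) d. f 0 \<in> ?I}" for d
    proof -
      have "aug Std D0 f = 0 \<longleftrightarrow> f 0 \<in> ?I" if "f \<in> free_deg V [0] d" for f
        using aug_eq_0_iff[OF D0 free_deg_fun[OF that]] by (simp add: act0)
      then have "Z0 d = {f \<in> free_deg V [0] d. f 0 \<in> ?I}" unfolding Z0_def by blast
      then show ?thesis using A(2)[of 0 d] by (simp add: Z0 s0)
    qed
    show "(0 :: nat \<Rightarrow> ('v, 'k) mpoly) 0 \<in> ?I" by (simp add: monomial_ideal_def poly_ring_def)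
    show "(f + g) 0 \<in> ?I" if "f 0 \<in> ?I" "g 0 \<in> ?I" for f g :: "nat \<Rightarrow> ('v, 'k) mpoly"
      using that keys_add[of "f 0" "g 0"] poly_ring_add by (fastforce simp: monomial_ideal_def)
    show "vcomp (s 0) d f 0 \<in> ?I" if "f 0 \<in> ?I" for d and f :: "nat \<Rightarrow> ('v, 'k) mpoly"
      using that by (auto simp: vcomp_def s0 monomial_ideal_def poly_ring_def in_keys_iff lookup_hcomp split: if_splits)
  qed
  have exS: "act (A (Suc i)) ` free_fun V (length (s (Suc (Suc i)))) = {f \<in> free_fun V (length (s (Suc i))). act (A i) f = 0}" for i
  proof (rule exact_from_degreewise[OF A(1)])
    show "act (A (Suc i)) ` free_deg V (s (Suc (Suc i))) d = {f \<in> free_deg V (s (Suc i)) d. act (A i) f = 0}" for d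
      using A(2)[of "Suc i" d] A(3)[of i] by simp
    show "act (A i) (vcomp (s (Suc i)) d f) = 0" if "act (A i) f = 0" for d f
      unfolding act_vcomp[OF A(1)] that by (auto simp: vcomp_def)
  qed (simp_all add: act_add)
  have "minimal_graded_free_resolution V ?I s D"
    unfolding minimal_graded_free_resolution_def Let_def
  proof (intro conjI allI ballI impI)
    show "D 0 \<in> graded_maps V (s 0) [0]" using D0 by (simp add: DS s0)
    show "D (Suc i) \<in> graded_maps V (s (Suc i)) (s i)" for i using A(1) by (simp add: DS)
    show "\<exists>f\<in>free_module V (length (s 0)). p - (D 0 *\<^sub>v f) $ 0 \<in> ?I" if p: "p \<in> poly_ring V" for p
    proof
      show v: "vec 1 (\<lambda>_. p) \<in> free_module V (length (s 0))" using p by (simp add: free_module_def s0)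
      show "p - (D 0 *\<^sub>v vec 1 (\<lambda>_. p)) $ 0 \<in> ?I"
        using D0f[of "vec 1 (\<lambda>_. p)"] v
        by (simp add: DS s0 fun_of_vec_def monomial_ideal_def poly_ring_def)
    qed
    show "(\<lambda>f. D 1 *\<^sub>v f) ` free_module V (length (s 1)) = {f \<in> free_module V (length (s 0)). (D 0 *\<^sub>v f) $ 0 \<in> ?I}"
      using ex0 D0f mult_vec_image_iff[OF dimS[of 0], of V "\<lambda>f. f 0 \<in> ?I"] by (simp add: DS s0 cong: conj_cong)
    show "(\<lambda>f. D (Suc (Suc i)) *\<^sub>v f) ` free_module V (length (s (Suc (Suc i)))) =
        {f \<in> free_module V (length (s (Suc i))). D (Suc i) *\<^sub>v f = 0\<^sub>v (length (s i))}" for i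
      using exS[of i] Af[of _ i] mult_vec_image_iff[OF dimS[of "Suc i"], of V "\<lambda>f. act (A i) f = 0"]
      by (simp add: DS cong: conj_cong)
    show "Poly_Mapping.lookup (D (Suc i) $$ (j, k)) 0 = 0"
      if jk: "j < length (s i)" "k < length (s (Suc i))" for i j k
    proof -
      \<comment> \<open>An entry of the matrix is a coordinate of the image of a basis vector, and
        this image lies in \<open>Z i\<close>, where constant terms are absent.\<close>
      have "(unit_fun k 0 :: nat \<Rightarrow> ('v, 'k) mpoly) \<in> free_deg V (s (Suc i)) (int (s (Suc i) ! k))"
        using jk hom_poly_single[of 0 V 0 "1::'k"] by (auto simp: free_deg_iff unit_fun_def)
      then have "act (A i) (unit_fun k 0) \<in> Z i (int (s (Suc i) ! k))" using A(2) by blast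
      then have "Poly_Mapping.lookup (act (A i) (unit_fun k 0) j) 0 = 0" by (rule Zmin)
      moreover have "act (A i) (unit_fun k 0) j = (\<Sum>k'<length (s (Suc i)). A i $$ (j, k') * unit_fun k 0 k')"
        using jk dimS[of i] by (simp add: act_def)
      moreover have "A i $$ (j, k') * unit_fun k 0 k' = (if k' = k then A i $$ (j, k) else 0)" for k'
        by (simp add: unit_fun_def)
      ultimately show ?thesis using jk by (simp add: DS)
    qed
  qed
  then show ?thesis by blast
qed

end


section \<open>Edge ideals and hexagons\<close>

definition indep_monomials :: "'v graph \<Rightarrow> ('v \<Rightarrow>\<^sub>0 nat) set" where
  "indep_monomials G = {m. \<forall>e\<in>edges G. \<not> e \<subseteq> Poly_Mapping.keys m}"

lemma down_closed_indep_monomials: "down_closed (indep_monomials G)"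
  by (auto simp: down_closed_def indep_monomials_def keys_nat_add)

lemma monomial_ideal_sum:
  fixes f :: "'a \<Rightarrow> ('v, 'k::comm_ring_1) mpoly"
  shows "(\<And>x. x \<in> A \<Longrightarrow> f x \<in> monomial_ideal V Std) \<Longrightarrow> sum f A \<in> monomial_ideal V Std"
proof (induction A rule: infinite_finite_induct)
  case (insert x A)
  then have "f x \<in> monomial_ideal V Std" "sum f A \<in> monomial_ideal V Std" by auto
  then have "f x + sum f A \<in> monomial_ideal V Std"
    using keys_add[of "f x" "sum f A"] poly_ring_add[of "f x" V "sum f A"] unfolding monomial_ideal_def by blast
  then show ?case using insert.hyps by simp
qed (auto simp: monomial_ideal_def poly_ring_def)

text \<open>A monomial whose support contains an edge is divisible by the product of the two ends,
  and the monomials of a polynomial can be treated one by one.\<close>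

lemma edge_ideal_eq_monomial_ideal:
  assumes E: "\<And>e. e \<in> edges G \<Longrightarrow> \<exists>x y. e = {x, y} \<and> x \<noteq> y \<and> x \<in> verts G \<and> y \<in> verts G"
  shows "(edge_ideal G :: ('v, 'k::field) mpoly set) = monomial_ideal (verts G) (indep_monomials G)"
proof
  let ?V = "verts G" and ?I = "monomial_ideal (verts G) (indep_monomials G) :: ('v, 'k) mpoly set"
  have vv: "var x * var y = (Poly_Mapping.single (xvar x + xvar y) 1 :: ('v, 'k) mpoly)" for x y
    by (simp add: var_eq mult_single)
  show "edge_ideal G \<subseteq> ?I"
  proof
    fix p :: "('v, 'k) mpoly" assume "p \<in> edge_ideal G"
    then obtain T c where p: "p = (\<Sum>g\<in>T. c g * g)" and T: "T \<subseteq> {var x * var y | x y. {x, y} \<in> edges G}"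
      and c: "\<forall>g\<in>T. c g \<in> poly_ring ?V"
      unfolding edge_ideal_def ideal_generated_def by blast
    have "c g * g \<in> ?I" if g: "g \<in> T" for g
    proof -
      obtain x y where xy: "g = var x * var y" "{x, y} \<in> edges G" using T g by blast
      have V: "x \<in> ?V" "y \<in> ?V" using E[OF xy(2)] by (auto simp: doubleton_eq_iff)
      have keys: "{x, y} \<subseteq> Poly_Mapping.keys m \<and> Poly_Mapping.keys m \<subseteq> ?V" if "m \<in> Poly_Mapping.keys (c g * g)" for m
      proof -
        obtain m' where "m' \<in> Poly_Mapping.keys (c g)" "m = m' + (xvar x + xvar y)"
          using \<open>m \<in> Poly_Mapping.keys (c g * g)\<close> keys_mult[of "c g" g] unfolding xy(1) vv by auto
        then show ?thesis using c g V by (auto simp: keys_nat_add poly_ring_def)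
      qed
      then show ?thesis using xy(2) unfolding monomial_ideal_def poly_ring_def indep_monomials_def by blast
    qed
    then show "p \<in> ?I" unfolding p by (rule monomial_ideal_sum)
  qed
  show "?I \<subseteq> edge_ideal G"
  proof
    fix p assume p: "p \<in> ?I"
    have "\<forall>m. \<exists>xy. m \<in> Poly_Mapping.keys p \<longrightarrow> {fst xy, snd xy} \<in> edges G \<and>
        m = (m - xvar (fst xy) - xvar (snd xy)) + (xvar (fst xy) + xvar (snd xy))"
    proof
      fix m
      show "\<exists>xy. m \<in> Poly_Mapping.keys p \<longrightarrow> {fst xy, snd xy} \<in> edges G \<and>
        m = (m - xvar (fst xy) - xvar (snd xy)) + (xvar (fst xy) + xvar (snd xy))"
      proof (cases "m \<in> Poly_Mapping.keys p")
        case True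
        then obtain e where e: "e \<in> edges G" "e \<subseteq> Poly_Mapping.keys m"
          using p by (auto simp: monomial_ideal_def indep_monomials_def)
        then obtain x y where xy: "e = {x, y}" "x \<noteq> y" using E by blast
        \<comment> \<open>Subtraction of exponents is truncated at 0; the identity holds because
          \<open>x\<close> and \<open>y\<close> are distinct and both divide
          \<open>m\<close>.\<close>
        have "m = (m - xvar x - xvar y) + (xvar x + xvar y)"
          using e(2) xy by (intro poly_mapping_eqI) (auto simp: lookup_add lookup_minus lookup_xvar in_keys_iff)
        then show ?thesis using e(1) xy(1) by (intro exI[of _ "(x, y)"]) simp
      qed simp
    qed
    from choice[OF this] obtain h where h: "\<And>m. m \<in> Poly_Mapping.keys p \<Longrightarrow> {fst (h m), snd (h m)} \<in> edges G"
      "\<And>m. m \<in> Poly_Mapping.keys p \<Longrightarrow> m = (m - xvar (fst (h m)) - xvar (snd (h m))) + (xvar (fst (h m)) + xvar (snd (h m)))"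
      by blast
    define q where "q m = m - xvar (fst (h m)) - xvar (snd (h m))" for m
    define g :: "('v \<Rightarrow>\<^sub>0 nat) \<Rightarrow> ('v, 'k) mpoly" where "g m = var (fst (h m)) * var (snd (h m))" for m
    \<comment> \<open>An element of \<open>ideal_generated\<close> has a single coefficient per
      generator, so the cofactors of all monomials assigned to the same product \<open>y\<close> are
      added up.\<close>
    define c where "c y = (\<Sum>m\<in>{m \<in> Poly_Mapping.keys p. g m = y}. Poly_Mapping.single (q m) (Poly_Mapping.lookup p m))" for y
    have "p = (\<Sum>m\<in>Poly_Mapping.keys p. Poly_Mapping.single (q m) (Poly_Mapping.lookup p m) * g m)"
    proof -
      have "Poly_Mapping.single m (Poly_Mapping.lookup p m) = Poly_Mapping.single (q m) (Poly_Mapping.lookup p m) * g m"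
        if "m \<in> Poly_Mapping.keys p" for m
        using h(2)[OF that] by (simp add: g_def vv mult_single q_def)
      then show ?thesis using poly_mapping_sum_single[of p] by simp
    qed
    also have "\<dots> = (\<Sum>y\<in>g ` Poly_Mapping.keys p. \<Sum>m\<in>{m \<in> Poly_Mapping.keys p. g m = y}. Poly_Mapping.single (q m) (Poly_Mapping.lookup p m) * g m)"
      by (rule sum.image_gen) simp
    also have "\<dots> = (\<Sum>y\<in>g ` Poly_Mapping.keys p. c y * y)"
      by (intro sum.cong) (auto simp: c_def sum_distrib_right)
    finally have "p = (\<Sum>y\<in>g ` Poly_Mapping.keys p. c y * y)" .
    moreover have "c y \<in> poly_ring ?V" for y
    proof -
      have "Poly_Mapping.single (q m) (Poly_Mapping.lookup p m) \<in> poly_ring ?V" if "m \<in> Poly_Mapping.keys p" for m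
      proof -
        have "Poly_Mapping.keys m \<subseteq> ?V" using p that by (auto simp: monomial_ideal_def poly_ring_def)
        moreover have "Poly_Mapping.keys (q m) \<subseteq> Poly_Mapping.keys m"
          by (auto simp: q_def in_keys_iff lookup_minus)
        ultimately show ?thesis by (auto simp: poly_ring_def)
      qed
      then show ?thesis unfolding c_def by (intro poly_ring_sum) auto
    qed
    moreover have "g ` Poly_Mapping.keys p \<subseteq> {var x * var y | x y. {x, y} \<in> edges G}"
      using h(1) by (auto simp: g_def)
    ultimately show "p \<in> edge_ideal G"
      unfolding edge_ideal_def ideal_generated_def
      by (intro CollectI exI[of _ "g ` Poly_Mapping.keys p"] exI[of _ c]) auto
  qed
qed

section \<open>Squarefree monomials\<close>

definition sqfree :: "'v set \<Rightarrow> 'v \<Rightarrow>\<^sub>0 nat" where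
  "sqfree F = (\<Sum>w\<in>F. xvar w)"

lemma lookup_sqfree: "finite F \<Longrightarrow> Poly_Mapping.lookup (sqfree F) w = (if w \<in> F then 1 else 0)"
  by (simp add: sqfree_def lookup_sum lookup_xvar)

lemma keys_sqfree: "finite F \<Longrightarrow> Poly_Mapping.keys (sqfree F) = F"
  by (auto simp: in_keys_iff lookup_sqfree split: if_splits)

lemma mon_deg_sqfree: "finite F \<Longrightarrow> mon_deg (sqfree F) = card F"
  by (simp add: mon_deg_def keys_sqfree lookup_sqfree)

lemma sqfree_minus: "finite F \<Longrightarrow> sqfree F - xvar w = sqfree (F - {w})"
  by (rule poly_mapping_eqI) (auto simp: lookup_minus lookup_sqfree lookup_xvar)

text \<open>The orbits have two elements and cancel within themselves, also in characteristic 2,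
  where reindexing along \<open>\<sigma>\<close> would be inconclusive.\<close>

lemma sum_involution_zero:
  fixes f :: "'a \<Rightarrow> 'm::ab_group_add"
  assumes "finite A" "\<And>x. x \<in> A \<Longrightarrow> \<sigma> x \<in> A" "\<And>x. x \<in> A \<Longrightarrow> \<sigma> (\<sigma> x) = x"
    "\<And>x. x \<in> A \<Longrightarrow> \<sigma> x \<noteq> x" "\<And>x. x \<in> A \<Longrightarrow> f (\<sigma> x) = - f x"
  shows "sum f A = 0"
  using assms
proof (induction "card A" arbitrary: A rule: less_induct)
  case less
  show ?case
  proof (cases "A = {}")
    case False
    then obtain x where x: "x \<in> A" by blast
    define A' where "A' = A - {x, \<sigma> x}"
    have A: "A = insert x (insert (\<sigma> x) A')" "x \<notin> insert (\<sigma> x) A'" "\<sigma> x \<notin> A'" "finite A'"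
      using x less.prems(1) less.prems(2,4)[OF x] by (auto simp: A'_def)
    have "card A' < card A" using A by simp
    moreover have "\<sigma> y \<in> A'" if "y \<in> A'" for y
    proof -
      have y: "y \<in> A" "y \<noteq> x" "y \<noteq> \<sigma> x" using that by (auto simp: A'_def)
      have "\<sigma> y \<noteq> x" using less.prems(3)[OF y(1)] y(3) by auto
      moreover have "\<sigma> y \<noteq> \<sigma> x" using less.prems(3)[OF y(1)] less.prems(3)[OF x] y(2) by metis
      ultimately show ?thesis using less.prems(2)[OF y(1)] by (simp add: A'_def)
    qed
    moreover have "y \<in> A" if "y \<in> A'" for y using that by (simp add: A'_def)
    ultimately have "sum f A' = 0" using less.prems(3-5) A(4) by (intro less.hyps) auto
    then show ?thesis using A less.prems(5)[OF x] by simp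
  qed simp
qed

context koszul
begin

lemma van_neg: "e < 0 \<Longrightarrow> van (smul Std) j e (stdmod Std :: int \<Rightarrow> (('v \<Rightarrow>\<^sub>0 nat) \<Rightarrow> 'k::field) set)"
  unfolding van_def
proof safe
  fix c :: "'v set \<Rightarrow> ('v \<Rightarrow>\<^sub>0 nat) \<Rightarrow> 'k"
  assume e: "e < 0" and c: "c \<in> chains j (stdmod Std e)" "bd (smul Std) c = (\<lambda>_. 0)"
  have "c T = 0" for T
  proof (cases "T \<subseteq> V \<and> card T = j")
    case True
    then have "c T m = 0" for m using chainsD[OF c(1), of T] e by (force simp: stdmod_def)
    then show ?thesis by auto
  qed (use chains_eq_0[OF c(1)] in simp)
  then have "c = (\<lambda>_. 0)" by auto
  then show "\<exists>b\<in>chains (Suc j) (stdmod Std (e - 1)). bd (smul Std) b = c"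
    using c(2) by (intro bexI[of _ "\<lambda>_. 0"] chains_0) (auto simp: stdmod_def)
qed

text \<open>The upper bound is used twice: it provides a minimal resolution, so that the choice in
  \<open>graded_betti\<close> is a genuine one, and together with \<open>van_neg\<close> it confines
  the differences to \<open>{0..B}\<close>, so that \<open>Max\<close> is taken over a finite
  set.\<close>

lemma quotient_reg_eqI:
  assumes Std: "down_closed Std" "0 \<in> Std"
    and upper: "\<And>j e. e > B \<Longrightarrow> van (smul Std) j e (stdmod Std :: int \<Rightarrow> (('v \<Rightarrow>\<^sub>0 nat) \<Rightarrow> 'k::field) set)"
    and lower: "\<not> van (smul Std) i B (stdmod Std :: int \<Rightarrow> (('v \<Rightarrow>\<^sub>0 nat) \<Rightarrow> 'k) set)"
  shows "quotient_reg V (monomial_ideal V Std :: ('v, 'k) mpoly set) = B"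
proof -
  let ?I = "monomial_ideal V Std :: ('v, 'k) mpoly set"
  define s where "s = (SOME s. \<exists>D. minimal_graded_free_resolution V ?I s D)"
  have "\<exists>s D. minimal_graded_free_resolution V ?I s D"
    by (rule ex_minimal_resolution[OF Std upper])
  then have "\<exists>D. minimal_graded_free_resolution V ?I s D"
    unfolding s_def by (rule someI_ex)
  then obtain D where "minimal_graded_free_resolution V ?I s D" ..
  then have mem: "d \<in> set (s i) \<longleftrightarrow> \<not> van (smul Std) i (int d - int i) (stdmod Std :: int \<Rightarrow> (('v \<Rightarrow>\<^sub>0 nat) \<Rightarrow> 'k) set)" for d i
    by (rule mgfr_shifts_iff[OF Std(1)])
  have betti: "graded_betti V ?I i d \<noteq> 0 \<longleftrightarrow> d \<in> set (s i)" for i d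
    by (simp add: graded_betti_def s_def[symmetric] count_list_0_iff)
  let ?E = "{int d - int i | i d. graded_betti V ?I i d \<noteq> 0}"
  have E: "?E \<subseteq> {0..B}"
  proof clarify
    fix i d assume "0 < graded_betti V ?I i d"
    then have "\<not> van (smul Std) i (int d - int i) (stdmod Std :: int \<Rightarrow> (('v \<Rightarrow>\<^sub>0 nat) \<Rightarrow> 'k) set)"
      using betti mem by simp
    then show "int d - int i \<in> {0..B}" using upper van_neg by (meson atLeastAtMost_iff not_le)
  qed
  have "B \<ge> 0" using lower van_neg by (meson not_le)
  then have "nat (B + int i) \<in> set (s i)" using mem lower by simp
  then have "B \<in> ?E" using betti[of i "nat (B + int i)"] \<open>B \<ge> 0\<close> by (intro CollectI exI[of _ i] exI[of _ "nat (B + int i)"]) auto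
  moreover have "y \<le> B" if "y \<in> ?E" for y using subsetD[OF E that] by simp
  moreover have "finite ?E" by (rule finite_subset[OF E]) simp
  ultimately have "Max ?E = B" by (intro Max_eqI)
  then show ?thesis by (simp add: quotient_reg_def)
qed

end

text \<open>
  The join of an edgeless graph on \<open>A\<close> with $n$ copies of $B_b$. The index \<open>(k, True)\<close> stands for
  the clique of the $x_i$ in copy \<open>k\<close>, \<open>(k, False)\<close> for the clique of the $y_i$; the order
  lists the vertices clique by clique.
\<close>

locale joined_prisms = koszul V ord for V :: "'v set" and ord :: "'v \<Rightarrow> nat" +
  fixes G :: "'v graph" and A :: "'v set" and n b :: nat and vert :: "nat \<times> bool \<Rightarrow> nat \<Rightarrow> 'v"
  assumes verts_G: "verts G = V"
    and V_eq: "V = A \<union> (\<Union>p\<in>{1..n} \<times> UNIV. vert p ` {1..b})"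
    and A_disj: "p \<in> {1..n} \<times> UNIV \<Longrightarrow> i \<in> {1..b} \<Longrightarrow> vert p i \<notin> A"
    and vert_inj: "p \<in> {1..n} \<times> UNIV \<Longrightarrow> q \<in> {1..n} \<times> UNIV \<Longrightarrow> i \<in> {1..b} \<Longrightarrow> j \<in> {1..b} \<Longrightarrow>
      vert p i = vert q j \<longleftrightarrow> p = q \<and> i = j"
    and clique: "p \<in> {1..n} \<times> UNIV \<Longrightarrow> i \<in> {1..b} \<Longrightarrow> j \<in> {1..b} \<Longrightarrow> i \<noteq> j \<Longrightarrow> {vert p i, vert p j} \<in> edges G"
    and cone: "a \<in> A \<Longrightarrow> p \<in> {1..n} \<times> UNIV \<Longrightarrow> i \<in> {1..b} \<Longrightarrow> {a, vert p i} \<in> edges G"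
    and edges_cases: "e \<in> edges G \<Longrightarrow>
      (\<exists>p\<in>{1..n} \<times> UNIV. \<exists>i\<in>{1..b}. \<exists>j\<in>{1..b}. i \<noteq> j \<and> e = {vert p i, vert p j}) \<or>
      (\<exists>k\<in>{1..n}. \<exists>i\<in>{1..b}. e = {vert (k, True) i, vert (k, False) i}) \<or>
      (\<exists>a\<in>A. \<exists>p\<in>{1..n} \<times> UNIV. \<exists>i\<in>{1..b}. e = {a, vert p i})"
    and ord_vert: "p \<in> {1..n} \<times> UNIV \<Longrightarrow> i \<in> {1..b} \<Longrightarrow> j \<in> {1..b} \<Longrightarrow>
      ord (vert p i) < ord (vert p j) \<longleftrightarrow> i < j"
    and ord_cliques: "p \<in> {1..n} \<times> UNIV \<Longrightarrow> q \<in> {1..n} \<times> UNIV \<Longrightarrow> p \<noteq> q \<Longrightarrow> i \<in> {1..b} \<Longrightarrow> j \<in> {1..b} \<Longrightarrow>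
      ord (vert p i) < ord (vert q j) \<longleftrightarrow> ord (vert p 1) < ord (vert q 1)"
    and b3: "b \<ge> 3"
begin

abbreviation P :: "(nat \<times> bool) set" where "P \<equiv> {1..n} \<times> UNIV"

abbreviation Std :: "('v \<Rightarrow>\<^sub>0 nat) set" where "Std \<equiv> indep_monomials G"

lemma finite_P: "finite P" and card_P: "card P = 2 * n" by (simp_all add: card_UNIV_bool)

lemma edge_doubleton: "e \<in> edges G \<Longrightarrow> \<exists>x y. e = {x, y} \<and> x \<noteq> y \<and> x \<in> verts G \<and> y \<in> verts G"
proof -
  assume "e \<in> edges G"
  then consider (1) p i j where "p \<in> P" "i \<in> {1..b}" "j \<in> {1..b}" "i \<noteq> j" "e = {vert p i, vert p j}"
    | (2) k i where "k \<in> {1..n}" "i \<in> {1..b}" "e = {vert (k, True) i, vert (k, False) i}"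
    | (3) a p i where "a \<in> A" "p \<in> P" "i \<in> {1..b}" "e = {a, vert p i}"
    using edges_cases by blast
  then show ?thesis
  proof cases
    case 1
    then have "vert p i \<noteq> vert p j" using vert_inj by auto
    then show ?thesis using 1 unfolding verts_G V_eq by blast
  next
    case 2
    then have "vert (k, True) i \<noteq> vert (k, False) i" using vert_inj[of "(k, True)" "(k, False)" i i] by auto
    then show ?thesis using 2 unfolding verts_G V_eq by blast
  next
    case 3
    then have "a \<noteq> vert p i" using A_disj by blast
    then show ?thesis using 3 unfolding verts_G V_eq by blast
  qed
qed

lemma zero_Std: "0 \<in> Std" using edge_doubleton by (auto simp: indep_monomials_def)

lemma edge_not_sub_A: "e \<in> edges G \<Longrightarrow> \<not> e \<subseteq> A"
  using edges_cases[of e] A_disj by auto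

text \<open>Two vertices of one clique are adjacent, so sending a vertex to its clique is injective
  on an independent set.\<close>

lemma card_indep_le:
  assumes "m \<in> Std" "Poly_Mapping.keys m \<subseteq> V" "Poly_Mapping.keys m \<inter> A = {}"
  shows "card (Poly_Mapping.keys m) \<le> 2 * n"
proof -
  have "\<exists>p. p \<in> P \<and> (\<exists>i\<in>{1..b}. w = vert p i)" if "w \<in> Poly_Mapping.keys m" for w
    using that assms(2,3) unfolding V_eq by blast
  then obtain p where p: "\<And>w. w \<in> Poly_Mapping.keys m \<Longrightarrow> p w \<in> P \<and> (\<exists>i\<in>{1..b}. w = vert (p w) i)" by metis
  have "inj_on p (Poly_Mapping.keys m)"
  proof
    fix v w assume v: "v \<in> Poly_Mapping.keys m" and w: "w \<in> Poly_Mapping.keys m" and eq: "p v = p w"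
    obtain i j where ij: "i \<in> {1..b}" "v = vert (p w) i" "j \<in> {1..b}" "w = vert (p w) j"
      using p[OF v] p[OF w] eq by metis
    show "v = w"
    proof (rule ccontr)
      assume "v \<noteq> w"
      then have "{v, w} \<in> edges G" using clique[of "p w" i j] ij p[OF w] by metis
      then show False using assms(1) v w by (auto simp: indep_monomials_def)
    qed
  qed
  moreover have "p ` Poly_Mapping.keys m \<subseteq> P" using p by blast
  ultimately show ?thesis using card_inj_on_le finite_P card_P by metis
qed

lemma indep_upper:
  assumes e: "e > 2 * int n"
  shows "van (smul Std) j e (stdmod Std :: int \<Rightarrow> (('v \<Rightarrow>\<^sub>0 nat) \<Rightarrow> 'k::field) set)"
proof (rule van_contract[OF down_closed_indep_monomials])
  fix u :: "'v \<Rightarrow> nat"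
  \<comment> \<open>Here \<open>u\<close> is squarefree, so the degree of \<open>m\<close> is the
    size of its support. More than \<open>2 * n\<close> vertices force a vertex of \<open>A\<close>
    into the support, and its adjacency to all clique vertices keeps the rest of the support in
    \<open>A\<close>.\<close>
  have meets: "Poly_Mapping.keys m \<subseteq> A \<and> (\<exists>a\<in>A. u a \<noteq> 0)"
    if u: "\<And>v. u v \<le> 1" and m: "m \<in> Std" "Poly_Mapping.keys m \<subseteq> V" "int (mon_deg m) = e" "mdeg S m = u" for S m
  proof -
    have le: "Poly_Mapping.lookup m v \<le> u v" for v using m(4) by (auto simp: mdeg_def)
    have "mon_deg m = (\<Sum>v\<in>Poly_Mapping.keys m. 1)"
      unfolding mon_deg_def
    proof (rule sum.cong)
      fix v assume "v \<in> Poly_Mapping.keys m"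
      then show "Poly_Mapping.lookup m v = 1" using le[of v] u[of v] by (auto simp: in_keys_iff)
    qed simp
    then have "card (Poly_Mapping.keys m) > 2 * n" using e m(3) by simp
    then obtain a where a: "a \<in> A" "a \<in> Poly_Mapping.keys m" using card_indep_le[OF m(1,2)] by fastforce
    have "w \<in> A" if w: "w \<in> Poly_Mapping.keys m" for w
    proof (rule ccontr)
      assume "w \<notin> A"
      then have "{a, w} \<in> edges G" using w m(2) cone[OF a(1)] unfolding V_eq by blast
      then show False using m(1) a w by (auto simp: indep_monomials_def)
    qed
    moreover have "u a \<noteq> 0" using a(2) le[of a] by (auto simp: in_keys_iff)
    ultimately show ?thesis using a(1) by blast
  qed
  show "\<exists>v. \<forall>S m. S \<subseteq> V \<and> card S = j \<and> m \<in> Std \<and> Poly_Mapping.keys m \<subseteq> V \<and>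
       int (mon_deg m) = e \<and> mdeg S m = u \<longrightarrow>
         (v \<in> S \<or> Poly_Mapping.lookup m v \<noteq> 0) \<and> (v \<in> S \<longrightarrow> m + xvar v \<in> Std)"
  proof (cases "\<exists>v. u v \<ge> 2")
    \<comment> \<open>The exterior part contributes at most 1 to \<open>u v\<close>, so
      \<open>v\<close> divides \<open>m\<close>, and multiplying by it once more leaves the support
      unchanged.\<close>
    case True
    then obtain v where v: "u v \<ge> 2" ..
    have "Poly_Mapping.lookup m v \<noteq> 0 \<and> m + xvar v \<in> Std" if "m \<in> Std" "mdeg S m = u" for S m
    proof -
      have "v \<in> Poly_Mapping.keys m" using v that(2) by (auto simp: mdeg_def in_keys_iff split: if_splits)
      then have "Poly_Mapping.keys (m + xvar v) = Poly_Mapping.keys m" by (auto simp: keys_nat_add)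
      then show ?thesis using that(1) \<open>v \<in> Poly_Mapping.keys m\<close> by (simp add: indep_monomials_def in_keys_iff)
    qed
    then show ?thesis by blast
  next
    case False
    have u: "u v \<le> 1" for v
    proof -
      have "\<not> u v \<ge> 2" using False by blast
      then show ?thesis by simp
    qed
    show ?thesis
    proof (cases "\<exists>a\<in>A. u a \<noteq> 0")
      \<comment> \<open>One vertex of \<open>A\<close> serves all \<open>S\<close> and
        \<open>m\<close> of this multidegree: every such \<open>m\<close> is supported in
        \<open>A\<close>, so is its product with the vertex, and no edge lies inside
        \<open>A\<close>.\<close>
      case True
      then obtain a where a: "a \<in> A" "u a \<noteq> 0" by blast
      have "(a \<in> S \<or> Poly_Mapping.lookup m a \<noteq> 0) \<and> m + xvar a \<in> Std"
        if m: "m \<in> Std" "Poly_Mapping.keys m \<subseteq> V" "int (mon_deg m) = e" "mdeg S m = u" for S m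
      proof -
        have "Poly_Mapping.keys (m + xvar a) \<subseteq> A" using meets[OF u m] a(1) by (simp add: keys_nat_add)
        then have "m + xvar a \<in> Std" using edge_not_sub_A unfolding indep_monomials_def by blast
        moreover have "a \<in> S \<or> Poly_Mapping.lookup m a \<noteq> 0" using a(2) m(4) by (auto simp: mdeg_def split: if_splits)
        ultimately show ?thesis by blast
      qed
      then show ?thesis by blast
    next
      \<comment> \<open>No standard monomial of degree \<open>e\<close> occurs in this multidegree,
        so the requirement is vacuous.\<close>
      case False
      then show ?thesis using meets[OF u] by blast
    qed
  qed
qed

text \<open>
  The first three vertices of all cliques induce $n$ copies of $B_3$, whose independence complex
  is the join of $n$ hexagons. A facet is given by the chosen vertex of each clique.
\<close>

definition fam :: "(nat \<times> bool \<Rightarrow> nat) set" where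
  "fam = {g \<in> P \<rightarrow>\<^sub>E {1..3}. \<forall>k\<in>{1..n}. g (k, True) \<noteq> g (k, False)}"

definition facet :: "(nat \<times> bool \<Rightarrow> nat) \<Rightarrow> 'v set" where
  "facet g = (\<lambda>p. vert p (g p)) ` P"

definition U :: "'v set" where "U = (\<Union>p\<in>P. vert p ` {1..3})"

text \<open>The other facet containing the ridge of \<open>facet g\<close> obtained by deleting the vertex in clique \<open>p\<close>; note $1 + 2 + 3 = 6$.\<close>

definition flip :: "(nat \<times> bool \<Rightarrow> nat) \<Rightarrow> nat \<times> bool \<Rightarrow> nat \<times> bool \<Rightarrow> nat" where
  "flip g p = g(p := 6 - g p - g (fst p, \<not> snd p))"

text \<open>The coefficients of the fundamental cycle of the join of hexagons.\<close>

definition orient :: "(nat \<times> bool \<Rightarrow> nat) \<Rightarrow> 'k::field" where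
  "orient g = (\<Prod>k\<in>{1..n}. if g (k, True) < g (k, False) then 1 else - 1)"

lemma fam_range: "g \<in> fam \<Longrightarrow> p \<in> P \<Longrightarrow> g p \<in> {1..3}"
  unfolding fam_def by (auto simp: PiE_iff)

lemma fam_ne: "g \<in> fam \<Longrightarrow> p \<in> P \<Longrightarrow> g p \<noteq> g (fst p, \<not> snd p)"
proof -
  assume "g \<in> fam" "p \<in> P"
  then have "g (fst p, True) \<noteq> g (fst p, False)" by (auto simp: fam_def)
  then show ?thesis by (cases p; cases "snd p") auto
qed

lemma atLeastAtMost_1_3: "i \<in> {1..3} \<longleftrightarrow> i = 1 \<or> i = 2 \<or> i = (3::nat)" by auto

lemma in_1_b: "i \<in> {1..3} \<Longrightarrow> i \<in> {1..b}" using b3 by auto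

text \<open>Among the pairs in \<open>{1..3}\<close> only 1 and 3 have equal parity, and only they
  are separated by the remaining value. Parity therefore records whether replacing \<open>i\<close>
  by \<open>i'\<close> changes the order relative to \<open>j\<close>.\<close>

lemma third:
  assumes "i \<in> {1..3}" "j \<in> {1..3}" "i \<noteq> j" "i' = 6 - i - (j::nat)"
  shows "i' \<in> {1..3}" "i' \<noteq> j" "i' \<noteq> i" "6 - i' - j = i"
    "(i' < j \<longleftrightarrow> i < j) \<longleftrightarrow> (odd i' \<noteq> odd i)" "(j < i' \<longleftrightarrow> j < i) \<longleftrightarrow> (odd i' \<noteq> odd i)"
  using assms unfolding atLeastAtMost_1_3 by auto

lemma flip_fam:
  assumes g: "g \<in> fam" and p: "p \<in> P"
  shows "flip g p \<in> fam" "flip (flip g p) p = g" "flip g p p \<noteq> g p"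
proof -
  obtain k t where kt: "p = (k, t)" "k \<in> {1..n}" using p by auto
  have q: "(k, \<not> t) \<in> P" using kt by auto
  note T = third[OF fam_range[OF g p] fam_range[OF g q] _ refl]
  have ne: "g p \<noteq> g (k, \<not> t)" using fam_ne[OF g p] by (simp add: kt)
  show "flip g p p \<noteq> g p" using T(3)[OF ne] by (simp add: flip_def kt)
  show "flip (flip g p) p = g" using T(4)[OF ne] by (auto simp: flip_def kt fun_eq_iff)
  have "flip g p \<in> P \<rightarrow>\<^sub>E {1..3}"
    using g T(1)[OF ne] p by (auto simp: flip_def fam_def kt PiE_iff extensional_def)
  moreover have "flip g p (k', True) \<noteq> flip g p (k', False)" if "k' \<in> {1..n}" for k'
    using g that T(2)[OF ne] by (cases t) (auto simp: flip_def fam_def kt)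
  ultimately show "flip g p \<in> fam" by (simp add: fam_def)
qed

text \<open>Either the orientation changes under \<open>flip\<close> or the parity of the chosen
  index does, never both. As \<open>sgs_facet\<close> turns this parity into the sign of the
  boundary, the product of the two signs always changes.\<close>

lemma orient_flip:
  assumes g: "g \<in> fam" and p: "p \<in> P"
  shows "(orient (flip g p) :: 'k::field) = (if odd (flip g p p) = odd (g p) then - orient g else orient g)"
proof -
  obtain k t where kt: "p = (k, t)" "k \<in> {1..n}" using p by auto
  have q: "(k, \<not> t) \<in> P" using kt by auto
  note T = third[OF fam_range[OF g p] fam_range[OF g q] _ refl]
  have ne: "g p \<noteq> g (k, \<not> t)" using fam_ne[OF g p] by (simp add: kt)
  let ?h = "\<lambda>g k. if g (k, True) < g (k, False) then 1 else - 1 :: 'k"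
  have rest: "(\<Prod>k'\<in>{1..n} - {k}. ?h (flip g p) k') = (\<Prod>k'\<in>{1..n} - {k}. ?h g k')"
    by (intro prod.cong) (auto simp: flip_def kt)
  have "?h (flip g p) k = (if odd (flip g p p) = odd (g p) then - ?h g k else ?h g k)"
  proof (cases t)
    case True
    then show ?thesis using T(5)[OF ne] by (auto simp: flip_def kt)
  next
    case False
    then show ?thesis using T(6)[OF ne] T(2)[OF ne] ne by (auto simp: flip_def kt not_less le_less)
  qed
  moreover have "(orient G :: 'k) = ?h G k * (\<Prod>k'\<in>{1..n} - {k}. ?h G k')" for G
    unfolding orient_def by (rule prod.remove) (use kt in auto)
  ultimately show ?thesis by (simp only: rest) simp
qed

section \<open>Facets of the join of hexagons\<close>

lemma facet_sub: "g \<in> fam \<Longrightarrow> facet g \<subseteq> U"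
  unfolding facet_def U_def using fam_range by blast

lemma U_sub: "U \<subseteq> V"
  unfolding U_def V_eq using in_1_b by blast

lemma finite_facet [simp]: "finite (facet g)" using finite_P by (simp add: facet_def)

lemma vert_inj_3:
  "p \<in> P \<Longrightarrow> q \<in> P \<Longrightarrow> i \<in> {1..3} \<Longrightarrow> j \<in> {1..3} \<Longrightarrow> vert p i = vert q j \<longleftrightarrow> p = q \<and> i = j"
  using vert_inj in_1_b by blast

lemma in_facet_iff: "g \<in> fam \<Longrightarrow> p \<in> P \<Longrightarrow> i \<in> {1..b} \<Longrightarrow> vert p i \<in> facet g \<longleftrightarrow> i = g p"
proof
  assume g: "g \<in> fam" and p: "p \<in> P" and i: "i \<in> {1..b}"
  show "i = g p" if "vert p i \<in> facet g"
  proof -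
    obtain q where q: "q \<in> P" "vert p i = vert q (g q)"
      using \<open>vert p i \<in> facet g\<close> unfolding facet_def by blast
    then show ?thesis using vert_inj[OF p q(1) i in_1_b[OF fam_range[OF g q(1)]]] by simp
  qed
qed (auto simp: facet_def)

lemma inj_facet: "g \<in> fam \<Longrightarrow> inj_on (\<lambda>p. vert p (g p)) P"
proof (rule inj_onI)
  fix p q assume g: "g \<in> fam" and p: "p \<in> P" and q: "q \<in> P" and "vert p (g p) = vert q (g q)"
  then show "p = q" using vert_inj_3[OF p q fam_range[OF g p] fam_range[OF g q]] by simp
qed

lemma facet_eqD:
  assumes "g \<in> fam" "g' \<in> fam" "facet g = facet g'"
  shows "g = g'"
proof
  fix p
  show "g p = g' p"
  proof (cases "p \<in> P")
    case True
    then have "vert p (g p) \<in> facet g'" using assms(3) unfolding facet_def by blast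
    then show ?thesis using in_facet_iff[OF assms(2) True in_1_b[OF fam_range[OF assms(1) True]]] by simp
  next
    case False
    moreover have "g \<in> P \<rightarrow>\<^sub>E {1..3}" "g' \<in> P \<rightarrow>\<^sub>E {1..3}" using assms(1,2) by (auto simp: fam_def)
    ultimately show ?thesis using PiE_arb[of g P "\<lambda>_. {1..3}" p] PiE_arb[of g' P "\<lambda>_. {1..3}" p] by simp
  qed
qed

lemma facet_indep: "g \<in> fam \<Longrightarrow> sqfree (facet g) \<in> Std"
proof -
  assume g: "g \<in> fam"
  have "\<not> e \<subseteq> facet g" if "e \<in> edges G" for e
  proof
    assume sub: "e \<subseteq> facet g"
    consider (1) p i j where "p \<in> P" "i \<in> {1..b}" "j \<in> {1..b}" "i \<noteq> j" "e = {vert p i, vert p j}"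
      | (2) k i where "k \<in> {1..n}" "i \<in> {1..b}" "e = {vert (k, True) i, vert (k, False) i}"
      | (3) a where "a \<in> A" "a \<in> e"
      using edges_cases[OF \<open>e \<in> edges G\<close>] by blast
    then show False
    proof cases
      case 1
      then show ?thesis using sub in_facet_iff[OF g] by auto
    next
      case 2
      then have "i = g (k, True)" "i = g (k, False)"
        using sub in_facet_iff[OF g, of "(k, True)" i] in_facet_iff[OF g, of "(k, False)" i] by auto
      moreover have "g (k, True) \<noteq> g (k, False)" using g 2(1) unfolding fam_def by blast
      ultimately show ?thesis by simp
    next
      case 3
      then have "a \<in> facet g" using sub by blast
      then show ?thesis using 3(1) A_disj in_1_b[OF fam_range[OF g]] unfolding facet_def by blast
    qed
  qed
  then show ?thesis by (simp add: indep_monomials_def keys_sqfree)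
qed

text \<open>Every other clique lies entirely before or entirely after clique \<open>p\<close> and
  has two vertices in \<open>U - facet g\<close>, so it contributes an even number. Clique
  \<open>p\<close> itself contributes \<open>g p - 1\<close> earlier vertices.\<close>

lemma sgs_facet:
  assumes g: "g \<in> fam" and p: "p \<in> P"
  shows "sgs (vert p (g p)) (U - facet g) a = (if odd (g p) then a else - a)"
proof -
  let ?B = "\<lambda>q. {i \<in> {1..3}. i \<noteq> g q \<and> ord (vert q i) < ord (vert p (g p))}"
  note gp = in_1_b[OF fam_range[OF g p]]
  have eq: "{w \<in> U - facet g. ord w < ord (vert p (g p))} = (\<Union>q\<in>P. vert q ` ?B q)"
  proof (intro equalityI subsetI)
    fix w assume w: "w \<in> {w \<in> U - facet g. ord w < ord (vert p (g p))}"
    then obtain q i where q: "q \<in> P" "i \<in> {1..3}" "w = vert q i" unfolding U_def by blast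
    then have "i \<noteq> g q" using w in_facet_iff[OF g q(1) in_1_b[OF q(2)]] by simp
    then show "w \<in> (\<Union>q\<in>P. vert q ` ?B q)" using q w by blast
  next
    fix w assume "w \<in> (\<Union>q\<in>P. vert q ` ?B q)"
    then obtain q i where q: "q \<in> P" "i \<in> ?B q" "w = vert q i" by blast
    then have "w \<in> U" unfolding U_def by blast
    moreover have "w \<notin> facet g" using q in_facet_iff[OF g q(1) in_1_b[of i]] by simp
    ultimately show "w \<in> {w \<in> U - facet g. ord w < ord (vert p (g p))}" using q by simp
  qed
  have cardB: "card (vert q ` ?B q) = card (?B q)" if "q \<in> P" for q
    using vert_inj_3[OF that that] by (intro card_image inj_onI) auto
  have "card {w \<in> U - facet g. ord w < ord (vert p (g p))} = (\<Sum>q\<in>P. card (vert q ` ?B q))"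
    unfolding eq
  proof (rule card_UN_disjoint)
    show "\<forall>q\<in>P. \<forall>q'\<in>P. q \<noteq> q' \<longrightarrow> vert q ` ?B q \<inter> vert q' ` ?B q' = {}"
    proof (intro ballI impI)
      fix q q' assume q: "q \<in> P" "q' \<in> P" "q \<noteq> q'"
      have "vert q i \<noteq> vert q' j" if "i \<in> {1..3}" "j \<in> {1..3}" for i j
        using vert_inj_3[OF q(1,2) that] q(3) by simp
      then show "vert q ` ?B q \<inter> vert q' ` ?B q' = {}" by blast
    qed
  qed (use finite_P in auto)
  also have "\<dots> = (\<Sum>q\<in>P. card (?B q))" using cardB by (intro sum.cong) auto
  also have "\<dots> = card (?B p) + (\<Sum>q\<in>P - {p}. card (?B q))"
    using finite_P p by (rule sum.remove)
  finally have card: "card {w \<in> U - facet g. ord w < ord (vert p (g p))} =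
    card (?B p) + (\<Sum>q\<in>P - {p}. card (?B q))" .
  have "even (card (?B q))" if q: "q \<in> P - {p}" for q
  proof -
    have oq: "ord (vert q i) < ord (vert p (g p)) \<longleftrightarrow> ord (vert q 1) < ord (vert p 1)" if "i \<in> {1..3}" for i
      using ord_cliques[of q p i "g p"] q p gp in_1_b[OF that] by blast
    show ?thesis
    proof (cases "ord (vert q 1) < ord (vert p 1)")
      case True
      then have "?B q = {1..3} - {g q}" using oq by auto
      then have "card (?B q) = 2" using fam_range[OF g, of q] q by simp
      then show ?thesis by simp
    next
      case False
      then have "?B q = {}" using oq by auto
      then show ?thesis by (simp only: card.empty even_zero)
    qed
  qed
  then have "even (\<Sum>q\<in>P - {p}. card (?B q))" by (rule dvd_sum)
  moreover have "?B p = {1..<g p}"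
    using ord_vert[OF p _ gp] in_1_b fam_range[OF g p] by auto
  ultimately have "even (card {w \<in> U - facet g. ord w < ord (vert p (g p))}) \<longleftrightarrow> odd (g p)"
    using fam_range[OF g p] unfolding card by auto
  then show ?thesis by (simp add: sgs_def)
qed

lemma facet_Diff:
  assumes "g \<in> fam" "p \<in> P"
  shows "facet g - {vert p (g p)} = (\<lambda>q. vert q (g q)) ` (P - {p})"
  using inj_on_image_set_diff[OF inj_facet[OF assms(1)], of P "{p}"] assms(2) by (simp add: facet_def)

lemma facet_Diff_flip:
  assumes "g \<in> fam" "p \<in> P"
  shows "facet (flip g p) - {vert p (flip g p p)} = facet g - {vert p (g p)}"
  unfolding facet_Diff[OF assms] facet_Diff[OF flip_fam(1)[OF assms] assms(2)]
  by (intro image_cong) (auto simp: flip_def)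

lemma finite_fam: "finite fam"
  unfolding fam_def using finite_PiE[OF finite_P, of "\<lambda>_. {1..3::nat}"] by simp

definition g0 :: "nat \<times> bool \<Rightarrow> nat" where
  "g0 = (\<lambda>p. if p \<in> P then if snd p then 1 else 2 else undefined)"

lemma g0_fam: "g0 \<in> fam" by (auto simp: fam_def g0_def PiE_iff extensional_def)

text \<open>In the squarefree multidegree of \<open>U\<close> a face sits in the monomial and its
  complement in the exterior part. Read this way, the Koszul boundary at a facet is a simplicial
  coboundary: a signed sum over the ridges of the facet.\<close>

lemma bd_facet:
  assumes g: "g \<in> fam"
  shows "bd (smul Std) c (U - facet g) (sqfree (facet g)) =
    (\<Sum>p\<in>P. if odd (g p) then c (U - (facet g - {vert p (g p)})) (sqfree (facet g - {vert p (g p)}))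
      else - c (U - (facet g - {vert p (g p)})) (sqfree (facet g - {vert p (g p)})))"
proof -
  have W: "{w \<in> V - (U - facet g). Poly_Mapping.lookup (sqfree (facet g)) w \<noteq> 0} = facet g"
    using facet_sub[OF g] U_sub by (auto simp: lookup_sqfree split: if_splits)
  have ins: "insert w (U - facet g) = U - (facet g - {w})" if "w \<in> facet g" for w
    using that facet_sub[OF g] by auto
  have "bd (smul Std) c (U - facet g) (sqfree (facet g)) =
      (\<Sum>w\<in>facet g. sgs w (U - facet g) (c (insert w (U - facet g)) (sqfree (facet g) - xvar w)))"
  proof -
    have "U - facet g \<subseteq> V" using U_sub by blast
    then show ?thesis using facet_indep[OF g] by (simp only: bd_smul_apply W simp_thms if_True)
  qed
  also have "\<dots> = (\<Sum>w\<in>facet g. sgs w (U - facet g) (c (U - (facet g - {w})) (sqfree (facet g - {w}))))"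
    by (intro sum.cong) (auto simp: ins sqfree_minus)
  also have "\<dots> = (\<Sum>p\<in>P. sgs (vert p (g p)) (U - facet g) (c (U - (facet g - {vert p (g p)})) (sqfree (facet g - {vert p (g p)}))))"
    unfolding facet_def[of g] using inj_facet[OF g] by (subst sum.reindex) auto
  also have "\<dots> = (\<Sum>p\<in>P. if odd (g p) then c (U - (facet g - {vert p (g p)})) (sqfree (facet g - {vert p (g p)}))
      else - c (U - (facet g - {vert p (g p)})) (sqfree (facet g - {vert p (g p)})))"
    by (intro sum.cong refl sgs_facet g)
  finally show ?thesis .
qed

text \<open>Pairs of a facet and a vertex to delete are matched by \<open>flip\<close>, which keeps
  the ridge and reverses the sign. So the fundamental cycle pairs to 0 with every
  coboundary.\<close>

lemma orient_bd:
  "(\<Sum>g\<in>fam. orient g * bd (smul Std) c (U - facet g) (sqfree (facet g))) = (0 :: 'k::field)"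
proof -
  define R where "R g p = facet g - {vert p (g p)}" for g p
  define f where "f = (\<lambda>(g, p). orient g * (if odd (g p) then c (U - R g p) (sqfree (R g p)) else - c (U - R g p) (sqfree (R g p))))"
  have "(\<Sum>g\<in>fam. orient g * bd (smul Std) c (U - facet g) (sqfree (facet g))) = (\<Sum>g\<in>fam. \<Sum>p\<in>P. f (g, p))"
    by (intro sum.cong refl) (simp only: bd_facet sum_distrib_left f_def R_def split_conv)
  also have "\<dots> = sum f (fam \<times> P)" by (simp add: sum.cartesian_product)
  also have "\<dots> = 0"
  proof (rule sum_involution_zero[where \<sigma> = "\<lambda>(g, p). (flip g p, p)"])
    show "finite (fam \<times> P)" using finite_fam finite_P by blast
    fix x assume "x \<in> fam \<times> P"
    then obtain g p where x: "x = (g, p)" "g \<in> fam" "p \<in> P" by blast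
    note F = flip_fam[OF x(2,3)]
    show "(case x of (g, p) \<Rightarrow> (flip g p, p)) \<in> fam \<times> P" using F(1) x by simp
    show "(case case x of (g, p) \<Rightarrow> (flip g p, p) of (g, p) \<Rightarrow> (flip g p, p)) = x" using F(2) x by simp
    show "(case x of (g, p) \<Rightarrow> (flip g p, p)) \<noteq> x" using F(3) x by auto
    have "R (flip g p) p = R g p" unfolding R_def by (rule facet_Diff_flip[OF x(2,3)])
    then show "f (case x of (g, p) \<Rightarrow> (flip g p, p)) = - f x"
      by (simp add: x(1) f_def orient_flip[OF x(2,3)])
  qed
  finally show ?thesis .
qed

text \<open>A facet supplies \<open>2 * n\<close> vertices to the monomial and the exterior part the
  rest of \<open>U\<close>, so this is the position of the top cohomology of the sphere.\<close>

lemma indep_lower: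
  "\<not> van (smul Std) (card (U - facet g0)) (2 * int n) (stdmod Std :: int \<Rightarrow> (('v \<Rightarrow>\<^sub>0 nat) \<Rightarrow> 'k::field) set)"
proof
  assume v: "van (smul Std) (card (U - facet g0)) (2 * int n) (stdmod Std :: int \<Rightarrow> (('v \<Rightarrow>\<^sub>0 nat) \<Rightarrow> 'k) set)"
  define c :: "'v set \<Rightarrow> ('v \<Rightarrow>\<^sub>0 nat) \<Rightarrow> 'k"
    where "c = (\<lambda>T m. if T = U - facet g0 \<and> m = sqfree (facet g0) then 1 else 0)"
  have "card (facet g0) = 2 * n" unfolding facet_def using card_image[OF inj_facet[OF g0_fam]] card_P by simp
  then have "c T \<in> stdmod Std (2 * int n)" for T
    using facet_indep[OF g0_fam] facet_sub[OF g0_fam] U_sub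
    by (auto simp: c_def stdmod_def keys_sqfree mon_deg_sqfree split: if_splits)
  moreover have "c T = 0" if "\<not> (T \<subseteq> V \<and> card T = card (U - facet g0))" for T
    using that U_sub by (auto simp: c_def fun_eq_iff)
  ultimately have c: "c \<in> chains (card (U - facet g0)) (stdmod Std (2 * int n))"
    by (auto simp: chains_def)
  have "bd (smul Std) c S m = 0" for S m
  proof (cases "S \<subseteq> V \<and> m \<in> Std")
    case True
    \<comment> \<open>The cochain of a facet is a cocycle because facets are maximal among
      independent sets inside \<open>U\<close>: a further vertex \<open>w\<close> would lie in a
      clique already represented.\<close>
    have "c (insert w S) (m - xvar w) = 0" if w: "w \<in> V - S" "Poly_Mapping.lookup m w \<noteq> 0" for w
    proof (rule ccontr)
      assume "c (insert w S) (m - xvar w) \<noteq> 0"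
      then have eq: "insert w S = U - facet g0" "m - xvar w = sqfree (facet g0)"
        by (auto simp: c_def split: if_splits)
      then have "w \<in> U" "w \<notin> facet g0" by auto
      then obtain p i where pi: "p \<in> P" "i \<in> {1..3}" "w = vert p i" unfolding U_def by blast
      then have "i \<noteq> g0 p" using \<open>w \<notin> facet g0\<close> in_facet_iff[OF g0_fam pi(1) in_1_b[OF pi(2)]] by simp
      then have e: "{vert p i, vert p (g0 p)} \<in> edges G"
        using clique pi in_1_b fam_range[OF g0_fam pi(1)] by blast
      have "Poly_Mapping.keys m = insert w (facet g0)"
        using minus_xvar_add[OF w(2)] keys_nat_add[of "sqfree (facet g0)" "xvar w"] by (simp add: eq(2) keys_sqfree)
      moreover have "vert p (g0 p) \<in> facet g0" using pi(1) unfolding facet_def by blast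
      ultimately have "{vert p i, vert p (g0 p)} \<subseteq> Poly_Mapping.keys m" using pi(3) by simp
      then show False using True e unfolding indep_monomials_def by blast
    qed
    then show ?thesis by (simp add: bd_smul_apply)
  next
    case False
    then show ?thesis by (auto simp: bd_smul_apply)
  qed
  then have "bd (smul Std) c = (\<lambda>_. 0)" by (auto simp: fun_eq_iff)
  then obtain h where h: "bd (smul Std) h = c" using v c unfolding van_def by blast
  have "c (U - facet g) (sqfree (facet g)) = (if g = g0 then 1 else 0)" if g: "g \<in> fam" for g
  proof -
    have "facet g = facet g0" if "sqfree (facet g) = sqfree (facet g0)"
      using arg_cong[OF that, of Poly_Mapping.keys] by (simp add: keys_sqfree)
    then show ?thesis using facet_eqD[OF g g0_fam] by (auto simp: c_def)
  qed
  then have "(\<Sum>g\<in>fam. orient g * c (U - facet g) (sqfree (facet g))) = (\<Sum>g\<in>fam. if g = g0 then orient g else 0)"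
    by (intro sum.cong) auto
  also have "\<dots> = orient g0" using finite_fam g0_fam by simp
  \<comment> \<open>The pairing with the cochain of the facet of \<open>g0\<close> is a product of
    signs, which is nonzero in every field.\<close>
  finally have "orient g0 = (0 :: 'k)" using orient_bd[of h] h by simp
  then show False by (auto simp: orient_def split: if_splits)
qed

lemma graph_reg_joined_prisms: "graph_reg TYPE('k::field) G = 2 * int n"
proof -
  have "quotient_reg V (monomial_ideal V Std :: ('v, 'k) mpoly set) = 2 * int n"
    by (rule quotient_reg_eqI[OF down_closed_indep_monomials zero_Std indep_upper indep_lower])
  moreover have "(edge_ideal G :: ('v, 'k) mpoly set) = monomial_ideal V Std"
    unfolding verts_G[symmetric] by (rule edge_ideal_eq_monomial_ideal[OF edge_doubleton])
  ultimately show ?thesis by (simp add: graph_reg_def verts_G)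
qed

end


section \<open>The two graph families\<close>

definition prism_vert :: "nat \<times> bool \<Rightarrow> nat \<Rightarrow> nat \<times> (nat + nat)" where
  "prism_vert p i = (fst p, if snd p then Inl i else Inr i)"

definition clique_nr :: "nat \<times> bool \<Rightarrow> nat" where
  "clique_nr p = 2 * fst p + of_bool (\<not> snd p)"

text \<open>Each clique occupies a block of \<open>b + 1\<close> consecutive numbers. Indices at
  most \<open>b\<close> stay inside their block, so comparing vertices of different cliques amounts
  to comparing the cliques.\<close>

definition prism_ord :: "nat \<Rightarrow> nat \<times> (nat + nat) \<Rightarrow> nat" where
  "prism_ord b w = (case snd w of Inl i \<Rightarrow> clique_nr (fst w, True) * (b + 1) + i
     | Inr i \<Rightarrow> clique_nr (fst w, False) * (b + 1) + i)"

lemma prism_vert_eq_iff [simp]: "prism_vert p i = prism_vert q j \<longleftrightarrow> p = q \<and> i = j"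
  by (cases p; cases q) (auto simp: prism_vert_def)

lemma clique_nr_eq_iff [simp]: "clique_nr p = clique_nr q \<longleftrightarrow> p = q"
proof
  assume eq: "clique_nr p = clique_nr q"
  then have "even (clique_nr p) \<longleftrightarrow> even (clique_nr q)" by simp
  then have "snd p = snd q" by (cases "snd p"; cases "snd q") (simp_all add: clique_nr_def)
  then show "p = q" using eq by (simp add: clique_nr_def prod_eq_iff)
qed simp

lemma prism_ord_vert: "prism_ord b (prism_vert p i) = clique_nr p * (b + 1) + i"
  by (cases p) (simp add: prism_ord_def prism_vert_def)

lemma block_less_iff:
  assumes "i \<le> b" "j \<le> (b :: nat)"
  shows "q * (b + 1) + i < r * (b + 1) + j \<longleftrightarrow> q < r \<or> q = r \<and> i < j"
proof -
  have "q * (b + 1) + i < r * (b + 1) + j" if "q < r" "i \<le> b" for q r i j :: nat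
  proof -
    have "q * (b + 1) + i < (q + 1) * (b + 1)" using that by simp
    also have "\<dots> \<le> r * (b + 1)" using that by (intro mult_right_mono) auto
    finally show ?thesis by simp
  qed
  from this[of q r i j] this[of r q j i] show ?thesis
    using assms by (cases q r rule: linorder_cases) auto
qed

lemma prism_ord_less_iff:
  "i \<in> {1..b} \<Longrightarrow> j \<in> {1..b} \<Longrightarrow>
    prism_ord b (prism_vert p i) < prism_ord b (prism_vert q j) \<longleftrightarrow>
      clique_nr p < clique_nr q \<or> p = q \<and> i < j"
  unfolding prism_ord_vert using block_less_iff[of i b j] by simp

lemma prism_ord_eq_iff:
  assumes "i \<in> {1..b}" "j \<in> {1..b}"
  shows "prism_ord b (prism_vert p i) = prism_ord b (prism_vert q j) \<longleftrightarrow> p = q \<and> i = j"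
proof
  assume "prism_ord b (prism_vert p i) = prism_ord b (prism_vert q j)"
  then have "\<not> (clique_nr p < clique_nr q \<or> p = q \<and> i < j)" "\<not> (clique_nr q < clique_nr p \<or> q = p \<and> j < i)"
    using prism_ord_less_iff[OF assms, of p q] prism_ord_less_iff[OF assms(2,1), of q p] by simp_all
  then have "clique_nr p = clique_nr q" "p = q \<longrightarrow> i = j" by auto
  then show "p = q \<and> i = j" by simp
qed simp

lemma verts_copies: "verts (copies n (graph_B b)) = (\<Union>p\<in>{1..n} \<times> UNIV. prism_vert p ` {1..b})"
proof -
  have "prism_vert (k, True) ` {1..b} = Pair k ` Inl ` {1..b}" "prism_vert (k, False) ` {1..b} = Pair k ` Inr ` {1..b}" for k
    by (simp_all add: prism_vert_def image_image)
  then have "(\<Union>t. prism_vert (k, t) ` {1..b}) = Pair k ` (Inl ` {1..b} \<union> Inr ` {1..b})" for k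
    by (simp add: UNIV_bool image_Un Un_commute)
  moreover have "(\<Union>p\<in>{1..n} \<times> UNIV. prism_vert p ` {1..b}) = (\<Union>k\<in>{1..n}. \<Union>t. prism_vert (k, t) ` {1..b})"
    by blast
  ultimately show ?thesis by (auto simp: copies_def graph_B_def)
qed

lemma edges_graph_B: "edges (graph_B b) = {{Inl i, Inl j} | i j. 1 \<le> i \<and> i < j \<and> j \<le> b}
    \<union> {{Inr i, Inr j} | i j. 1 \<le> i \<and> i < j \<and> j \<le> b} \<union> {{Inl i, Inr i} | i. 1 \<le> i \<and> i \<le> b}"
  by (simp add: graph_B_def)

lemma edges_copies_iff:
  "e \<in> edges (copies n (graph_B b)) \<longleftrightarrow>
    (\<exists>p\<in>{1..n} \<times> UNIV. \<exists>i\<in>{1..b}. \<exists>j\<in>{1..b}. i \<noteq> j \<and> e = {prism_vert p i, prism_vert p j}) \<or>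
    (\<exists>k\<in>{1..n}. \<exists>i\<in>{1..b}. e = {prism_vert (k, True) i, prism_vert (k, False) i})" (is "?L \<longleftrightarrow> ?R")
proof
  assume ?L
  then obtain k e' where k: "k \<in> {1..n}" "e = Pair k ` e'" "e' \<in> edges (graph_B b)"
    unfolding copies_def by auto
  have "(\<exists>i j. 1 \<le> i \<and> i < j \<and> j \<le> b \<and> (e' = {Inl i, Inl j} \<or> e' = {Inr i, Inr j})) \<or>
      (\<exists>i. 1 \<le> i \<and> i \<le> b \<and> e' = {Inl i, Inr i})"
    using k(3) unfolding edges_graph_B by blast
  then consider (1) i j where "i \<in> {1..b}" "j \<in> {1..b}" "i < j" "e' = {Inl i, Inl j}"
    | (2) i j where "i \<in> {1..b}" "j \<in> {1..b}" "i < j" "e' = {Inr i, Inr j}"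
    | (3) i where "i \<in> {1..b}" "e' = {Inl i, Inr i}"
    by (elim disjE exE conjE) simp_all
  then show ?R
  proof cases
    case 1
    then show ?thesis using k
      by (intro disjI1 bexI[of _ "(k, True)"] bexI[of _ i] bexI[of _ j]) (auto simp: prism_vert_def)
  next
    case 2
    then show ?thesis using k
      by (intro disjI1 bexI[of _ "(k, False)"] bexI[of _ i] bexI[of _ j]) (auto simp: prism_vert_def)
  next
    case 3
    then have "e = {prism_vert (k, True) i, prism_vert (k, False) i}" using k(2) by (simp add: prism_vert_def)
    then show ?thesis using k(1) 3(1) by blast
  qed
next
  have cop: "Pair k ` e' \<in> edges (copies n (graph_B b))" if "k \<in> {1..n}" "e' \<in> edges (graph_B b)" for k e'
    using that by (auto simp: copies_def)
  have lt: "{prism_vert p i, prism_vert p j} \<in> edges (copies n (graph_B b))"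
    if "p \<in> {1..n} \<times> UNIV" "i \<in> {1..b}" "j \<in> {1..b}" "i < j" for p i j
  proof (cases "snd p")
    case True
    have "{Inl i, Inl j} \<in> edges (graph_B b)" unfolding edges_graph_B using that(2-4) by auto
    then show ?thesis using cop[of "fst p" "{Inl i, Inl j}"] that(1) True by (auto simp: prism_vert_def)
  next
    case False
    have "{Inr i, Inr j} \<in> edges (graph_B b)" unfolding edges_graph_B using that(2-4) by auto
    then show ?thesis using cop[of "fst p" "{Inr i, Inr j}"] that(1) False by (auto simp: prism_vert_def)
  qed
  assume ?R
  then show ?L
  proof
    assume "\<exists>p\<in>{1..n} \<times> UNIV. \<exists>i\<in>{1..b}. \<exists>j\<in>{1..b}. i \<noteq> j \<and> e = {prism_vert p i, prism_vert p j}"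
    then obtain p i j where e: "p \<in> {1..n} \<times> UNIV" "i \<in> {1..b}" "j \<in> {1..b}" "i \<noteq> j" "e = {prism_vert p i, prism_vert p j}"
      by blast
    then consider "i < j" | "j < i" by linarith
    then show ?thesis using lt[OF e(1-3)] lt[OF e(1,3,2)] e(5) by cases (auto simp: insert_commute)
  next
    assume "\<exists>k\<in>{1..n}. \<exists>i\<in>{1..b}. e = {prism_vert (k, True) i, prism_vert (k, False) i}"
    then obtain k i where ki: "k \<in> {1..n}" "i \<in> {1..b}" "e = {prism_vert (k, True) i, prism_vert (k, False) i}" by blast
    then have "{Inl i, Inr i} \<in> edges (graph_B b)" unfolding edges_graph_B by auto
    from cop[OF ki(1) this] show ?thesis using ki(3) by (simp add: prism_vert_def)
  qed
qed

lemma inj_on_prism_ord: "inj_on (prism_ord b) (\<Union>p\<in>{1..n} \<times> UNIV. prism_vert p ` {1..b})"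
proof (rule inj_onI)
  fix x y assume "x \<in> (\<Union>p\<in>{1..n} \<times> UNIV. prism_vert p ` {1..b})" "y \<in> (\<Union>p\<in>{1..n} \<times> UNIV. prism_vert p ` {1..b})"
    and eq: "prism_ord b x = prism_ord b y"
  then obtain p i q j where "x = prism_vert p i" "y = prism_vert q j" "i \<in> {1..b}" "j \<in> {1..b}" by blast
  then show "x = y" using eq prism_ord_eq_iff[of i b j p q] by simp
qed

text \<open>The disjoint union alone is the case of an empty \<open>A\<close>, so one locale yields
  both regularities.\<close>

lemma joined_prisms_copies:
  assumes "b \<ge> 3"
  shows "joined_prisms (verts (copies n (graph_B b))) (prism_ord b) (copies n (graph_B b)) {} n b prism_vert"
proof
  let ?G = "copies n (graph_B b)" and ?P = "{1..n} \<times> (UNIV :: bool set)"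
  show "finite (verts ?G)" by (simp add: verts_copies)
  show "inj_on (prism_ord b) (verts ?G)" unfolding verts_copies by (rule inj_on_prism_ord)
  show "verts ?G = {} \<union> (\<Union>p\<in>?P. prism_vert p ` {1..b})" by (simp add: verts_copies)
  show "e \<in> edges ?G \<Longrightarrow>
      (\<exists>p\<in>?P. \<exists>i\<in>{1..b}. \<exists>j\<in>{1..b}. i \<noteq> j \<and> e = {prism_vert p i, prism_vert p j}) \<or>
      (\<exists>k\<in>{1..n}. \<exists>i\<in>{1..b}. e = {prism_vert (k, True) i, prism_vert (k, False) i}) \<or>
      (\<exists>a\<in>{}. \<exists>p\<in>?P. \<exists>i\<in>{1..b}. e = {a, prism_vert p i})" for e
    unfolding edges_copies_iff by blast
  show "p \<in> ?P \<Longrightarrow> i \<in> {1..b} \<Longrightarrow> j \<in> {1..b} \<Longrightarrow> i \<noteq> j \<Longrightarrow> {prism_vert p i, prism_vert p j} \<in> edges ?G"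
    for p i j unfolding edges_copies_iff by blast
  show "p \<in> ?P \<Longrightarrow> i \<in> {1..b} \<Longrightarrow> j \<in> {1..b} \<Longrightarrow>
      prism_ord b (prism_vert p i) < prism_ord b (prism_vert p j) \<longleftrightarrow> i < j" for p i j
    using prism_ord_less_iff[of i b j p p] by simp
  show "p \<noteq> q \<Longrightarrow> i \<in> {1..b} \<Longrightarrow> j \<in> {1..b} \<Longrightarrow>
      prism_ord b (prism_vert p i) < prism_ord b (prism_vert q j) \<longleftrightarrow>
      prism_ord b (prism_vert p 1) < prism_ord b (prism_vert q 1)" for p q i j
    using prism_ord_less_iff[of i b j p q] prism_ord_less_iff[of 1 b 1 p q] assms by simp
qed (use assms in auto)

text \<open>Doubling \<open>prism_ord\<close> preserves all comparisons between clique vertices and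
  leaves the odd numbers to the vertices of the edgeless graph, which keeps the order
  injective.\<close>

lemma joined_prisms_graph_join:
  fixes a n b :: nat
  assumes "b \<ge> 3"
  defines "G \<equiv> graph_join (edgeless a) (copies n (graph_B b))"
  shows "joined_prisms (verts G) (case_sum (\<lambda>u. 2 * u + 1) (\<lambda>w. 2 * prism_ord b w)) G (Inl ` {1..a}) n b
    (\<lambda>p i. Inr (prism_vert p i))"
proof
  let ?P = "{1..n} \<times> (UNIV :: bool set)" and ?H = "copies n (graph_B b)"
  show V: "verts G = Inl ` {1..a} \<union> (\<Union>p\<in>?P. (\<lambda>i. Inr (prism_vert p i)) ` {1..b})"
    by (auto simp: G_def graph_join_def edgeless_def verts_copies)
  have E: "edges G = (\<lambda>e. Inr ` e) ` edges ?H \<union> {{Inl u, Inr v} | u v. u \<in> {1..a} \<and> v \<in> verts ?H}"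
    by (simp add: G_def graph_join_def edgeless_def)
  show "finite (verts G)" unfolding V by simp
  show "inj_on (case_sum (\<lambda>u. 2 * u + 1) (\<lambda>w. 2 * prism_ord b w)) (verts G)"
  proof (rule inj_onI)
    fix x y assume xy: "x \<in> verts G" "y \<in> verts G"
      "case_sum (\<lambda>u. 2 * u + 1) (\<lambda>w. 2 * prism_ord b w) x = case_sum (\<lambda>u. 2 * u + 1) (\<lambda>w. 2 * prism_ord b w) y"
    have odd: "2 * u + 1 \<noteq> 2 * (v :: nat)" for u v by presburger
    show "x = y"
    proof (cases x)
      case (Inl u)
      then show ?thesis using xy(3) odd by (cases y) auto
    next
      case (Inr w)
      then obtain w' where w': "y = Inr w'" using xy(3) odd[symmetric] by (cases y) auto
      have "w \<in> (\<Union>p\<in>?P. prism_vert p ` {1..b})" "w' \<in> (\<Union>p\<in>?P. prism_vert p ` {1..b})"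
        using xy(1,2) Inr w' unfolding V by auto
      then show ?thesis using inj_onD[OF inj_on_prism_ord, of b w w' n] xy(3) Inr w' by simp
    qed
  qed
  show "{Inr (prism_vert p i), Inr (prism_vert p j)} \<in> edges G"
    if "p \<in> ?P" "i \<in> {1..b}" "j \<in> {1..b}" "i \<noteq> j" for p i j
  proof -
    have "{prism_vert p i, prism_vert p j} \<in> edges ?H" unfolding edges_copies_iff using that by blast
    then have "Inr ` {prism_vert p i, prism_vert p j} \<in> edges G" unfolding E by blast
    then show ?thesis by simp
  qed
  show "{x, Inr (prism_vert p i)} \<in> edges G" if "x \<in> Inl ` {1..a}" "p \<in> ?P" "i \<in> {1..b}" for x p i
    using that unfolding E verts_copies by blast
  show "(\<exists>p\<in>?P. \<exists>i\<in>{1..b}. \<exists>j\<in>{1..b}. i \<noteq> j \<and> e = {Inr (prism_vert p i), Inr (prism_vert p j)}) \<or>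
      (\<exists>k\<in>{1..n}. \<exists>i\<in>{1..b}. e = {Inr (prism_vert (k, True) i), Inr (prism_vert (k, False) i)}) \<or>
      (\<exists>x\<in>Inl ` {1..a}. \<exists>p\<in>?P. \<exists>i\<in>{1..b}. e = {x, Inr (prism_vert p i)})" if e: "e \<in> edges G" for e
  proof -
    consider (1) e' where "e' \<in> edges ?H" "e = Inr ` e'" | (2) u v where "u \<in> {1..a}" "v \<in> verts ?H" "e = {Inl u, Inr v}"
      using e unfolding E by blast
    then show ?thesis
    proof cases
      case 1
      then consider p i j where "p \<in> ?P" "i \<in> {1..b}" "j \<in> {1..b}" "i \<noteq> j" "e' = {prism_vert p i, prism_vert p j}"
        | k i where "k \<in> {1..n}" "i \<in> {1..b}" "e' = {prism_vert (k, True) i, prism_vert (k, False) i}"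
        unfolding edges_copies_iff by blast
      then show ?thesis
      proof cases
        case 1
        then have "e = {Inr (prism_vert p i), Inr (prism_vert p j)}" using \<open>e = Inr ` e'\<close> by simp
        then show ?thesis using 1 by blast
      next
        case 2
        then have "e = {Inr (prism_vert (k, True) i), Inr (prism_vert (k, False) i)}" using \<open>e = Inr ` e'\<close> by simp
        then show ?thesis using 2(1,2) by blast
      qed
    next
      case 2
      then show ?thesis unfolding verts_copies by blast
    qed
  qed
  show "case_sum (\<lambda>u. 2 * u + 1) (\<lambda>w. 2 * prism_ord b w) (Inr (prism_vert p i))
      < case_sum (\<lambda>u. 2 * u + 1) (\<lambda>w. 2 * prism_ord b w) (Inr (prism_vert p j)) \<longleftrightarrow> i < j"
    if "i \<in> {1..b}" "j \<in> {1..b}" for p i j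
    using prism_ord_less_iff[OF that, of p p] by simp
  show "case_sum (\<lambda>u. 2 * u + 1) (\<lambda>w. 2 * prism_ord b w) (Inr (prism_vert p i))
      < case_sum (\<lambda>u. 2 * u + 1) (\<lambda>w. 2 * prism_ord b w) (Inr (prism_vert q j)) \<longleftrightarrow>
      case_sum (\<lambda>u. 2 * u + 1) (\<lambda>w. 2 * prism_ord b w) (Inr (prism_vert p 1))
      < case_sum (\<lambda>u. 2 * u + 1) (\<lambda>w. 2 * prism_ord b w) (Inr (prism_vert q 1))"
    if "p \<noteq> q" "i \<in> {1..b}" "j \<in> {1..b}" for p q i j
    using prism_ord_less_iff[OF that(2,3), of p q] prism_ord_less_iff[of 1 b 1 p q] assms that(1) by simp
qed (use assms in auto)

theorem theorem5p4:
  fixes a n b :: nat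
  assumes "a \<ge> 1" and "n \<ge> 1" and "b \<ge> 3"
  shows "graph_reg TYPE('k::field) (copies n (graph_B b)) = 2 * int n \<and>
         graph_reg TYPE('k::field) (graph_join (edgeless a) (copies n (graph_B b))) = 2 * int n"
  using joined_prisms.graph_reg_joined_prisms[OF joined_prisms_copies[OF assms(3)]]
    joined_prisms.graph_reg_joined_prisms[OF joined_prisms_graph_join[OF assms(3)]]
  by blast

end
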